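(* Let $f_\varepsilon\in\mathbb{L}_2(\mathbb{R})$ with $f_\varepsilon^*(x)\neq 0$ for all $x\in\mathbb{R}$, and assume that there are constants $\kappa_0,\kappa_0'>0$, $\gamma,\mu,\delta\ge 0$ (with $\mu>0$ if $\delta>0$) such that for all $x\in\mathbb{R}$ $$\kappa_0(x^2+1)^{-\gamma/2}\exp\{-\mu|x|^\delta\}\le |f_\varepsilon^*(x)|\le \kappa_0'(x^2+1)^{-\gamma/2}\exp\{-\mu|x|^\delta\}.$$ Assume that $g\in\mathbb{L}_2(\mathbb{R})$ with $\int x^2g^2(x)\,dx\le M_2<\infty$ for some $M_2>0$, that $g$ belongs to $$\mathcal{S}_{s,r,b}(C_1)=\Big\{\psi:\ \int_{-\infty}^{+\infty}|\psi^*(x)|^2(x^2+1)^s\exp\{2b|x|^r\}\,dx\le C_1\Big\}$$ for some nonnegative numbers $s,r,b$ and some finite $C_1$, and that $k_n\ge n$. Assume either that 1. $\sum_{k\ge1}\beta_1(k)<+\infty$; or 2. $\delta=0$, $\gamma>1$ and $\sum_{k\ge1}\tau_1(k)<+\infty$; or 3. $\delta>0$ and $\sum_{k\ge1}\tau_1(k)<+\infty$. Then $\hat g_m^{(n)}$ satisfies $$\mathbb{E}\|g-\hat g_m^{(n)}\|^2\le\frac{C_1}{2\pi}(m^2\pi^2+1)^{-s}\exp\{-2b\pi^rm^r\}+\frac{2\lambda_1(f_\varepsilon,\kappa_0)\Gamma(m)}{n}+\frac{C_2}{n}\Gamma(m)\,o_m(1),$$ where $C_2$ is a finite constant depending on $\sum_{k\ge1}\beta_1(k)$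 in case 1 (respectively on $\sum_{k\ge1}\tau_1(k)$ in cases 2 and 3), and $o_m(1)$ denotes a term, depending on $m$, which tends to $0$ as $m\to\infty$.
   Context: **Model.** $((Y_t,\sigma_t))_{t\ge0}$ is a strictly stationary sequence of $\mathbb{R}\times\mathbb{R}^+$-valued random variables with $Y_t=\sigma_t\eta_t$, where $(\eta_t)_{t\in\mathbb{Z}}$ is a sequence of i.i.d. random variables with mean zero and finite variance and, for each $t\ge0$, the random vector $(\sigma_i,\eta_{i-1})_{0\le i\le t}$ is independent of the sequence $(\eta_i)_{i\ge t}$. Put $Z_t=\ln(Y_t^2)$, $X_t=\ln(\sigma_t^2)$, $\varepsilon_t=\ln(\eta_t^2)$, so $Z_t=X_t+\varepsilon_t$. The variable $X_t$ has (unknown) density $g$, and $\varepsilon_t$ has (known) density $f_\varepsilon$. One observes $Z_1,\dots,Z_n$. **Notation.** $u^*(x)=\int e^{itx}u(t)\,dt$ is the Fourier transform; $\|\cdot\|$ is the $\mathbb{L}_2(\mathbb{R})$ norm; $$\Gamma(m)=(1+(\pi m)^2)^\gamma(\pi m)^{1-\delta}\exp\{2\mu(\pi m)^\delta\},\qquad \lambda_1(f_\varepsilon,\kappa_0)=\frac1{\kappa_0^2\pi R(\mu,\delta)},$$ with $R(\mu,\delta)=1$ if $\delta=0$ and $R(\mu,\delta)=2\mu\delta$ if $\delta>0$. **Dependence coefficients.** Let $W_t=(Z_t,X_t)$. For a $\sigma$-algebra $\mathcal{M}$ and an $\mathbb{R}^2$-valued random vector $W$ with distribution $\mathbb{P}_W$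 and conditional distribution $\mathbb{P}_{W|\mathcal{M}}$ given $\mathcal{M}$, let $$\beta(\mathcal{M},\sigma(W))=\mathbb{E}\Big(\sup_{A\in\mathcal{B}(\mathbb{R}^2)}|\mathbb{P}_{W|\mathcal{M}}(A)-\mathbb{P}_W(A)|\Big)$$ and, if $\mathbb{E}\|W\|_{\mathbb{R}^2}<\infty$, $$\tau(\mathcal{M},W)=\mathbb{E}\Big(\sup_{f\in\Lambda_1(\mathbb{R}^2)}|\mathbb{P}_{W|\mathcal{M}}(f)-\mathbb{P}_W(f)|\Big),$$ where $\Lambda_1(\mathbb{R}^2)$ is the set of functions $\mathbb{R}^2\to\mathbb{R}$ that are 1-Lipschitz for the norm $\|x-y\|_{\mathbb{R}^2}=|x_1-y_1|+|x_2-y_2|$. Then $\beta_1(k)=\beta(\sigma(W_0),\sigma(W_k))$ and, if $\mathbb{E}\|W_0\|_{\mathbb{R}^2}<\infty$, $\tau_1(k)=\tau(\sigma(W_0),W_k)$. (In cases where $\tau_1$ is used it is understood that $\mathbb{E}\|W_0\|_{\mathbb{R}^2}<\infty$.) **Estimators.** Let $\varphi(x)=\sin(\pi x)/(\pi x)$ and $\varphi_{m,j}(x)=\sqrt m\,\varphi(mx-j)$ for integers $m\ge1$, $j\in\mathbb{Z}$ (an orthonormal system). $S_m^{(n)}$ is the span of $\{\varphi_{m,j}:|j|\le k_n\}$, with $k_n$ an integer. For $t\in S_m^{(n)}$, $$\gamma_n(t)=\frac1n\sum_{i=1}^n\big[\|t\|^2-2u_t^*(Z_i)\big],\qquad u_t(x)=\frac1{2\pi}\frac{t^*(-x)}{f_\varepsilon^*(x)},$$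 and $\hat g_m^{(n)}=\arg\min_{t\in S_m^{(n)}}\gamma_n(t)$. *)

theory Defs
  imports "HOL-Probability.Probability"
begin

section \<open>Real powers, square integrability and Fourier transforms\<close>

text \<open>Power of a nonnegative base with the convention that the zeroth power of 0 is 1;
  \<^const>\<open>powr\<close> would give 0 there.\<close>

definition pow0 :: "real \<Rightarrow> real \<Rightarrow> real" where
  "pow0 x a = (if a = 0 then 1 else x powr a)"

definition square_integrable :: "(real \<Rightarrow> real) \<Rightarrow> bool" where
  "square_integrable u \<longleftrightarrow> u \<in> borel_measurable borel \<and> integrable lborel (\<lambda>x. (u x)\<^sup>2)"

definition l2norm :: "(real \<Rightarrow> real) \<Rightarrow> real" where
  "l2norm u = sqrt (LINT x|lborel. (u x)\<^sup>2)"

text \<open>The Fourier transform is taken as the limit of the integrals over \<open>[-T, T]\<close>. For integrable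
  functions this is the Lebesgue integral over the real line. The limit is needed because the
  functions \<open>phi m j\<close> below are square integrable but not integrable; for square
  integrable functions it agrees almost everywhere with the Plancherel transform.\<close>

definition fourier :: "(real \<Rightarrow> complex) \<Rightarrow> real \<Rightarrow> complex" where
  "fourier u x = Lim at_top (\<lambda>T. LINT t:{-T..T}|lborel. iexp (t * x) * u t)"

abbreviation fourier_real :: "(real \<Rightarrow> real) \<Rightarrow> real \<Rightarrow> complex" where
  "fourier_real u \<equiv> fourier (\<lambda>t. complex_of_real (u t))"

definition smoothness_class :: "real \<Rightarrow> real \<Rightarrow> real \<Rightarrow> real \<Rightarrow> (real \<Rightarrow> real) set" where
  "smoothness_class s r b C1 =
     {\<psi>. integrable lborel
            (\<lambda>x. (cmod (fourier_real \<psi> x))\<^sup>2 * (x\<^sup>2 + 1) powr s * exp (2 * b * pow0 \<bar>x\<bar> r)) \<and>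
          (LINT x|lborel.
             (cmod (fourier_real \<psi> x))\<^sup>2 * (x\<^sup>2 + 1) powr s * exp (2 * b * pow0 \<bar>x\<bar> r)) \<le> C1}"

section \<open>Dependence coefficients\<close>

text \<open>\<open>K\<close> is a regular version of the conditional distribution of \<open>W\<close> given the sub-sigma-algebra
  \<open>F\<close>.\<close>

definition is_cond_distr ::
  "'a measure \<Rightarrow> 'a measure \<Rightarrow> ('a \<Rightarrow> real \<times> real) \<Rightarrow> ('a \<Rightarrow> (real \<times> real) measure) \<Rightarrow> bool"
where
  "is_cond_distr M F W K \<longleftrightarrow>
     K \<in> F \<rightarrow>\<^sub>M prob_algebra borel \<and>
     (\<forall>A\<in>sets borel. AE \<omega> in M.
        measure (K \<omega>) A = real_cond_exp M F (\<lambda>\<omega>. indicator A (W \<omega>)) \<omega>)"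

text \<open>Any two versions agree almost surely (lemma \<open>is_cond_distr_unique\<close>), so in the two
  coefficients below every version gives the same expectation, and the infimum over versions is that
  common value.\<close>

definition beta_coeff :: "'a measure \<Rightarrow> 'a measure \<Rightarrow> ('a \<Rightarrow> real \<times> real) \<Rightarrow> ennreal" where
  "beta_coeff M F W =
     (\<Sqinter>K\<in>{K. is_cond_distr M F W K}.
        \<integral>\<^sup>+\<omega>. (\<Squnion>A\<in>sets borel.
          ennreal \<bar>measure (K \<omega>) A - measure (distr M borel W) A\<bar>) \<partial>M)"

definition l1norm :: "real \<times> real \<Rightarrow> real" where
  "l1norm w = \<bar>fst w\<bar> + \<bar>snd w\<bar>"

definition Lip1 :: "(real \<times> real \<Rightarrow> real) set" where
  "Lip1 = {h. \<forall>v w. \<bar>h v - h w\<bar> \<le> l1norm (v - w)}"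

definition tau_coeff :: "'a measure \<Rightarrow> 'a measure \<Rightarrow> ('a \<Rightarrow> real \<times> real) \<Rightarrow> ennreal" where
  "tau_coeff M F W =
     (\<Sqinter>K\<in>{K. is_cond_distr M F W K}.
        \<integral>\<^sup>+\<omega>. (\<Squnion>h\<in>Lip1.
          ennreal \<bar>(LINT w|K \<omega>. h w) - (LINT w|distr M borel W. h w)\<bar>) \<partial>M)"

lemma is_cond_distr_unique:
  assumes K: "is_cond_distr M F W K" and K': "is_cond_distr M F W K'"
    and F: "subalgebra M F"
  shows "AE \<omega> in M. K \<omega> = K' \<omega>"
proof -
  obtain B :: "(real \<times> real) set set" where B: "countable B" "topological_basis B"
    using ex_countable_basis by blast
  define D where "D = (\<lambda>S. \<Inter>S) ` {S. S \<subseteq> B \<and> finite S}"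
  have D_countable: "countable D"
    unfolding D_def
    by (intro countable_image) (use B countable_Collect_finite_subset in \<open>metis (mono_tags, lifting) Collect_cong\<close>)
  have D_open: "open A" if "A \<in> D" for A
  proof -
    obtain S where "A = \<Inter>S" "S \<subseteq> B" "finite S" using \<open>A \<in> D\<close> unfolding D_def by blast
    then show ?thesis using topological_basis_open[OF B(2)] by blast
  qed
  have D_borel: "D \<subseteq> sets borel"
    using D_open by auto
  have D_gen: "sets borel = sigma_sets UNIV D"
  proof -
    have "B \<subseteq> D"
    proof
      fix A assume "A \<in> B"
      then have "A = \<Inter>{A}" "{A} \<in> {S. S \<subseteq> B \<and> finite S}" by auto
      then show "A \<in> D" unfolding D_def by blast
    qed
    then have "sigma_sets UNIV B \<subseteq> sigma_sets UNIV D"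
      by (rule sigma_sets_mono')
    moreover have "sets (borel :: (real \<times> real) measure) = sigma_sets UNIV B"
      by (subst borel_eq_countable_basis[OF B]) simp
    moreover have "sigma_sets UNIV D \<subseteq> sets borel"
      using sets.sigma_sets_subset[OF D_borel] by simp
    ultimately show ?thesis by simp
  qed
  have D_Int: "Int_stable D"
    unfolding Int_stable_def D_def
  proof safe
    fix S T assume "S \<subseteq> B" "finite S" "T \<subseteq> B" "finite T"
    then have "\<Inter>S \<inter> \<Inter>T = \<Inter>(S \<union> T)" "S \<union> T \<in> {S. S \<subseteq> B \<and> finite S}" by auto
    then show "\<Inter>S \<inter> \<Inter>T \<in> (\<lambda>S. \<Inter>S) ` {S. S \<subseteq> B \<and> finite S}" by blast
  qed
  have D_UNIV: "UNIV \<in> D"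
    unfolding D_def by (rule image_eqI[where x = "{}"]) auto
  have "AE \<omega> in M. \<forall>A\<in>D. measure (K \<omega>) A = measure (K' \<omega>) A"
  proof (subst AE_ball_countable[OF D_countable], intro ballI)
    fix A assume "A \<in> D"
    then have "A \<in> sets borel" using D_borel by blast
    then show "AE \<omega> in M. measure (K \<omega>) A = measure (K' \<omega>) A"
      using K K' unfolding is_cond_distr_def by fastforce
  qed
  then show ?thesis
  proof (rule AE_mp, intro AE_I2 impI)
    fix \<omega> assume \<omega>: "\<omega> \<in> space M" and eq: "\<forall>A\<in>D. measure (K \<omega>) A = measure (K' \<omega>) A"
    have "space F = space M" using F by (simp add: subalgebra_def)
    then have "K \<omega> \<in> space (prob_algebra borel)" "K' \<omega> \<in> space (prob_algebra borel)"
      using K K' \<omega> unfolding is_cond_distr_def by (auto dest: measurable_space)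
    then have P: "prob_space (K \<omega>)" "sets (K \<omega>) = sets borel"
        "prob_space (K' \<omega>)" "sets (K' \<omega>) = sets borel"
      by (auto simp: space_prob_algebra)
    interpret K: prob_space "K \<omega>" by (rule P)
    interpret K': prob_space "K' \<omega>" by (rule P)
    show "K \<omega> = K' \<omega>"
    proof (rule measure_eqI_generator_eq[OF D_Int, where \<Omega> = UNIV and A = "\<lambda>_. UNIV"])
      show "emeasure (K \<omega>) A = emeasure (K' \<omega>) A" if "A \<in> D" for A
        using eq that by (simp add: K.emeasure_eq_measure K'.emeasure_eq_measure)
    qed (use P D_gen D_UNIV in auto)
  qed
qed

section \<open>The model\<close>

definition strictly_stationary :: "'a measure \<Rightarrow> (nat \<Rightarrow> 'a \<Rightarrow> real \<times> real) \<Rightarrow> bool" where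
  "strictly_stationary M V \<longleftrightarrow>
     (\<forall>t. V t \<in> borel_measurable M) \<and>
     (\<forall>h. distr M (Pi\<^sub>M UNIV (\<lambda>_. borel)) (\<lambda>\<omega> t. V (t + h) \<omega>) =
          distr M (Pi\<^sub>M UNIV (\<lambda>_. borel)) (\<lambda>\<omega> t. V t \<omega>))"

text \<open>The logarithm of a square; since \<^term>\<open>ln (0 :: real) = 0\<close>, the assumption that the variables
  \<open>X\<close> and \<open>\<epsilon>\<close> below have densities forces \<open>\<sigma>\<close> and \<open>\<eta>\<close> to be almost surely nonzero.\<close>

definition log_sq :: "('i \<Rightarrow> 'a \<Rightarrow> real) \<Rightarrow> 'i \<Rightarrow> 'a \<Rightarrow> real" where
  "log_sq U t \<omega> = ln ((U t \<omega>)\<^sup>2)"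

locale volatility_model = prob_space M for M :: "'a measure" +
  fixes Y \<sigma> :: "nat \<Rightarrow> 'a \<Rightarrow> real" and \<eta> :: "int \<Rightarrow> 'a \<Rightarrow> real"
    and f\<epsilon> g :: "real \<Rightarrow> real"
  assumes stationary: "strictly_stationary M (\<lambda>t \<omega>. (Y t \<omega>, \<sigma> t \<omega>))"
    and \<sigma>_nonneg: "\<And>t \<omega>. \<omega> \<in> space M \<Longrightarrow> 0 \<le> \<sigma> t \<omega>"
    and Y_eq: "\<And>t \<omega>. \<omega> \<in> space M \<Longrightarrow> Y t \<omega> = \<sigma> t \<omega> * \<eta> (int t) \<omega>"
    and \<eta>_indep: "indep_vars (\<lambda>_. borel) \<eta> UNIV"
    and \<eta>_ident: "\<And>t. distr M borel (\<eta> t) = distr M borel (\<eta> 0)"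
    and \<eta>_square_integrable: "\<And>t. integrable M (\<lambda>\<omega>. (\<eta> t \<omega>)\<^sup>2)"
    and \<eta>_mean: "\<And>t. expectation (\<eta> t) = 0"
    and indep_future: "\<And>t::nat. indep_set
       (sets (vimage_algebra (space M) (\<lambda>\<omega>. \<lambda>i\<in>{0..t}. (\<sigma> i \<omega>, \<eta> (int i - 1) \<omega>))
                (Pi\<^sub>M {0..t} (\<lambda>_. borel))))
       (sets (vimage_algebra (space M) (\<lambda>\<omega>. \<lambda>i\<in>{int t..}. \<eta> i \<omega>)
                (Pi\<^sub>M {int t..} (\<lambda>_. borel))))"
    and g_nonneg: "\<And>x. 0 \<le> g x"
    and f\<epsilon>_nonneg: "\<And>x. 0 \<le> f\<epsilon> x"
    and X_density: "\<And>t. distributed M lborel (log_sq \<sigma> t) (\<lambda>x. ennreal (g x))"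
    and \<epsilon>_density: "\<And>t. distributed M lborel (log_sq \<eta> t) (\<lambda>x. ennreal (f\<epsilon> x))"

definition W_proc ::
  "(nat \<Rightarrow> 'a \<Rightarrow> real) \<Rightarrow> (nat \<Rightarrow> 'a \<Rightarrow> real) \<Rightarrow> nat \<Rightarrow> 'a \<Rightarrow> real \<times> real"
where
  "W_proc Y \<sigma> t \<omega> = (log_sq Y t \<omega>, log_sq \<sigma> t \<omega>)"

definition beta1 ::
  "'a measure \<Rightarrow> (nat \<Rightarrow> 'a \<Rightarrow> real) \<Rightarrow> (nat \<Rightarrow> 'a \<Rightarrow> real) \<Rightarrow> nat \<Rightarrow> ennreal"
where
  "beta1 M Y \<sigma> k =
     beta_coeff M (vimage_algebra (space M) (W_proc Y \<sigma> 0) borel) (W_proc Y \<sigma> k)"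

definition tau1 ::
  "'a measure \<Rightarrow> (nat \<Rightarrow> 'a \<Rightarrow> real) \<Rightarrow> (nat \<Rightarrow> 'a \<Rightarrow> real) \<Rightarrow> nat \<Rightarrow> ennreal"
where
  "tau1 M Y \<sigma> k =
     tau_coeff M (vimage_algebra (space M) (W_proc Y \<sigma> 0) borel) (W_proc Y \<sigma> k)"

section \<open>The estimator\<close>

definition phi :: "nat \<Rightarrow> int \<Rightarrow> real \<Rightarrow> real" where
  "phi m j x = sqrt (real m) * sinc (pi * (real m * x - real_of_int j))"

text \<open>The real linear span of the functions \<open>phi m j\<close> with \<open>\<bar>j\<bar> \<le> k\<close>.\<close>

definition Sm :: "nat \<Rightarrow> int \<Rightarrow> (real \<Rightarrow> real) set" where
  "Sm m k = {t. \<exists>a :: int \<Rightarrow> real. t = (\<lambda>x. \<Sum>j | \<bar>j\<bar> \<le> k. a j * phi m j x)}"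

definition u_fun :: "(real \<Rightarrow> real) \<Rightarrow> (real \<Rightarrow> real) \<Rightarrow> real \<Rightarrow> complex" where
  "u_fun f\<epsilon> t x = 1 / (2 * pi) * (fourier_real t (- x) / fourier_real f\<epsilon> x)"

text \<open>For real-valued \<open>t\<close> and \<open>f\<epsilon>\<close> the transform of \<open>u_fun f\<epsilon> t\<close> is real-valued, so taking the real
  part only changes the type.\<close>

definition contrast ::
  "(real \<Rightarrow> real) \<Rightarrow> nat \<Rightarrow> (nat \<Rightarrow> real) \<Rightarrow> (real \<Rightarrow> real) \<Rightarrow> real"
where
  "contrast f\<epsilon> n z t =
     1 / real n * (\<Sum>i=1..n. (l2norm t)\<^sup>2 - 2 * Re (fourier (u_fun f\<epsilon> t) (z i)))"

definition estimator ::
  "(real \<Rightarrow> real) \<Rightarrow> nat \<Rightarrow> int \<Rightarrow> nat \<Rightarrow> (nat \<Rightarrow> real) \<Rightarrow> real \<Rightarrow> real"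
where
  "estimator f\<epsilon> m k n z = arg_min (contrast f\<epsilon> n z) (\<lambda>t. t \<in> Sm m k)"

section \<open>The quantities in the risk bound\<close>

definition Gamma_rate :: "real \<Rightarrow> real \<Rightarrow> real \<Rightarrow> nat \<Rightarrow> real" where
  "Gamma_rate \<gamma> \<mu> \<delta> m =
     (1 + (pi * real m)\<^sup>2) powr \<gamma> * (pi * real m) powr (1 - \<delta>) *
     exp (2 * \<mu> * (pi * real m) powr \<delta>)"

definition R_const :: "real \<Rightarrow> real \<Rightarrow> real" where
  "R_const \<mu> \<delta> = (if \<delta> = 0 then 1 else 2 * \<mu> * \<delta>)"

definition lambda1 :: "real \<Rightarrow> real \<Rightarrow> real \<Rightarrow> real" where
  "lambda1 \<kappa>0 \<mu> \<delta> = 1 / (\<kappa>0\<^sup>2 * pi * R_const \<mu> \<delta>)"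

end

theory Submission
  imports Defs "HOL-Real_Asymp.Real_Asymp"
begin

text \<open>Let \<open>U\<^sub>j(z)\<close> be the real part of the \<open>j\<close>th Fourier coefficient over the band \<open>[-\<pi>m, \<pi>m]\<close> of
  \<open>x \<mapsto> exp(izx) / f\<^sub>\<epsilon>\<^sup>*(x)\<close>. The contrast is a quadratic form in the coordinates of \<open>t\<close>, so the estimator is
  \<open>\<Sum>\<^sub>j (1/n \<Sum>\<^sub>i U\<^sub>j(Z\<^sub>i)) \<phi>\<^sub>m\<^sub>,\<^sub>j\<close>, and by orthonormality the risk is a squared bias plus the sum of the variances of
  the coefficients.

  Bias: the energy of \<open>g\<^sup>*\<close> outside the band is controlled by the smoothness class, and the
  coefficients with \<open>\<bar>j\<bar> > k\<^sub>n\<close> by \<open>\<integral> x\<^sup>2 g\<^sup>2(x) dx\<close>, which makes them \<open>O(m / \<bar>j\<bar>)\<close>.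

  Variance: by Bessel's inequality \<open>\<Sum>\<^sub>j U\<^sub>j(z)\<^sup>2 \<le> \<Delta>\<close> with \<open>\<Delta> = 1/(2\<pi>) \<integral> \<bar>f\<^sub>\<epsilon>\<^sup>*\<bar>\<^sup>-\<^sup>2\<close> over the band, which bounds the
  diagonal. Off the diagonal, the noise at the later time is independent of the rest, so \<open>U\<^sub>j(Z\<^sub>k)\<close> may be
  replaced by \<open>\<phi>\<^sub>m\<^sub>,\<^sub>j(X\<^sub>k)\<close>. The kernel \<open>\<Sum>\<^sub>j U\<^sub>j(z) \<phi>\<^sub>m\<^sub>,\<^sub>j(x)\<close> is bounded by \<open>\<surd>(m\<Delta>)\<close> and Lipschitz in \<open>x\<close> with
  constant \<open>\<pi>m \<surd>(m\<Delta>)\<close>; hence the covariances at lag \<open>k\<close> are at most \<open>2 \<surd>(m\<Delta>) \<beta>\<^sub>1(k)\<close> and \<open>\<pi>m \<surd>(m\<Delta>) \<tau>\<^sub>1(k)\<close>.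

  Rates: \<open>\<Delta> \<le> c + 2 \<lambda>\<^sub>1 \<Gamma>(m)\<close>, and \<open>m\<^sup>2\<close>, \<open>\<surd>(m\<Delta>)\<close> and (if \<open>\<delta> > 0\<close> or \<open>\<gamma> > 1\<close>) \<open>m \<surd>(m\<Delta>)\<close> are \<open>o(\<Gamma>(m))\<close>; for
  \<open>\<delta> = 0\<close> this uses \<open>\<gamma> > 1/2\<close>, which follows from the square integrability of \<open>f\<^sub>\<epsilon>\<close>.\<close>

subsection \<open>The trigonometric system on a band\<close>

text \<open>The bound has to be uniform: \<open>C2\<close> and \<open>rem\<close> are fixed before
  the probability space, the process, \<open>g\<close> and \<open>k\<close>, so every estimate is
  explicit in m and in the sum B of the coefficients.

  Covariances are bounded for the whole sum over j at once. Absolute values term by term would cost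
  a factor growing with the number of coefficients; the kernel is bounded uniformly in the index
  set.

  Completeness of the sinc system is used for probability densities only. Their transforms are
  mixtures of exponentials, so by convexity it suffices that Bessel's inequality becomes an equality
  for each exponential. This says that the squares of sinc at the points pi (y - j), j an integer,
  add up to 1: the partial fraction expansion of pi^2 / sin^2(pi y).

  Elements of the sinc space need not be integrable, so their norms come from Plancherel on the
  frequency side, where they are bounded with compact support. For g the bias calls for an upper
  bound of its norm by that of its transform, obtained by duality with continuous test functions.

  The factor 2 before \<open>\<lambda>\<^sub>1\<close>: for \<open>\<delta> > 0\<close> the rate is
  a primitive of the weight only to leading order, and half of the leading term absorbs the
  rest.\<close>

definition bounded_borel :: "(real \<Rightarrow> complex) \<Rightarrow> bool" where
  "bounded_borel w \<longleftrightarrow> w \<in> borel_measurable borel \<and> bounded (range w)"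

lemma bounded_borelI:
  "w \<in> borel_measurable borel \<Longrightarrow> (\<And>x. norm (w x) \<le> c) \<Longrightarrow> bounded_borel w"
  by (auto simp: bounded_borel_def bounded_iff)

lemma bounded_borelE:
  assumes "bounded_borel w"
  obtains c where "\<And>x. norm (w x) \<le> c" "0 \<le> c"
  using assms unfolding bounded_borel_def bounded_iff
  by (metis norm_ge_zero order_trans rangeI)

lemma bounded_borel_measurable[measurable_dest]: "bounded_borel w \<Longrightarrow> w \<in> borel_measurable borel"
  by (simp add: bounded_borel_def)

lemma bounded_borel_const: "bounded_borel (\<lambda>_. c)"
  by (rule bounded_borelI[of _ "norm c"]) auto

lemma bounded_borel_add:
  assumes "bounded_borel v" "bounded_borel w"
  shows "bounded_borel (\<lambda>x. v x + w x)"
proof -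
  note [measurable] = assms[THEN bounded_borel_measurable]
  obtain c d where "\<And>x. norm (v x) \<le> c" "\<And>x. norm (w x) \<le> d"
    using assms by (metis bounded_borelE)
  then show ?thesis
    by (intro bounded_borelI[of _ "c + d"]) (auto intro: norm_triangle_mono)
qed

lemma bounded_borel_mult:
  assumes "bounded_borel v" "bounded_borel w"
  shows "bounded_borel (\<lambda>x. v x * w x)"
proof -
  note [measurable] = assms[THEN bounded_borel_measurable]
  obtain c d where "\<And>x. norm (v x) \<le> c" "\<And>x. norm (w x) \<le> d" "0 \<le> c"
    using assms by (metis bounded_borelE)
  then show ?thesis
    by (intro bounded_borelI[of _ "c * d"]) (auto simp: norm_mult intro!: mult_mono)
qed

lemma bounded_borel_cnj: "bounded_borel v \<Longrightarrow> bounded_borel (\<lambda>x. cnj (v x))"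
  unfolding bounded_borel_def bounded_iff by (auto intro!: borel_measurable_continuous_on[of cnj] continuous_intros)

lemma bounded_borel_uminus: "bounded_borel v \<Longrightarrow> bounded_borel (\<lambda>x. - v x)"
  using bounded_borel_mult[OF bounded_borel_const[of "-1"], of v] by simp

lemma bounded_borel_diff:
  "bounded_borel v \<Longrightarrow> bounded_borel w \<Longrightarrow> bounded_borel (\<lambda>x. v x - w x)"
  using bounded_borel_add[OF _ bounded_borel_uminus, of v w] by simp

lemma bounded_borel_divide: "bounded_borel v \<Longrightarrow> bounded_borel (\<lambda>x. v x / c)"
  using bounded_borel_mult[OF _ bounded_borel_const[of "1 / c"], of v] by simp

lemma bounded_borel_sum:
  "(\<And>i. i \<in> I \<Longrightarrow> bounded_borel (w i)) \<Longrightarrow> bounded_borel (\<lambda>x. \<Sum>i\<in>I. w i x)"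
  by (induction I rule: infinite_finite_induct) (auto intro: bounded_borel_const bounded_borel_add)

lemma cis_measurable[measurable]: "cis \<in> borel_measurable borel"
  by (intro borel_measurable_continuous_onI continuous_intros)

lemma bounded_borel_cis: "f \<in> borel_measurable borel \<Longrightarrow> bounded_borel (\<lambda>x. cis (f x))"
  by (rule bounded_borelI[of _ 1]) auto

lemmas bounded_borel_intros =
  bounded_borel_const bounded_borel_add bounded_borel_mult bounded_borel_cnj
  bounded_borel_uminus bounded_borel_diff bounded_borel_divide bounded_borel_sum bounded_borel_cis

text \<open>A measure rather than a set integral, so that the facts on finite measures (bounded
  functions are integrable, Fubini) apply directly.\<close>

definition band :: "nat \<Rightarrow> real measure" where
  "band m = density lborel (indicator {- (pi * m)..pi * m})"

lemma sets_band[measurable_cong, simp]: "sets (band m) = sets borel"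
  by (simp add: band_def)

lemma space_band[simp]: "space (band m) = UNIV"
  by (simp add: band_def)

lemma emeasure_band_UNIV: "emeasure (band m) UNIV = ennreal (2 * pi * m)"
  by (simp add: band_def emeasure_density mult.commute flip: mult_2_right)

lemma measure_band_UNIV: "measure (band m) UNIV = 2 * pi * m"
  by (simp add: measure_def emeasure_band_UNIV)

lemma finite_measure_band: "finite_measure (band m)"
  by (rule finite_measureI) (simp add: emeasure_band_UNIV)

lemma AE_band: "AE x in band m. \<bar>x\<bar> \<le> pi * m"
  unfolding band_def by (subst AE_density) (auto simp: indicator_def)

lemma integral_band:
  fixes w :: "real \<Rightarrow> 'b :: {banach, second_countable_topology}"
  assumes "w \<in> borel_measurable borel"
  shows "(LINT x|band m. w x) = (LINT x:{- (pi * m)..pi * m}|lborel. w x)"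
proof -
  have "band m = density lborel (\<lambda>x. ennreal (indicator {- (pi * m)..pi * m} x))"
    unfolding band_def by (intro arg_cong[where f = "density lborel"] ext) (auto simp: indicator_def)
  then show ?thesis
    unfolding set_lebesgue_integral_def using assms by (simp add: integral_density)
qed

lemma integrable_bandI:
  fixes w :: "real \<Rightarrow> 'b :: {banach, second_countable_topology}"
  assumes "w \<in> borel_measurable borel" "\<And>x. norm (w x) \<le> c"
  shows "integrable (band m) w"
proof -
  interpret finite_measure "band m" by (rule finite_measure_band)
  show ?thesis by (rule integrable_const_bound[of _ c]) (use assms in auto)
qed

lemma integrable_band: "bounded_borel w \<Longrightarrow> integrable (band m) w"
  by (metis bounded_borelE bounded_borel_measurable integrable_bandI)

lemma integral_band_cis:
  "(LINT x|band m. cis (\<theta> * x)) = of_real (2 * pi * m * sinc (pi * m * \<theta>))"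
proof (cases "\<theta> = 0")
  case True
  have "(LINT x|band m. (1 :: complex)) = of_real (2 * pi * m)"
    by (subst lebesgue_integral_const) (simp add: measure_band_UNIV scaleR_conv_of_real)
  then show ?thesis using True by simp
next
  case False
  have "(LINT x|band m. cis (\<theta> * x)) = cis (\<theta> * (pi * m)) / (\<i> * \<theta>) - cis (\<theta> * (- (pi * m))) / (\<i> * \<theta>)"
    apply (subst integral_band)
     apply measurable
    unfolding set_lebesgue_integral_def
  proof (rule integral_FTC_Icc)
    fix x :: real
    have "((\<lambda>x. exp (\<i> * \<theta> * of_real x) / (\<i> * \<theta>)) has_vector_derivative exp (\<i> * \<theta> * of_real x))
        (at x within {- (pi * real m)..pi * real m})"
      by (rule has_vector_derivative_real_field) (use False in \<open>auto intro!: derivative_eq_intros\<close>)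
    then show "((\<lambda>x. cis (\<theta> * x) / (\<i> * \<theta>)) has_vector_derivative cis (\<theta> * x))
        (at x within {- (pi * real m)..pi * real m})"
      by (simp add: cis_conv_exp mult.assoc)
  qed (auto intro!: continuous_intros)
  also have "\<dots> = of_real (2 * sin (\<theta> * (pi * m)) / \<theta>)"
  proof -
    have "cis (\<theta> * (pi * m)) - cis (\<theta> * (- (pi * m))) = 2 * \<i> * of_real (sin (\<theta> * (pi * m)))"
      by (simp add: complex_eq_iff)
    then show ?thesis
      unfolding diff_divide_distrib[symmetric] using False by (simp add: field_simps)
  qed
  \<comment> \<open>\<open>m = 0\<close> is split off: \<open>sinc\<close> is then taken at 0
    although \<open>\<theta>\<close> is not 0.\<close>
  finally show ?thesis using False by (cases "m = 0") (auto simp: mult_ac)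
qed

text \<open>The functions \<open>cis (j * x / m) / sqrt m\<close> are orthonormal for the integral
  over the band divided by 2 pi, and these are the coefficients for that inner product. With this
  scaling an exponential has exactly the values of \<open>phi\<close> as coefficients.\<close>

definition trig_coeff :: "nat \<Rightarrow> (real \<Rightarrow> complex) \<Rightarrow> int \<Rightarrow> complex" where
  "trig_coeff m w j = (LINT x|band m. w x * cis (- (of_int j * x / m))) / of_real (2 * pi * sqrt m)"

text \<open>Sinc functions are the Fourier coefficients of exponentials; the bounds on sums of
  squares of \<open>phi\<close> below are therefore instances of Bessel's inequality.\<close>

lemma trig_coeff_cis:
  assumes "m \<ge> 1"
  shows "trig_coeff m (\<lambda>x. cis (t * x)) j = of_real (phi m j t)"
proof -
  have "trig_coeff m (\<lambda>x. cis (t * x)) j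
      = (LINT x|band m. cis ((t - j / m) * x)) / of_real (2 * pi * sqrt m)"
    unfolding trig_coeff_def by (simp add: cis_mult algebra_simps)
  also have "\<dots> = of_real (2 * pi * m / (2 * pi * sqrt m) * sinc (pi * m * (t - j / m)))"
    by (subst integral_band_cis) simp
  also have "pi * m * (t - j / m) = pi * (m * t - j)"
    using assms by (simp add: field_simps)
  also have "2 * pi * m / (2 * pi * sqrt m) = sqrt m"
    using assms by (simp add: real_div_sqrt)
  finally show ?thesis unfolding phi_def .
qed

lemma phi_eq_integral:
  assumes "m \<ge> 1"
  shows "of_real (phi m j t) = (LINT x|band m. cis (t * x) * cis (- (of_int j * x / m))) / of_real (2 * pi * sqrt m)"
  using trig_coeff_cis[OF assms, of t j] by (simp add: trig_coeff_def)

lemma trig_coeff_diff: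
  "bounded_borel v \<Longrightarrow> bounded_borel w \<Longrightarrow>
    trig_coeff m (\<lambda>x. v x - w x) j = trig_coeff m v j - trig_coeff m w j"
  unfolding trig_coeff_def diff_divide_distrib[symmetric] left_diff_distrib
  by (subst Bochner_Integration.integral_diff) (auto intro!: integrable_band bounded_borel_intros)

definition trig_proj :: "nat \<Rightarrow> int set \<Rightarrow> (real \<Rightarrow> complex) \<Rightarrow> real \<Rightarrow> complex" where
  "trig_proj m J w x = (\<Sum>j\<in>J. trig_coeff m w j * cis (of_int j * x / m)) / of_real (sqrt m)"

lemma bounded_borel_trig_proj: "bounded_borel (trig_proj m J w)"
  unfolding trig_proj_def [abs_def] by (auto intro!: bounded_borel_intros)

lemma trig_coeff_sum_cis:
  assumes "m \<ge> 1" "finite J" "i \<in> J"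
  shows "trig_coeff m (\<lambda>x. (\<Sum>j\<in>J. b j * cis (of_int j * x / m)) / of_real (sqrt m)) i = b i"
proof -
  let ?P = "\<lambda>x. (\<Sum>j\<in>J. b j * cis (of_int j * x / m)) / complex_of_real (sqrt m)"
  \<comment> \<open>The integral is a sinc at an integer multiple of pi, which vanishes unless the
    integer is 0.\<close>
  have orth: "(LINT x|band m. cis (of_int j * x / m) * cis (- (of_int i * x / m))) = (if i = j then of_real (2 * pi * m) else 0)" for j :: int
  proof -
    have "cis (of_int j * x / m) * cis (- (of_int i * x / m)) = cis ((j - i) / m * x)" for x
      by (simp add: cis_mult diff_divide_distrib algebra_simps)
    then have "(LINT x|band m. cis (of_int j * x / m) * cis (- (of_int i * x / m)))
        = of_real (2 * pi * m * sinc (pi * m * ((j - i) / m)))"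
      by (simp only: integral_band_cis)
    also have "pi * m * ((j - i) / m) = pi * of_int (j - i)" using assms by simp
    also have "sin (pi * of_int (j - i)) = 0"
      by (rule sin_npi_int)
    finally show ?thesis by (auto simp: if_distrib)
  qed
  have "?P x * cis (- (of_int i * x / m))
      = (\<Sum>j\<in>J. b j / of_real (sqrt m) * (cis (of_int j * x / m) * cis (- (of_int i * x / m))))" for x
    unfolding sum_divide_distrib sum_distrib_right by (intro sum.cong) (auto simp: mult_ac)
  then have "(LINT x|band m. ?P x * cis (- (of_int i * x / m)))
      = (\<Sum>j\<in>J. b j / of_real (sqrt m) *
           (LINT x|band m. cis (of_int j * x / m) * cis (- (of_int i * x / m))))"
    by (simp only:) (subst Bochner_Integration.integral_sum,
        auto intro!: integrable_band bounded_borel_intros sum.cong)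
  also have "\<dots> = b i / of_real (sqrt m) * of_real (2 * pi * m)"
    using assms(2,3) by (subst orth) (simp add: if_distrib sum.delta cong: if_cong)
  also have "\<dots> = b i * of_real (2 * pi * (m / sqrt m))"
    by (simp add: field_simps)
  finally show ?thesis
    using assms(1) unfolding trig_coeff_def
    by (simp add: real_div_sqrt)
qed

lemma trig_coeff_trig_proj:
  "m \<ge> 1 \<Longrightarrow> finite J \<Longrightarrow> i \<in> J \<Longrightarrow> trig_coeff m (trig_proj m J w) i = trig_coeff m w i"
  unfolding trig_proj_def[abs_def] by (rule trig_coeff_sum_cis)

text \<open>Pythagoras for the projection onto the span of J. The equality is kept, and not only
  Bessel's inequality, because the Parseval argument needs the defect as the integral of a
  square.\<close>

lemma bessel_identity:
  assumes m: "m \<ge> 1" and J: "finite J" and w: "bounded_borel w"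
  shows "(LINT x|band m. (norm (w x - trig_proj m J w x))\<^sup>2) / (2 * pi)
      = (LINT x|band m. (norm (w x))\<^sup>2) / (2 * pi) - (\<Sum>j\<in>J. (norm (trig_coeff m w j))\<^sup>2)"
proof -
  let ?P = "trig_proj m J w" and ?S = "\<Sum>j\<in>J. (norm (trig_coeff m w j))\<^sup>2"
  note bb = w bounded_borel_trig_proj[of m J w]
  \<comment> \<open>Pairing with the projection depends on \<open>v\<close> only through its
    coefficients on J. Taking \<open>v = w\<close> and \<open>v = ?P\<close> gives equal values,
    since these two functions share their coefficients there.\<close>
  have inner: "(LINT x|band m. v x * cnj (?P x)) = of_real (2 * pi) * (\<Sum>j\<in>J. cnj (trig_coeff m w j) * trig_coeff m v j)"
    if v: "bounded_borel v" for v
  proof -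
    have "v x * cnj (?P x) = (\<Sum>j\<in>J. cnj (trig_coeff m w j) / of_real (sqrt m) * (v x * cis (- (of_int j * x / m))))" for x
      by (simp add: trig_proj_def sum_divide_distrib sum_distrib_left mult_ac cis_cnj)
    then have "(LINT x|band m. v x * cnj (?P x)) = (\<Sum>j\<in>J. cnj (trig_coeff m w j) / of_real (sqrt m) *
          (LINT x|band m. v x * cis (- (of_int j * x / m))))"
      by (simp only:) (subst Bochner_Integration.integral_sum,
        auto intro!: integrable_band bounded_borel_intros v sum.cong)
    also have "\<dots> = (\<Sum>j\<in>J. cnj (trig_coeff m w j) * (of_real (2 * pi) * trig_coeff m v j))"
      using m by (intro sum.cong) (auto simp: trig_coeff_def field_simps)
    finally show ?thesis by (simp add: sum_distrib_left mult_ac)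
  qed
  have S: "(\<Sum>j\<in>J. cnj (trig_coeff m w j) * trig_coeff m w j) = of_real ?S"
    unfolding of_real_sum complex_norm_square by (simp only: mult.commute)
  have wP: "(LINT x|band m. w x * cnj (?P x)) = of_real (2 * pi * ?S)"
    by (simp add: inner[OF w] S)
  have PP: "(LINT x|band m. ?P x * cnj (?P x)) = of_real (2 * pi * ?S)"
    by (subst inner[OF bb(2)]) (use trig_coeff_trig_proj[OF m J] S in simp)
  have Pw: "(LINT x|band m. cnj (w x) * ?P x) = of_real (2 * pi * ?S)"
  proof -
    have "(LINT x|band m. cnj (w x) * ?P x) = cnj (LINT x|band m. w x * cnj (?P x))"
      using Bochner_Integration.integral_cnj[of "band m" "\<lambda>x. w x * cnj (?P x)"] by simp
    then show ?thesis by (simp only: wP complex_cnj_complex_of_real)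
  qed
  have "complex_of_real (LINT x|band m. (norm (w x - ?P x))\<^sup>2)
      = (LINT x|band m. w x * cnj (w x) - w x * cnj (?P x) - cnj (w x) * ?P x + ?P x * cnj (?P x))"
    by (subst integral_complex_of_real[symmetric])
       (auto simp only: complex_norm_square complex_cnj_diff algebra_simps)
  also have "\<dots> = (LINT x|band m. w x * cnj (w x)) - of_real (2 * pi * ?S)"
    apply (subst Bochner_Integration.integral_add)
    apply (auto intro!: integrable_band bounded_borel_intros bb) [2]
    apply (subst Bochner_Integration.integral_diff)
    apply (auto intro!: integrable_band bounded_borel_intros bb) [2]
    apply (subst Bochner_Integration.integral_diff)
    apply (auto intro!: integrable_band bounded_borel_intros bb) [2]
    by (simp only: wP PP Pw diff_add_cancel)
  also have "(LINT x|band m. w x * cnj (w x)) = of_real (LINT x|band m. (norm (w x))\<^sup>2)"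
    by (subst integral_complex_of_real[symmetric]) (simp only: complex_norm_square)
  finally have "(LINT x|band m. (norm (w x - ?P x))\<^sup>2) = (LINT x|band m. (norm (w x))\<^sup>2) - 2 * pi * ?S"
    by (simp only: of_real_diff[symmetric] of_real_eq_iff)
  then show ?thesis by (simp add: field_simps)
qed

lemma bessel_ineq:
  assumes "m \<ge> 1" "finite J" "bounded_borel w"
  shows "(\<Sum>j\<in>J. (norm (trig_coeff m w j))\<^sup>2) \<le> (LINT x|band m. (norm (w x))\<^sup>2) / (2 * pi)"
  using bessel_identity[OF assms]
    divide_nonneg_pos[OF integral_nonneg_AE, of "\<lambda>x. (norm (w x - trig_proj m J w x))\<^sup>2" "band m" "2 * pi"]
  by simp

text \<open>An exponential has modulus 1, so its energy on the band divided by 2 pi is m.\<close>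

lemma sum_phi_sq_le:
  assumes "m \<ge> 1" "finite J"
  shows "(\<Sum>j\<in>J. (phi m j t)\<^sup>2) \<le> m"
  using bessel_ineq[OF assms, of "\<lambda>x. cis (t * x)"] assms
  by (simp add: trig_coeff_cis bounded_borel_cis measure_band_UNIV)

lemma norm_cis_diff_le: "norm (cis a - cis b) \<le> \<bar>a - b\<bar>"
proof -
  have "cis a - cis b = cis b * (cis (a - b) - 1)"
    by (simp add: cis_mult algebra_simps)
  then have "norm (cis a - cis b) = norm (cis (a - b) - 1)"
    by (simp add: norm_mult)
  also have "\<dots> \<le> \<bar>a - b\<bar>"
    using iexp_approx1[of "a - b" 0] by (simp add: cis_conv_exp)
  finally show ?thesis .
qed

text \<open>Bessel for the difference of two exponentials, which on the band is at most pi m times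
  the distance of their frequencies. This is the source of the Lipschitz constant of the
  kernel.\<close>

lemma sum_phi_diff_sq_le:
  assumes "m \<ge> 1" "finite J"
  shows "(\<Sum>j\<in>J. (phi m j s - phi m j t)\<^sup>2) \<le> m * (pi * m * \<bar>s - t\<bar>)\<^sup>2"
proof -
  let ?w = "\<lambda>x. cis (s * x) - cis (t * x)"
  have bb: "bounded_borel ?w"
    by (auto intro!: bounded_borel_intros)
  have "norm (trig_coeff m ?w j) = \<bar>phi m j s - phi m j t\<bar>" for j
    using assms(1) by (subst trig_coeff_diff)
      (auto intro!: bounded_borel_intros simp: trig_coeff_cis simp flip: of_real_diff)
  then have "(\<Sum>j\<in>J. (phi m j s - phi m j t)\<^sup>2) \<le> (LINT x|band m. (norm (?w x))\<^sup>2) / (2 * pi)"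
    using bessel_ineq[OF assms bb] by simp
  also have "(LINT x|band m. (norm (?w x))\<^sup>2) \<le> (LINT x|band m. (pi * m * \<bar>s - t\<bar>)\<^sup>2)"
  proof (rule integral_mono_AE)
    show "integrable (band m) (\<lambda>x. (norm (?w x))\<^sup>2)"
      by (rule integrable_bandI[of _ 4]) (auto intro!: power_mono[of _ 2 2, simplified] norm_triangle_le_diff)
    show "integrable (band m) (\<lambda>x. (pi * m * \<bar>s - t\<bar>)\<^sup>2)"
      by (rule integrable_bandI) auto
    show "AE x in band m. (norm (?w x))\<^sup>2 \<le> (pi * m * \<bar>s - t\<bar>)\<^sup>2"
      using AE_band[of m]
    proof eventually_elim
      case (elim x)
      have "norm (?w x) \<le> \<bar>s * x - t * x\<bar>" by (rule norm_cis_diff_le)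
      also have "\<dots> = \<bar>x\<bar> * \<bar>s - t\<bar>" by (simp add: abs_mult algebra_simps flip: abs_mult)
      also have "\<dots> \<le> pi * m * \<bar>s - t\<bar>" using elim by (intro mult_right_mono) auto
      finally show ?case by (intro power_mono) auto
    qed
  qed
  finally show ?thesis
    by (simp add: measure_band_UNIV divide_right_mono)
qed

subsection \<open>Parseval for a characteristic function on a band\<close>

text \<open>Euler's reflection formula differentiated twice: the first derivative gives
  \<open>Digamma (1 - w) - Digamma w\<close> as pi times the cotangent of pi w, the second gives the
  claim.\<close>

lemma inverse_square_series_reflection:
  fixes z :: complex
  assumes z: "z \<notin> \<int>"
  shows "Polygamma 1 z + Polygamma 1 (1 - z) = (of_real pi / sin (of_real pi * z))\<^sup>2"
proof -
  have sin_nz: "sin (of_real pi * w) \<noteq> 0" if "w \<notin> \<int>" for w :: complex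
  proof
    assume "sin (of_real pi * w) = 0"
    then obtain n :: int where "of_real pi * w = of_real (of_int n * pi)"
      using sin_eq_0 by blast
    then have "w = of_int n" by simp
    then show False using that by simp
  qed
  have notint: "w \<notin> \<int>\<^sub>\<le>\<^sub>0" "1 - w \<notin> \<int>\<^sub>\<le>\<^sub>0" if "w \<notin> \<int>" for w :: complex
    using that nonpos_Ints_Int Ints_diff[OF Ints_1, of "1 - w"] by auto
  have dig: "Digamma (1 - w) - Digamma w = of_real pi * cos (of_real pi * w) / sin (of_real pi * w)"
    if w: "w \<notin> \<int>" for w :: complex
  proof -
    have "((\<lambda>w. rGamma w * rGamma (1 - w)) has_field_derivative
        rGamma w * rGamma (1 - w) * (Digamma (1 - w) - Digamma w)) (at w)"
      using notint[OF w] by (auto intro!: derivative_eq_intros simp: algebra_simps)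
    moreover have "((\<lambda>w. sin (of_real pi * w) / of_real pi) has_field_derivative cos (of_real pi * w)) (at w)"
      by (auto intro!: derivative_eq_intros)
    ultimately have "rGamma w * rGamma (1 - w) * (Digamma (1 - w) - Digamma w) = cos (of_real pi * w)"
      unfolding rGamma_reflection_complex by (rule DERIV_unique)
    then show ?thesis
      unfolding rGamma_reflection_complex using sin_nz[OF w] by (simp add: field_simps)
  qed
  have "((\<lambda>w. Digamma (1 - w) - Digamma w) has_field_derivative - Polygamma 1 (1 - z) - Polygamma 1 z) (at z)"
    using notint[OF z] by (auto intro!: derivative_eq_intros)
  \<comment> \<open>The cotangent formula holds off the integers only. They form a closed set, so it
    holds in a neighbourhood of \<open>z\<close>, which is enough to transfer the
    derivative.\<close>
  moreover have "((\<lambda>w. Digamma (1 - w) - Digamma w) has_field_derivative - (of_real pi / sin (of_real pi * z))\<^sup>2) (at z)"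
  proof (rule has_field_derivative_transform_within_open)
    show "((\<lambda>w. of_real pi * cos (of_real pi * w) / sin (of_real pi * w)) has_field_derivative
        - (of_real pi / sin (of_real pi * z))\<^sup>2) (at z)"
    proof -
      let ?S = "sin (z * of_real pi)" and ?C = "cos (z * of_real pi)" and ?p = "complex_of_real pi"
      have "?S * ?S + ?C * ?C = 1"
        using sin_cos_squared_add[of "z * of_real pi"] by (simp add: power2_eq_square)
      then have "- (?p * (?p * (?S * ?S))) - ?p * (?p * (?C * ?C)) = - (?p * ?p)"
        by algebra
      then show ?thesis
        using sin_nz[OF z]
        by (auto intro!: derivative_eq_intros simp: power2_eq_square algebra_simps) (simp add: field_simps)
    qed
    show "open (- \<int> :: complex set)" by (intro open_Compl closed_Ints)
  qed (use z dig in auto)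
  ultimately have "- Polygamma 1 (1 - z) - Polygamma 1 z = - (of_real pi / sin (of_real pi * z))\<^sup>2"
    by (rule DERIV_unique)
  then show ?thesis by (simp add: algebra_simps)
qed

lemma int_interval_eq: "{j :: int. \<bar>j\<bar> \<le> int N} = (\<lambda>k. - int k) ` {..N} \<union> (\<lambda>k. int (Suc k)) ` {..<N}"
proof (intro equalityI subsetI)
  fix j assume "j \<in> {j. \<bar>j\<bar> \<le> int N}"
  then have j: "\<bar>j\<bar> \<le> int N" by simp
  show "j \<in> (\<lambda>k. - int k) ` {..N} \<union> (\<lambda>k. int (Suc k)) ` {..<N}"
  proof (cases "j \<le> 0")
    case True
    then have "j = - int (nat (- j))" "nat (- j) \<le> N" using j by auto
    then show ?thesis by blast
  next
    case False
    then have "j = int (Suc (nat (j - 1)))" "nat (j - 1) < N" using j by auto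
    then show ?thesis by blast
  qed
qed auto

text \<open>Zero joins the negative indices: the indices \<open>- k\<close> and \<open>k + 1\<close>
  then give the terms 1 / (y + k)^2 and 1 / (1 - y + k)^2 of the two Polygamma series, both of which
  start at k = 0.\<close>

lemma sum_abs_le_int:
  fixes f :: "int \<Rightarrow> 'b :: comm_monoid_add"
  shows "(\<Sum>j | \<bar>j\<bar> \<le> int N. f j) = (\<Sum>k\<le>N. f (- int k)) + (\<Sum>k<N. f (int (Suc k)))"
  unfolding int_interval_eq
  by (subst sum.union_disjoint) (auto simp: sum.reindex inj_on_def)

lemma finite_abs_le_int [simp]: "finite {j :: int. \<bar>j\<bar> \<le> k}"
  by (rule finite_subset[of _ "{-k..k}"]) auto

text \<open>All numerators equal sin^2(pi y), so off the integers this is the partial fraction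
  expansion. At an integer a single term survives, and it is the value of \<open>sinc\<close> at
  0.\<close>

lemma sum_sinc_sq_tendsto:
  fixes y :: real
  shows "(\<lambda>N. \<Sum>j | \<bar>j\<bar> \<le> int N. (sinc (pi * (y - of_int j)))\<^sup>2) \<longlonglongrightarrow> 1"
proof (cases "y \<in> \<int>")
  case True
  then obtain i where i: "y = of_int i" by (auto elim: Ints_cases)
  have val: "(sinc (pi * (y - of_int j)))\<^sup>2 = (if j = i then 1 else 0)" for j :: int
    using sin_npi_int[of "i - j"] by (auto simp: i)
  have "\<forall>\<^sub>F N in sequentially. (\<Sum>j | \<bar>j\<bar> \<le> int N. (sinc (pi * (y - of_int j)))\<^sup>2) = 1"
    using eventually_ge_at_top[of "nat \<bar>i\<bar>"]
    by eventually_elim (unfold val, auto simp: sum.delta)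
  then show ?thesis by (rule tendsto_eventually)
next
  case False
  let ?z = "complex_of_real y"
  have z: "?z \<notin> \<int>" using False by (metis of_real_in_Ints_iff)
  then have nz: "?z \<noteq> 0" "1 - ?z \<noteq> 0" by (metis Ints_0) (metis Ints_1 right_minus_eq z)
  have s1: "(\<lambda>k. inverse ((?z + of_nat k)\<^sup>2)) sums Polygamma 1 ?z"
    using Polygamma_LIMSEQ[OF nz(1), of 1] by (simp add: power2_eq_square)
  have s2: "(\<lambda>k. inverse ((1 - ?z + of_nat k)\<^sup>2)) sums Polygamma 1 (1 - ?z)"
    using Polygamma_LIMSEQ[OF nz(2), of 1] by (simp add: power2_eq_square)
  have "(\<lambda>N. (\<Sum>k\<le>N. inverse ((?z + of_nat k)\<^sup>2)) + (\<Sum>k<N. inverse ((1 - ?z + of_nat k)\<^sup>2)))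
      \<longlonglongrightarrow> (of_real pi / sin (of_real pi * ?z))\<^sup>2"
    unfolding inverse_square_series_reflection[OF z, symmetric]
    by (intro tendsto_add s1[unfolded sums_def_le] s2[unfolded sums_def])
  also have "(\<lambda>N. (\<Sum>k\<le>N. inverse ((?z + of_nat k)\<^sup>2)) + (\<Sum>k<N. inverse ((1 - ?z + of_nat k)\<^sup>2)))
      = (\<lambda>N. complex_of_real (\<Sum>j | \<bar>j\<bar> \<le> int N. inverse ((y - of_int j)\<^sup>2)))"
  proof
    fix N
    have "(1 - ?z + of_nat k)\<^sup>2 = (?z - of_nat (Suc k))\<^sup>2" for k
      by (simp add: power2_eq_square algebra_simps)
    then show "(\<Sum>k\<le>N. inverse ((?z + of_nat k)\<^sup>2)) + (\<Sum>k<N. inverse ((1 - ?z + of_nat k)\<^sup>2))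
        = complex_of_real (\<Sum>j | \<bar>j\<bar> \<le> int N. inverse ((y - of_int j)\<^sup>2))"
      by (simp add: sum_abs_le_int)
  qed
  also have "(of_real pi / sin (of_real pi * ?z))\<^sup>2 = complex_of_real ((pi / sin (pi * y))\<^sup>2)"
    by (simp add: sin_of_real flip: of_real_mult)
  finally have "(\<lambda>N. \<Sum>j | \<bar>j\<bar> \<le> int N. inverse ((y - of_int j)\<^sup>2)) \<longlonglongrightarrow> (pi / sin (pi * y))\<^sup>2"
    by (rule tendsto_of_real_iff[THEN iffD1])
  then have "(\<lambda>N. (sin (pi * y) / pi)\<^sup>2 * (\<Sum>j | \<bar>j\<bar> \<le> int N. inverse ((y - of_int j)\<^sup>2)))
      \<longlonglongrightarrow> (sin (pi * y) / pi)\<^sup>2 * (pi / sin (pi * y))\<^sup>2"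
    by (rule tendsto_mult_left)
  also have "(sin (pi * y) / pi)\<^sup>2 * (pi / sin (pi * y))\<^sup>2 = 1"
  proof -
    have "sin (pi * y) \<noteq> 0"
      using False by (auto simp: sin_zero_iff_int2 Ints_def)
    then show ?thesis by (simp add: power_divide)
  qed
  also have "(\<lambda>N. (sin (pi * y) / pi)\<^sup>2 * (\<Sum>j | \<bar>j\<bar> \<le> int N. inverse ((y - of_int j)\<^sup>2)))
      = (\<lambda>N. \<Sum>j | \<bar>j\<bar> \<le> int N. (sinc (pi * (y - of_int j)))\<^sup>2)"
  proof -
    have sinsq: "(sin (pi * (y - of_int j)))\<^sup>2 = (sin (pi * y))\<^sup>2" for j :: int
    proof -
      have "sin (pi * (y - of_int j)) = sin (pi * y) * cos (pi * of_int j)"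
        by (simp add: right_diff_distrib sin_diff)
      moreover have "(cos (pi * of_int j))\<^sup>2 = 1"
        using sin_cos_squared_add[of "pi * of_int j"] by simp
      ultimately show ?thesis by (simp add: power_mult_distrib)
    qed
    have "(sin (pi * y) / pi)\<^sup>2 * inverse ((y - of_int j)\<^sup>2) = (sinc (pi * (y - of_int j)))\<^sup>2" for j :: int
    proof -
      have "y - of_int j \<noteq> 0" using False by auto
      then have "(sinc (pi * (y - of_int j)))\<^sup>2 = (sin (pi * (y - of_int j)))\<^sup>2 / (pi\<^sup>2 * (y - of_int j)\<^sup>2)"
        by (simp add: power_divide power_mult_distrib)
      also have "\<dots> = (sin (pi * y) / pi)\<^sup>2 * inverse ((y - of_int j)\<^sup>2)"
        unfolding sinsq by (simp add: divide_inverse power_mult_distrib power_inverse mult.assoc)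
      finally show ?thesis ..
    qed
    then show ?thesis by (simp add: sum_distrib_left)
  qed
  finally show ?thesis .
qed

text \<open>Bessel's inequality for an exponential is an equality in the limit. This is the
  completeness statement from which Parseval is derived.\<close>

lemma sum_phi_sq_tendsto:
  assumes "m \<ge> 1"
  shows "(\<lambda>N. \<Sum>j | \<bar>j\<bar> \<le> int N. (phi m j t)\<^sup>2) \<longlonglongrightarrow> m"
proof -
  have "(\<lambda>N. m * (\<Sum>j | \<bar>j\<bar> \<le> int N. (sinc (pi * (m * t - of_int j)))\<^sup>2)) \<longlonglongrightarrow> real m * 1"
    by (intro tendsto_mult_left sum_sinc_sq_tendsto)
  then show ?thesis
    by (simp add: phi_def power_mult_distrib sum_distrib_left)
qed

lemma finite_pair_integrable:
  fixes f :: "'a \<Rightarrow> 'b \<Rightarrow> 'c :: {banach, second_countable_topology}"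
  assumes "finite_measure A" "finite_measure B"
    and "case_prod f \<in> borel_measurable (A \<Otimes>\<^sub>M B)" "\<And>x y. norm (f x y) \<le> c"
  shows "integrable (A \<Otimes>\<^sub>M B) (case_prod f)"
proof -
  interpret finite_measure "A \<Otimes>\<^sub>M B" by (intro finite_measure_pair_measure assms)
  show ?thesis by (rule integrable_const_bound[of _ c]) (use assms(3,4) in auto)
qed

lemma finite_pair_Fubini:
  fixes f :: "'a \<Rightarrow> 'b \<Rightarrow> 'c :: {banach, second_countable_topology}"
  assumes "finite_measure A" "finite_measure B"
    and "case_prod f \<in> borel_measurable (A \<Otimes>\<^sub>M B)" "\<And>x y. norm (f x y) \<le> c"
  shows "(LINT y|B. LINT x|A. f x y) = (LINT x|A. LINT y|B. f x y)"
proof -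
  interpret A: finite_measure A by fact
  interpret B: finite_measure B by fact
  interpret pair_sigma_finite A B ..
  show ?thesis by (rule Fubini_integral[OF finite_pair_integrable[OF assms]])
qed

lemma abs_phi_le: "m \<ge> 1 \<Longrightarrow> \<bar>phi m j t\<bar> \<le> sqrt m"
  using sum_phi_sq_le[of m "{j}" t] by (intro real_le_rsqrt) simp

lemma phi_measurable[measurable]: "phi m j \<in> borel_measurable borel"
  unfolding phi_def[abs_def] by measurable

section \<open>Characteristic functions as mixtures of exponentials\<close>

context
  fixes N :: "real measure" and m :: nat
  assumes N: "real_distribution N" and m: "m \<ge> 1"
begin

interpretation real_distribution N by (rule N)

lemma char_eq_cis: "char N x = (LINT t|N. cis (t * x))"
  by (simp add: char_def cis_conv_exp mult.commute)

lemma bounded_borel_char: "bounded_borel (char N)"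
  by (rule bounded_borelI[of _ 1]) (auto intro: cmod_char_le_1)

lemma trig_coeff_char: "trig_coeff m (char N) j = of_real (LINT t|N. phi m j t)"
proof -
  have "(LINT x|band m. char N x * cis (- (of_int j * x / m)))
      = (LINT x|band m. LINT t|N. cis (t * x) * cis (- (of_int j * x / m)))"
    by (simp add: char_eq_cis)
  also have "\<dots> = (LINT t|N. LINT x|band m. cis (t * x) * cis (- (of_int j * x / m)))"
    by (rule finite_pair_Fubini[of _ _ _ 1]) (auto simp: finite_measure_band norm_mult intro: finite_measure_axioms)
  also have "\<dots> = (LINT t|N. of_real (phi m j t) * of_real (2 * pi * sqrt m))"
    using m by (simp add: phi_eq_integral)
  finally show ?thesis
    using m by (simp add: trig_coeff_def)
qed

text \<open>The defect of Bessel's inequality is a convex function, so for a mixture of exponentials it is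
  at most the mean of the defects.\<close>

lemma trig_defect_char_le:
  assumes J: "finite J"
  shows "(LINT x|band m. (norm (char N x))\<^sup>2) / (2 * pi) - (\<Sum>j\<in>J. (LINT t|N. phi m j t)\<^sup>2)
    \<le> (LINT t|N. m - (\<Sum>j\<in>J. (phi m j t)\<^sup>2))"
proof -
  \<comment> \<open>What the projection leaves of the exponential with frequency
    \<open>t\<close>.\<close>
  define R where "R t x = cis (t * x) - trig_proj m J (\<lambda>x. cis (t * x)) x" for t x
  have R_eq: "R t x = cis (t * x) - (\<Sum>j\<in>J. of_real (phi m j t) * cis (of_int j * x / m)) / of_real (sqrt m)" for t x
    by (simp add: R_def trig_proj_def trig_coeff_cis[OF m])
  have R_meas[measurable]: "case_prod R \<in> borel_measurable (borel \<Otimes>\<^sub>M borel)"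
    unfolding R_eq split_beta' by measurable
  have R_meas'[measurable]: "(\<lambda>t. R t x) \<in> borel_measurable borel" "R t \<in> borel_measurable borel" for x t
    using R_meas by (auto intro: measurable_compose[OF _ R_meas, of "\<lambda>t. (t, x)" for x, simplified]
        measurable_compose[OF _ R_meas, of "\<lambda>x. (t, x)" for t, simplified])
  have R_bound: "norm (R t x) \<le> 1 + real (card J)" for t x
  proof -
    have "norm (\<Sum>j\<in>J. of_real (phi m j t) * cis (of_int j * x / m)) \<le> (\<Sum>j\<in>J. sqrt m)"
      by (rule sum_norm_le) (simp add: norm_mult abs_phi_le[OF m])
    then have "norm ((\<Sum>j\<in>J. of_real (phi m j t) * cis (of_int j * x / m)) / of_real (sqrt m)) \<le> card J"
      using m by (simp add: norm_divide divide_le_eq)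
    then show ?thesis unfolding R_eq by (intro order_trans[OF norm_triangle_ineq4]) simp
  qed
  have R_sq: "(norm (R t x))\<^sup>2 \<le> (1 + real (card J))\<^sup>2" for t x
    by (intro power_mono R_bound) simp
  have R_int: "integrable N (\<lambda>t. R t x)" for x
    by (rule integrable_const_bound[of _ "1 + real (card J)"]) (auto intro: R_bound)
  have R_sq_int: "integrable N (\<lambda>t. (norm (R t x))\<^sup>2)" for x
    by (rule integrable_const_bound[of _ "(1 + real (card J))\<^sup>2"]) (use R_sq in auto)
  \<comment> \<open>By linearity of the projection, the residual of the mixture is the mean of the
    residuals.\<close>
  have char_R: "char N x - trig_proj m J (char N) x = (LINT t|N. R t x)" for x
  proof -
    have int: "integrable N (\<lambda>t. complex_of_real (phi m j t) * cis (of_int j * x / m))" for j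
      by (rule integrable_const_bound[of _ "sqrt m"]) (auto simp: norm_mult abs_phi_le[OF m])
    have int': "integrable N (\<lambda>t. cis (t * x))"
      by (rule integrable_const_bound[of _ 1]) auto
    have "(LINT t|N. R t x) = (LINT t|N. cis (t * x))
        - (LINT t|N. (\<Sum>j\<in>J. of_real (phi m j t) * cis (of_int j * x / m)) / of_real (sqrt m))"
      unfolding R_eq by (rule Bochner_Integration.integral_diff) (use int int' in auto)
    also have "(LINT t|N. (\<Sum>j\<in>J. of_real (phi m j t) * cis (of_int j * x / m)) / of_real (sqrt m))
        = trig_proj m J (char N) x"
      using int by (simp add: trig_proj_def trig_coeff_char)
    finally show ?thesis by (simp add: char_eq_cis)
  qed
  \<comment> \<open>Jensen's inequality for the square, read off from the nonnegativity of the
    variance of the norm.\<close>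
  have jensen: "(norm (LINT t|N. R t x))\<^sup>2 \<le> (LINT t|N. (norm (R t x))\<^sup>2)" for x
  proof -
    have "norm (LINT t|N. R t x) \<le> (LINT t|N. norm (R t x))" by (rule integral_norm_bound)
    then have "(norm (LINT t|N. R t x))\<^sup>2 \<le> (LINT t|N. norm (R t x))\<^sup>2" by (intro power_mono) auto
    also have "\<dots> \<le> (LINT t|N. (norm (R t x))\<^sup>2)"
      using variance_positive[of "\<lambda>t. norm (R t x)"] variance_eq[of "\<lambda>t. norm (R t x)"] R_int R_sq_int by simp
    finally show ?thesis .
  qed
  have "(LINT x|band m. (norm (char N x))\<^sup>2) / (2 * pi) - (\<Sum>j\<in>J. (LINT t|N. phi m j t)\<^sup>2)
      = (LINT x|band m. (norm (LINT t|N. R t x))\<^sup>2) / (2 * pi)"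
    using bessel_identity[OF m J bounded_borel_char] by (simp add: char_R trig_coeff_char)
  also have "\<dots> \<le> (LINT x|band m. LINT t|N. (norm (R t x))\<^sup>2) / (2 * pi)"
  proof (intro divide_right_mono integral_mono)
    show "integrable (band m) (\<lambda>x. (norm (LINT t|N. R t x))\<^sup>2)"
      unfolding char_R[symmetric]
      by (rule integrable_bandI[of _ "(1 + real (card J))\<^sup>2"])
        (use bounded_borel_char bounded_borel_trig_proj in \<open>auto simp: char_R intro!: power_mono
          order_trans[OF integral_norm_bound] integral_le_const R_int R_bound\<close>)
    show "integrable (band m) (\<lambda>x. LINT t|N. (norm (R t x))\<^sup>2)"
      by (rule integrable_bandI[of _ "(1 + real (card J))\<^sup>2"]) (use R_sq in \<open>auto intro!: integral_le_const R_sq_int\<close>)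
  qed (auto intro: jensen)
  also have "(LINT x|band m. LINT t|N. (norm (R t x))\<^sup>2) = (LINT t|N. LINT x|band m. (norm (R t x))\<^sup>2)"
    by (rule finite_pair_Fubini[of _ _ _ "(1 + real (card J))\<^sup>2"])
      (use R_sq in \<open>auto simp: finite_measure_band intro: finite_measure_axioms\<close>)
  also have "\<dots> / (2 * pi) = (LINT t|N. (LINT x|band m. (norm (R t x))\<^sup>2) / (2 * pi))"
    by simp
  also have "\<dots> = (LINT t|N. m - (\<Sum>j\<in>J. (phi m j t)\<^sup>2))"
    unfolding R_def using bessel_identity[OF m J bounded_borel_cis[of "\<lambda>x. t * x" for t]]
    by (simp add: trig_coeff_cis[OF m] measure_band_UNIV)
  finally show ?thesis .
qed

text \<open>Bessel bounds the sums from above. From below they miss the limit by at most the mean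
  defect of the exponentials; these defects lie between 0 and m and tend to 0 at every frequency, so
  dominated convergence closes the gap.\<close>

lemma parseval_band:
  "(\<lambda>K. \<Sum>j | \<bar>j\<bar> \<le> int K. (LINT t|N. phi m j t)\<^sup>2)
    \<longlonglongrightarrow> (LINT x|band m. (norm (char N x))\<^sup>2) / (2 * pi)"
proof (rule real_tendsto_sandwich)
  let ?I = "(LINT x|band m. (norm (char N x))\<^sup>2) / (2 * pi)"
  let ?D = "\<lambda>K. LINT t|N. m - (\<Sum>j | \<bar>j\<bar> \<le> int K. (phi m j t)\<^sup>2)"
  have "?D \<longlonglongrightarrow> (LINT t|N. 0)"
  proof (rule integral_dominated_convergence[where w = "\<lambda>_. m"])
    show "AE t in N. norm (m - (\<Sum>j | \<bar>j\<bar> \<le> int K. (phi m j t)\<^sup>2)) \<le> m" for K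
      using sum_phi_sq_le[OF m finite_abs_le_int[of "int K"]]
      by (intro AE_I2) (simp add: abs_of_nonneg sum_nonneg)
    show "AE t in N. (\<lambda>K. m - (\<Sum>j | \<bar>j\<bar> \<le> int K. (phi m j t)\<^sup>2)) \<longlonglongrightarrow> 0"
      using tendsto_diff[OF tendsto_const sum_phi_sq_tendsto[OF m], of "real m"] by simp
  qed auto
  then show "(\<lambda>K. ?I - ?D K) \<longlonglongrightarrow> ?I"
    using tendsto_diff[OF tendsto_const, of ?D 0 _ ?I] by simp
  show "\<forall>\<^sub>F K in sequentially. ?I - ?D K \<le> (\<Sum>j | \<bar>j\<bar> \<le> int K. (LINT t|N. phi m j t)\<^sup>2)"
    using trig_defect_char_le[of "{j. \<bar>j\<bar> \<le> int K}" for K] by (auto intro!: always_eventually simp: algebra_simps)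
  show "\<forall>\<^sub>F K in sequentially. (\<Sum>j | \<bar>j\<bar> \<le> int K. (LINT t|N. phi m j t)\<^sup>2) \<le> ?I"
    using bessel_ineq[OF m _ bounded_borel_char, of "{j. \<bar>j\<bar> \<le> int K}" for K]
    by (auto intro!: always_eventually simp: trig_coeff_char)
qed (rule tendsto_const)

end

subsection \<open>Plancherel\<close>

lemma cnj_measurable [measurable]: "cnj \<in> borel_measurable borel"
  by (intro borel_measurable_continuous_onI continuous_intros)

text \<open>The Lebesgue integral to which the limit in \<open>fourier\<close> reduces for
  integrable functions; unlike the limit it is open to Fubini.\<close>

definition ft :: "(real \<Rightarrow> complex) \<Rightarrow> real \<Rightarrow> complex" where
  "ft u x = (LINT t|lborel. u t * cis (t * x))"

lemma fourierI:
  assumes "((\<lambda>T. LINT t:{-T..T}|lborel. iexp (t * x) * u t) \<longlongrightarrow> l) at_top"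
  shows "fourier u x = l"
  unfolding fourier_def using assms by (intro tendsto_Lim) auto

lemma integrable_mult_cis:
  assumes "integrable lborel u" "f \<in> borel_measurable borel"
  shows "integrable lborel (\<lambda>t. u t * cis (f t))"
proof (rule Bochner_Integration.integrable_bound[OF assms(1)])
  show "(\<lambda>t. u t * cis (f t)) \<in> borel_measurable lborel"
    using assms by measurable
qed (simp add: norm_mult)

lemma fourier_eq_ft:
  assumes "integrable lborel u"
  shows "fourier u x = ft u x"
proof (rule fourierI)
  have int: "integrable lborel (\<lambda>t. u t * cis (t * x))"
    using assms by (rule integrable_mult_cis) simp
  have "((\<lambda>T. LINT t|lborel. indicator {-T..T} t *\<^sub>R (u t * cis (t * x))) \<longlongrightarrow> (LINT t|lborel. u t * cis (t * x))) at_top"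
  proof (rule integral_dominated_convergence_at_top)
    show "AE t in lborel. ((\<lambda>T. indicator {-T..T} t *\<^sub>R (u t * cis (t * x))) \<longlongrightarrow> u t * cis (t * x)) at_top"
    proof (intro AE_I2 tendsto_eventually)
      fix t :: real
      show "\<forall>\<^sub>F T in at_top. indicator {-T..T} t *\<^sub>R (u t * cis (t * x)) = u t * cis (t * x)"
        using eventually_ge_at_top[of "\<bar>t\<bar>"] by eventually_elim (auto simp: indicator_def)
    qed
    show "\<forall>\<^sub>F T in at_top. AE t in lborel. norm (indicator {-T..T} t *\<^sub>R (u t * cis (t * x))) \<le> norm (u t * cis (t * x))"
      by (auto simp: indicator_def)
    show "integrable lborel (\<lambda>t. norm (u t * cis (t * x)))" using int by (rule integrable_norm)
  qed (use borel_measurable_integrable[OF int] in auto)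
  then show "((\<lambda>T. LINT t:{-T..T}|lborel. iexp (t * x) * u t) \<longlongrightarrow> ft u x) at_top"
    by (simp add: ft_def set_lebesgue_integral_def cis_conv_exp mult.commute)
qed

lemma ft_measurable [measurable]:
  assumes [measurable]: "u \<in> borel_measurable borel"
  shows "ft u \<in> borel_measurable borel"
  unfolding ft_def[abs_def] by measurable

lemma norm_ft_le: "norm (ft u x) \<le> (LINT t|lborel. norm (u t))"
proof -
  have "norm (ft u x) \<le> (LINT t|lborel. norm (u t * cis (t * x)))"
    unfolding ft_def by (rule integral_norm_bound)
  then show ?thesis by (simp add: norm_mult)
qed

lemma cnj_ft: "cnj (ft v x) = (LINT t|lborel. cnj (v t) * cis (- (t * x)))"
  unfolding ft_def Bochner_Integration.integral_cnj[symmetric] by (simp add: cis_cnj)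

section \<open>Gaussian weights\<close>

definition gauss :: "real \<Rightarrow> real \<Rightarrow> real" where
  "gauss e x = exp (- (e * x)\<^sup>2 / 2)"

lemma gauss_measurable [measurable]: "gauss e \<in> borel_measurable borel"
  unfolding gauss_def[abs_def] by measurable

lemma gauss_pos: "0 < gauss e x" and gauss_le_1: "gauss e x \<le> 1"
  by (auto simp: gauss_def)

lemma std_normal_density_eq: "std_normal_density x = exp (- x\<^sup>2 / 2) / sqrt (2 * pi)"
  by (simp add: std_normal_density_def)

text \<open>The characteristic function of the standard normal law, rescaled by
  \<open>e\<close>.\<close>

lemma
  assumes "e > 0"
  shows integrable_gauss: "integrable lborel (gauss e)"
    and integral_gauss_cis: "(LINT x|lborel. of_real (gauss e x) * cis (x * y)) = of_real (sqrt (2 * pi) / e * exp (- (y / e)\<^sup>2 / 2))"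
proof -
  have "integrable lborel (\<lambda>x. sqrt (2 * pi) * std_normal_density (0 + e * x))"
    using assms by (intro integrable_mult_right lborel_integrable_real_affine) auto
  then show "integrable lborel (gauss e)"
    by (simp add: gauss_def[abs_def] std_normal_density_eq)
  have "of_real (exp (- (y / e)\<^sup>2 / 2)) = char std_normal_distribution (y / e)"
    by (simp add: char_std_normal_distribution)
  also have "\<dots> = (LINT x|lborel. std_normal_density x *\<^sub>R iexp (y / e * x))"
    unfolding char_def by (subst integral_density) (auto simp: normal_density_nonneg)
  also have "\<dots> = e *\<^sub>R (LINT x|lborel. std_normal_density (0 + e * x) *\<^sub>R iexp (y / e * (0 + e * x)))"
    using assms by (subst lborel_integral_real_affine[of e _ 0]) auto
  also have "(LINT x|lborel. std_normal_density (0 + e * x) *\<^sub>R iexp (y / e * (0 + e * x)))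
      = (LINT x|lborel. (of_real (gauss e x) * cis (x * y)) / of_real (sqrt (2 * pi)))"
    using assms by (simp add: gauss_def std_normal_density_eq cis_conv_exp scaleR_conv_of_real mult_ac)
  also have "\<dots> = (LINT x|lborel. of_real (gauss e x) * cis (x * y)) / of_real (sqrt (2 * pi))"
    by simp
  finally show "(LINT x|lborel. of_real (gauss e x) * cis (x * y)) = of_real (sqrt (2 * pi) / e * exp (- (y / e)\<^sup>2 / 2))"
    using assms by (simp add: field_simps scaleR_conv_of_real)
qed

lemma integrable_lborel_pair_mult:
  fixes f g :: "real \<Rightarrow> complex"
  assumes f: "integrable lborel f" and g: "integrable lborel g"
    and h[measurable]: "case_prod h \<in> borel_measurable (borel \<Otimes>\<^sub>M borel)" and b: "\<And>x y. norm (h x y) \<le> c"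
  shows "integrable (lborel \<Otimes>\<^sub>M lborel) (\<lambda>(x, y). f x * g y * (h x y :: complex))"
proof (rule Bochner_Integration.integrable_bound)
  note [measurable] = f[THEN borel_measurable_integrable] g[THEN borel_measurable_integrable]
  show "integrable (lborel \<Otimes>\<^sub>M lborel) (\<lambda>(x, y). c *\<^sub>R (f x * g y))"
    unfolding split_beta'
  proof (intro integrable_scaleR_right lborel_pair.Fubini_integrable)
    show "integrable lborel (\<lambda>x. LINT y|lborel. norm (f (fst (x, y)) * g (snd (x, y))))"
      using f by (simp add: norm_mult)
    show "AE x in lborel. integrable lborel (\<lambda>y. f (fst (x, y)) * g (snd (x, y)))"
      using g by simp
  qed measurable
  show "(\<lambda>(x, y). f x * g y * h x y) \<in> borel_measurable (lborel \<Otimes>\<^sub>M lborel)"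
    by measurable
  have "0 \<le> c" using b[of 0 0] norm_ge_zero order_trans by blast
  then show "AE p in lborel \<Otimes>\<^sub>M lborel. norm (case p of (x, y) \<Rightarrow> f x * g y * h x y) \<le> norm (case p of (x, y) \<Rightarrow> c *\<^sub>R (f x * g y))"
    using b by (intro AE_I2) (auto simp: norm_mult split_beta' mult.commute[of c] intro!: mult_left_mono)
qed

text \<open>Plancherel with a Gaussian weight; letting \<open>e\<close> tend to 0 removes the weight.\<close>

lemma gauss_identity:
  assumes u: "integrable lborel u" and v: "integrable lborel v" and e: "e > 0"
  shows "(LINT x|lborel. of_real (gauss e x) * (ft u x * cnj (ft v x)))
      = of_real (2 * pi) * (LINT s|lborel. u s * (LINT z|std_normal_distribution. cnj (v (s + e * z))))"
proof -
  note [measurable] = u[THEN borel_measurable_integrable] v[THEN borel_measurable_integrable]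
  have [measurable]: "u \<in> borel_measurable borel" "v \<in> borel_measurable borel"
    using u v by (auto dest: borel_measurable_integrable)
  let ?w = "\<lambda>x. complex_of_real (gauss e x)"
  have w: "integrable lborel ?w" using integrable_gauss[OF e] by (rule integrable_of_real)
  have cv: "integrable lborel (\<lambda>t. cnj (v t))" using v by simp
  have inner: "(LINT x|lborel. ?w x * cis (s * x) * cnj (ft v x))
      = of_real (2 * pi) * (LINT z|std_normal_distribution. cnj (v (s + e * z)))" for s
  proof -
    have "(LINT x|lborel. ?w x * cis (s * x) * cnj (ft v x))
        = (LINT x|lborel. LINT t|lborel. ?w x * cnj (v t) * cis ((s - t) * x))"
      unfolding cnj_ft
      by (subst Bochner_Integration.integral_mult_right_zero[symmetric])
        (intro Bochner_Integration.integral_cong refl, simp add: cis_mult mult.assoc mult.left_commute[of "cis _"] algebra_simps)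
    also have "\<dots> = (LINT t|lborel. LINT x|lborel. ?w x * cnj (v t) * cis ((s - t) * x))"
      by (rule lborel_pair.Fubini_integral[symmetric])
        (rule integrable_lborel_pair_mult[OF w cv, of "\<lambda>x t. cis ((s - t) * x)" 1], auto)
    also have "\<dots> = (LINT t|lborel. cnj (v t) * (LINT x|lborel. ?w x * cis (x * (s - t))))"
      by (simp add: mult_ac flip: Bochner_Integration.integral_mult_right_zero)
    also have "\<dots> = (LINT t|lborel. cnj (v t) * of_real (sqrt (2 * pi) / e * exp (- ((s - t) / e)\<^sup>2 / 2)))"
      by (simp only: integral_gauss_cis[OF e])
    \<comment> \<open>Substitute t = s + e z. The Jacobian cancels the factor 1 / e, and sqrt (2 pi)
      is 2 pi times the normalising constant of the normal density.\<close>
    also have "\<dots> = e *\<^sub>R (LINT z|lborel. cnj (v (s + e * z)) * of_real (sqrt (2 * pi) / e * exp (- ((s - (s + e * z)) / e)\<^sup>2 / 2)))"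
      using e by (subst lborel_integral_real_affine[of e _ s]) auto
    also have "\<dots> = (LINT z|lborel. of_real (2 * pi) * (std_normal_density z *\<^sub>R cnj (v (s + e * z))))"
    proof -
      have "e * (sqrt (2 * pi) / e * exp (- ((s - (s + e * z)) / e)\<^sup>2 / 2)) = 2 * pi * std_normal_density z" for z
      proof -
        have "((s - (s + e * z)) / e)\<^sup>2 = z\<^sup>2" using e by simp
        moreover have "e * (sqrt (2 * pi) / e * x) = 2 * pi * (x / sqrt (2 * pi))" for x
          using e real_div_sqrt[of "2 * pi"] by (simp add: field_simps)
        ultimately show ?thesis unfolding std_normal_density_eq by simp
      qed
      note k = this
      have "e *\<^sub>R (cnj (v (s + e * z)) * of_real (sqrt (2 * pi) / e * exp (- ((s - (s + e * z)) / e)\<^sup>2 / 2)))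
          = of_real (2 * pi) * (std_normal_density z *\<^sub>R cnj (v (s + e * z)))" for z
      proof -
        have "e *\<^sub>R (a * of_real A) = of_real (2 * pi) * (d *\<^sub>R a)" if "e * A = 2 * pi * d" for a :: complex and A d
        proof -
          have "e *\<^sub>R (a * of_real A) = a * of_real (e * A)" by (simp add: scaleR_conv_of_real)
          then show ?thesis unfolding that by (simp add: scaleR_conv_of_real)
        qed
        from this[OF k] show ?thesis .
      qed
      then show ?thesis unfolding integral_scaleR_right[symmetric] by simp
    qed
    also have "\<dots> = of_real (2 * pi) * (LINT z|std_normal_distribution. cnj (v (s + e * z)))"
      by (simp only: Bochner_Integration.integral_mult_right_zero, subst integral_density) (auto simp: normal_density_nonneg)
    finally show ?thesis .
  qed
  have "(LINT x|lborel. ?w x * (ft u x * cnj (ft v x)))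
      = (LINT x|lborel. LINT s|lborel. ?w x * u s * (cis (s * x) * cnj (ft v x)))"
    unfolding ft_def[of u] by (simp add: mult_ac flip: Bochner_Integration.integral_mult_right_zero Bochner_Integration.integral_mult_left_zero)
  also have "\<dots> = (LINT s|lborel. LINT x|lborel. ?w x * u s * (cis (s * x) * cnj (ft v x)))"
    by (rule lborel_pair.Fubini_integral[symmetric])
      (rule integrable_lborel_pair_mult[OF w u, of _ "LINT t|lborel. norm (v t)"],
       auto simp: norm_mult norm_ft_le)
  also have "\<dots> = (LINT s|lborel. u s * (LINT x|lborel. ?w x * cis (s * x) * cnj (ft v x)))"
    by (simp add: mult_ac flip: Bochner_Integration.integral_mult_right_zero)
  also have "\<dots> = of_real (2 * pi) * (LINT s|lborel. u s * (LINT z|std_normal_distribution. cnj (v (s + e * z))))"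
    unfolding inner by (simp add: mult_ac flip: Bochner_Integration.integral_mult_right_zero)
  finally show ?thesis .
qed

lemma gauss_tendsto_1: "(\<lambda>n. gauss (1 / Suc n) x) \<longlonglongrightarrow> 1"
proof -
  have "(\<lambda>n. gauss (inverse (Suc n)) x) \<longlonglongrightarrow> exp (- (0 * x)\<^sup>2 / 2)"
    unfolding gauss_def by (intro tendsto_intros LIMSEQ_inverse_real_of_nat) auto
  then show ?thesis by (simp add: inverse_eq_divide)
qed

text \<open>The identity above averages \<open>v\<close> over s + z / (n + 1) with z normal; this
  tends to v(s) at every continuity point, and boundedness of \<open>v\<close> dominates both
  integrals. Continuity almost everywhere is the right hypothesis because functions cut off at the
  ends of a band jump there. Regularity is asked of \<open>v\<close> alone, so \<open>u\<close> may
  be a general density.\<close>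

lemma gauss_limit:
  assumes u: "integrable lborel u" and v: "integrable lborel v"
    and b: "bounded_borel v" and cont: "AE s in lborel. isCont v s"
  shows "(\<lambda>n. LINT x|lborel. of_real (gauss (1 / Suc n) x) * (ft u x * cnj (ft v x)))
      \<longlonglongrightarrow> of_real (2 * pi) * (LINT s|lborel. u s * cnj (v s))"
proof -
  interpret G: prob_space std_normal_distribution by (rule prob_space_normal_density) simp
  obtain c where c: "\<And>x. norm (v x) \<le> c" "0 \<le> c" using b by (rule bounded_borelE) auto
  have [measurable]: "u \<in> borel_measurable borel" "v \<in> borel_measurable borel"
    using u v by (auto dest: borel_measurable_integrable)
  let ?I = "\<lambda>n s. LINT z|std_normal_distribution. cnj (v (s + 1 / Suc n * z))"
  have "(\<lambda>n. LINT s|lborel. u s * ?I n s) \<longlonglongrightarrow> (LINT s|lborel. u s * cnj (v s))"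
  proof (rule integral_dominated_convergence[where w = "\<lambda>s. c * norm (u s)"])
    show "AE s in lborel. (\<lambda>n. u s * ?I n s) \<longlonglongrightarrow> u s * cnj (v s)"
      using cont
    proof eventually_elim
      case (elim s)
      have "(\<lambda>n. ?I n s) \<longlonglongrightarrow> (LINT z|std_normal_distribution. cnj (v s))"
      proof (rule integral_dominated_convergence[where w = "\<lambda>_. c"])
        show "AE z in std_normal_distribution. (\<lambda>n. cnj (v (s + 1 / Suc n * z))) \<longlonglongrightarrow> cnj (v s)"
        proof (intro AE_I2 tendsto_cnj isCont_tendsto_compose[OF elim])
          fix z :: real
          have "(\<lambda>n. s + inverse (real (Suc n)) * z) \<longlonglongrightarrow> s + 0 * z"
            by (intro tendsto_intros LIMSEQ_inverse_real_of_nat)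
          then show "(\<lambda>n. s + 1 / Suc n * z) \<longlonglongrightarrow> s" by (simp add: inverse_eq_divide)
        qed
      qed (use c in auto)
      also have "(LINT z|std_normal_distribution. cnj (v s)) = cnj (v s)"
        using G.prob_space by simp
      finally show ?case by (rule tendsto_mult_left)
    qed
    show "AE s in lborel. norm (u s * ?I n s) \<le> c * norm (u s)" for n
    proof (intro AE_I2)
      fix s
      have "norm (?I n s) \<le> c"
        using G.prob_space c
        by (intro order_trans[OF integral_norm_bound] G.integral_le_const G.integrable_const_bound[of _ c]) auto
      then show "norm (u s * ?I n s) \<le> c * norm (u s)"
        by (simp add: norm_mult mult.commute[of c] mult_left_mono)
    qed
    show "(\<lambda>s. u s * ?I n s) \<in> borel_measurable lborel" for n
      by measurable
  qed (use u in auto)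
  then have "(\<lambda>n. of_real (2 * pi) * (LINT s|lborel. u s * ?I n s)) \<longlonglongrightarrow> of_real (2 * pi) * (LINT s|lborel. u s * cnj (v s))"
    by (rule tendsto_mult_left)
  then show ?thesis
    by (subst gauss_identity[OF u v]) auto
qed

lemma ft_norm_sq: "complex_of_real (w * (norm (ft u x))\<^sup>2) = of_real w * (ft u x * cnj (ft u x))"
  by (simp only: of_real_mult complex_norm_square)

lemma integrable_gauss_ft:
  assumes e: "e > 0" and u: "integrable lborel u" and v: "integrable lborel v"
  shows "integrable lborel (\<lambda>x. of_real (gauss e x) * (ft u x * cnj (ft v x)))"
proof (rule Bochner_Integration.integrable_bound)
  let ?c = "(LINT t|lborel. norm (u t)) * (LINT t|lborel. norm (v t))"
  have [measurable]: "u \<in> borel_measurable borel" "v \<in> borel_measurable borel"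
    using u v by (auto dest: borel_measurable_integrable)
  show "integrable lborel (\<lambda>x. gauss e x * ?c)"
    using integrable_gauss[OF e] by simp
  show "(\<lambda>x. of_real (gauss e x) * (ft u x * cnj (ft v x))) \<in> borel_measurable lborel"
    by measurable
  show "AE x in lborel. norm (of_real (gauss e x) * (ft u x * cnj (ft v x))) \<le> norm (gauss e x * ?c)"
    using gauss_pos[of e] by (intro AE_I2) (auto simp: norm_mult abs_mult less_imp_le intro!: mult_mono norm_ft_le)
qed

text \<open>With \<open>u = v\<close> the weighted integrands increase to the squared modulus of the
  transform, so monotone convergence yields integrability together with the value. It is applied to
  trigonometric polynomials cut off at the band.\<close>

lemma plancherel_bounded:
  assumes u: "integrable lborel u" and b: "bounded_borel u" and cont: "AE s in lborel. isCont u s"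
  shows "integrable lborel (\<lambda>x. (norm (ft u x))\<^sup>2)"
    and "(LINT x|lborel. (norm (ft u x))\<^sup>2) = 2 * pi * (LINT s|lborel. (norm (u s))\<^sup>2)"
proof -
  have [measurable]: "u \<in> borel_measurable borel"
    using u by (auto dest: borel_measurable_integrable)
  let ?f = "\<lambda>n x. gauss (1 / Suc n) x * (norm (ft u x))\<^sup>2"
  have int: "integrable lborel (?f n)" for n
    using integrable_Re[OF integrable_gauss_ft[OF _ u u, of "1 / Suc n"]]
    unfolding ft_norm_sq[symmetric] by (simp only: Re_complex_of_real) simp
  have "(\<lambda>n. complex_of_real (LINT x|lborel. ?f n x)) \<longlonglongrightarrow> of_real (2 * pi) * (LINT s|lborel. u s * cnj (u s))"
    using gauss_limit[OF u u b cont] unfolding ft_norm_sq[symmetric] integral_complex_of_real .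
  also have "of_real (2 * pi) * (LINT s|lborel. u s * cnj (u s)) = complex_of_real (2 * pi * (LINT s|lborel. (norm (u s))\<^sup>2))"
    by (simp only: complex_norm_square[symmetric] integral_complex_of_real of_real_mult)
  finally have lim: "(\<lambda>n. LINT x|lborel. ?f n x) \<longlonglongrightarrow> 2 * pi * (LINT s|lborel. (norm (u s))\<^sup>2)"
    by (rule tendsto_of_real_iff[THEN iffD1])
  have mono: "AE x in lborel. mono (\<lambda>n. ?f n x)"
  proof (intro AE_I2 monoI mult_right_mono)
    fix x :: real and i j :: nat assume "i \<le> j"
    then have "(1 / Suc j)\<^sup>2 * x\<^sup>2 \<le> (1 / Suc i)\<^sup>2 * x\<^sup>2"
      by (intro mult_right_mono power_mono divide_left_mono) auto
    then show "gauss (1 / Suc i) x \<le> gauss (1 / Suc j) x" by (simp add: gauss_def power_mult_distrib power_divide)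
  qed auto
  have conv: "AE x in lborel. (\<lambda>n. ?f n x) \<longlonglongrightarrow> (norm (ft u x))\<^sup>2"
    using tendsto_mult_right[OF gauss_tendsto_1] by (intro AE_I2) force
  show "integrable lborel (\<lambda>x. (norm (ft u x))\<^sup>2)"
    by (rule integrable_monotone_convergence[OF int mono conv lim]) measurable
  show "(LINT x|lborel. (norm (ft u x))\<^sup>2) = 2 * pi * (LINT s|lborel. (norm (u s))\<^sup>2)"
    by (rule integral_monotone_convergence[OF int mono conv lim]) measurable
qed

section \<open>The Plancherel inequality by duality\<close>

lemma integrable_indicator_Icc [simp]: "integrable lborel (indicator {a..b :: real} :: real \<Rightarrow> real)"
  by (simp add: integrable_real_indicator emeasure_lborel_Icc_eq)

text \<open>This is the nonnegativity of the squared modulus of a - b; applied pointwise under the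
  integral it does the work of Cauchy-Schwarz.\<close>

lemma two_Re_mult_cnj_le: "2 * Re (a * cnj b) - (norm b)\<^sup>2 \<le> (norm a)\<^sup>2"
proof -
  have "(norm a)\<^sup>2 - (2 * Re (a * cnj b) - (norm b)\<^sup>2) = (Re a - Re b)\<^sup>2 + (Im a - Im b)\<^sup>2"
    by (simp add: cmod_power2 power2_diff)
  then show ?thesis by (smt (verit) zero_le_power2)
qed

text \<open>A density may be unbounded and nowhere continuous, so the Gaussian limit cannot be taken
  for \<open>g\<close> paired with itself. It can be taken for \<open>g\<close> paired with a
  regular \<open>f\<close>, and the supremum of the left side over f is the squared norm of
  \<open>g\<close>.\<close>

lemma plancherel_test_function:
  fixes g f :: "real \<Rightarrow> real"
  assumes g: "integrable lborel g" and G: "integrable lborel (\<lambda>x. (norm (ft g x))\<^sup>2)"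
    and f: "integrable lborel f" and cont: "continuous_on UNIV f" and c: "\<And>x. \<bar>f x\<bar> \<le> c"
  shows "2 * (LINT x|lborel. g x * f x) - (LINT x|lborel. (f x)\<^sup>2) \<le> (LINT x|lborel. (norm (ft g x))\<^sup>2) / (2 * pi)"
proof -
  have [measurable]: "g \<in> borel_measurable borel" "f \<in> borel_measurable borel"
    using g f by (auto dest: borel_measurable_integrable)
  have g': "integrable lborel (\<lambda>x. complex_of_real (g x))" and f': "integrable lborel (\<lambda>x. complex_of_real (f x))"
    using g f by auto
  have b: "bounded_borel (\<lambda>x. complex_of_real (f x))"
    by (rule bounded_borelI[of _ c]) (use c in auto)
  have cont': "AE s in lborel. isCont (\<lambda>x. complex_of_real (f x)) s"
    using cont by (auto simp: continuous_on_eq_continuous_at intro!: AE_I2 continuous_intros)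
  let ?w = "\<lambda>n x. complex_of_real (gauss (1 / Suc n) x)"
  let ?A = "\<lambda>n. LINT x|lborel. ?w n x * (ft g x * cnj (ft f x))"
  let ?B = "\<lambda>n. LINT x|lborel. ?w n x * (ft f x * cnj (ft f x))"
  have A: "(\<lambda>n. Re (?A n)) \<longlonglongrightarrow> 2 * pi * (LINT x|lborel. g x * f x)"
    using tendsto_Re[OF gauss_limit[OF g' f' b cont']]
    by (simp flip: of_real_mult add: integral_complex_of_real)
  have B: "(\<lambda>n. Re (?B n)) \<longlonglongrightarrow> 2 * pi * (LINT x|lborel. (f x)\<^sup>2)"
    using tendsto_Re[OF gauss_limit[OF f' f' b cont']]
    by (simp flip: of_real_mult add: integral_complex_of_real power2_eq_square)
  have "2 * Re (?A n) - Re (?B n) \<le> (LINT x|lborel. (norm (ft g x))\<^sup>2)" for n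
  proof -
    have iA: "integrable lborel (\<lambda>x. ?w n x * (ft g x * cnj (ft f x)))"
      and iB: "integrable lborel (\<lambda>x. ?w n x * (ft f x * cnj (ft f x)))"
      by (intro integrable_gauss_ft g' f'; simp)+
    have "2 * Re (?A n) - Re (?B n)
        = (LINT x|lborel. 2 * Re (?w n x * (ft g x * cnj (ft f x))) - Re (?w n x * (ft f x * cnj (ft f x))))"
      using iA iB by (subst Bochner_Integration.integral_diff) (auto simp del: of_real_mult times_complex.sel)
    also have "\<dots> \<le> (LINT x|lborel. (norm (ft g x))\<^sup>2)"
    proof (rule integral_mono)
      show "integrable lborel (\<lambda>x. 2 * Re (?w n x * (ft g x * cnj (ft f x))) - Re (?w n x * (ft f x * cnj (ft f x))))"
        using iA iB by (intro Bochner_Integration.integrable_diff integrable_mult_right integrable_Re)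
      fix x
      have "2 * Re (?w n x * (ft g x * cnj (ft f x))) - Re (?w n x * (ft f x * cnj (ft f x)))
          = gauss (1 / Suc n) x * (2 * Re (ft g x * cnj (ft f x)) - (norm (ft f x))\<^sup>2)"
        by (simp only: complex_norm_square[symmetric] of_real_mult[symmetric] Re_complex_of_real)
          (simp add: algebra_simps)
      also have "\<dots> \<le> gauss (1 / Suc n) x * (norm (ft g x))\<^sup>2"
        by (intro mult_left_mono two_Re_mult_cnj_le less_imp_le gauss_pos)
      also have "\<dots> \<le> 1 * (norm (ft g x))\<^sup>2"
        by (intro mult_right_mono gauss_le_1) simp
      finally show "2 * Re (?w n x * (ft g x * cnj (ft f x))) - Re (?w n x * (ft f x * cnj (ft f x)))
          \<le> (norm (ft g x))\<^sup>2" by simp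
    qed (rule G)
    finally show ?thesis .
  qed
  then have "2 * (2 * pi * (LINT x|lborel. g x * f x)) - 2 * pi * (LINT x|lborel. (f x)\<^sup>2) \<le> (LINT x|lborel. (norm (ft g x))\<^sup>2)"
    by (intro LIMSEQ_le_const2[OF tendsto_diff[OF tendsto_mult_left[OF A] B]]) auto
  then show ?thesis by (simp add: field_simps)
qed

lemma continuous_approx_AE:
  fixes h :: "real \<Rightarrow> real"
  assumes [measurable]: "h \<in> borel_measurable borel"
  obtains p where "\<And>n. continuous_on UNIV (p n)" "AE x in lborel. (\<lambda>n. p n x) \<longlonglongrightarrow> h x"
proof -
  have "h \<in> borel_measurable lebesgue"
    using assms by (simp add: measurable_completion)
  then have "h measurable_on UNIV"
    by (intro lebesgue_measurable_imp_measurable_on_real) auto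
  then obtain N p where N: "negligible N" and p: "\<And>n. continuous_on UNIV (p n)"
    and lim: "\<And>x. x \<notin> N \<Longrightarrow> (\<lambda>n. p n x) \<longlonglongrightarrow> h x"
    unfolding measurable_on_def by auto
  from N obtain N' where "N' \<in> null_sets lborel" "N \<subseteq> N'"
    by (auto simp: negligible_iff_null_sets null_sets_completion_iff2)
  then have "AE x in lborel. (\<lambda>n. p n x) \<longlonglongrightarrow> h x"
    using lim by (intro AE_I'[of N']) auto
  then show ?thesis using p that by blast
qed

text \<open>The test inequality is first extended to the truncations \<open>h R\<close>, and then R
  tends to infinity.\<close>

lemma plancherel_lower:
  fixes g :: "real \<Rightarrow> real"
  assumes g: "integrable lborel g" and g2: "integrable lborel (\<lambda>x. (g x)\<^sup>2)" and nonneg: "\<And>x. 0 \<le> g x"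
    and G: "integrable lborel (\<lambda>x. (norm (ft g x))\<^sup>2)"
  shows "(LINT x|lborel. (g x)\<^sup>2) \<le> (LINT x|lborel. (norm (ft g x))\<^sup>2) / (2 * pi)"
proof -
  let ?C = "(LINT x|lborel. (norm (ft g x))\<^sup>2) / (2 * pi)"
  have [measurable]: "g \<in> borel_measurable borel"
    using g by (auto dest: borel_measurable_integrable)
  define h where "h R x = (if \<bar>x\<bar> \<le> R then min (g x) R else 0)" for R x :: real
  have h_meas[measurable]: "h R \<in> borel_measurable borel" for R
    unfolding h_def[abs_def] by measurable
  have h_le: "0 \<le> h R x" "h R x \<le> R" "h R x \<le> g x" if "0 \<le> R" for R x
    using that nonneg[of x] by (auto simp: h_def)
  have key: "(LINT x|lborel. (h R x)\<^sup>2) \<le> ?C" if R: "0 \<le> R" for R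
  proof -
    obtain p where p: "\<And>n. continuous_on UNIV (p n)" and lim: "AE x in lborel. (\<lambda>n. p n x) \<longlonglongrightarrow> h R x"
      using continuous_approx_AE[OF h_meas] by blast
    \<comment> \<open>The approximant is clipped to [0, R] and multiplied by a trapezoid that is 1
      on [-R, R] and 0 outside [-R-1, R+1]: it stays continuous, is dominated by an integrable
      function, and keeps its limit \<open>h R\<close>.\<close>
    define f where "f n x = min R (max 0 (p n x)) * max 0 (min 1 (R + 1 - \<bar>x\<bar>))" for n x
    have cont: "continuous_on UNIV (f n)" for n
      unfolding f_def by (intro continuous_intros p)
    then have [measurable]: "f n \<in> borel_measurable borel" for n
      by (rule borel_measurable_continuous_onI)
    have f_le: "0 \<le> f n x" "f n x \<le> R * indicator {-R-1..R+1} x" for n x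
    proof -
      show "0 \<le> f n x" using R by (simp add: f_def)
      have "f n x \<le> R * max 0 (min 1 (R + 1 - \<bar>x\<bar>))"
        unfolding f_def by (intro mult_right_mono) auto
      also have "\<dots> \<le> R * indicator {-R-1..R+1} x"
        using R by (intro mult_left_mono) (auto simp: indicator_def)
      finally show "f n x \<le> R * indicator {-R-1..R+1} x" .
    qed
    have f_abs: "\<bar>f n x\<bar> \<le> R" for n x
      using f_le[of n x] R by (cases "x \<in> {-R-1..R+1}") auto
    have f_int: "integrable lborel (f n)" for n
      by (rule Bochner_Integration.integrable_bound[of _ "\<lambda>x. R * indicator {-R-1..R+1} x"])
        (use f_le in \<open>auto intro!: integrable_mult_right order_trans[OF _ abs_ge_self]\<close>)
    have f_lim: "AE x in lborel. (\<lambda>n. f n x) \<longlonglongrightarrow> h R x"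
      using lim
    proof eventually_elim
      case (elim x)
      then have "(\<lambda>n. f n x) \<longlonglongrightarrow> min R (max 0 (h R x)) * max 0 (min 1 (R + 1 - \<bar>x\<bar>))"
        unfolding f_def by (intro tendsto_intros)
      also have "min R (max 0 (h R x)) * max 0 (min 1 (R + 1 - \<bar>x\<bar>)) = h R x"
        using h_le[OF R, of x] R by (auto simp: h_def min_def max_def)
      finally show ?case .
    qed
    have lim1: "(\<lambda>n. LINT x|lborel. g x * f n x) \<longlonglongrightarrow> (LINT x|lborel. g x * h R x)"
    proof (rule integral_dominated_convergence[where w = "\<lambda>x. R * g x"])
      show "AE x in lborel. (\<lambda>n. g x * f n x) \<longlonglongrightarrow> g x * h R x"
        using f_lim by eventually_elim (rule tendsto_mult_left)
      show "AE x in lborel. norm (g x * f n x) \<le> R * g x" for n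
        using f_abs[of n] nonneg by (auto simp: abs_mult mult.commute[of R] intro!: mult_left_mono)
    qed (use g in auto)
    have lim2: "(\<lambda>n. LINT x|lborel. (f n x)\<^sup>2) \<longlonglongrightarrow> (LINT x|lborel. (h R x)\<^sup>2)"
    proof (rule integral_dominated_convergence[where w = "\<lambda>x. R\<^sup>2 * indicator {-R-1..R+1} x"])
      show "AE x in lborel. (\<lambda>n. (f n x)\<^sup>2) \<longlonglongrightarrow> (h R x)\<^sup>2"
        using f_lim by eventually_elim (rule tendsto_power)
      show "AE x in lborel. norm ((f n x)\<^sup>2) \<le> R\<^sup>2 * indicator {-R-1..R+1} x" for n
      proof (intro AE_I2)
        fix x
        have "(f n x)\<^sup>2 \<le> (R * indicator {-R-1..R+1} x)\<^sup>2"
          by (intro power_mono f_le)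
        then show "norm ((f n x)\<^sup>2) \<le> R\<^sup>2 * indicator {-R-1..R+1} x"
          by (cases "x \<in> {-R-1..R+1}") auto
      qed
    qed auto
    have "2 * (LINT x|lborel. g x * f n x) - (LINT x|lborel. (f n x)\<^sup>2) \<le> ?C" for n
      by (rule plancherel_test_function[OF g G f_int cont f_abs])
    then have le: "2 * (LINT x|lborel. g x * h R x) - (LINT x|lborel. (h R x)\<^sup>2) \<le> ?C"
      by (intro LIMSEQ_le_const2[OF tendsto_diff[OF tendsto_mult_left[OF lim1] lim2]]) auto
    have "integrable lborel (\<lambda>x. g x * h R x)"
      by (rule Bochner_Integration.integrable_bound[OF g2])
        (use h_le[OF R] nonneg in \<open>auto simp: abs_mult power2_eq_square intro!: mult_left_mono\<close>)
    \<comment> \<open>Truncation only lowers \<open>g\<close>, so the pairing of \<open>g\<close>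
      with \<open>h R\<close> is at least the squared norm of \<open>h R\<close>, and the test
      inequality bounds that norm.\<close>
    then have "(LINT x|lborel. (h R x)\<^sup>2) \<le> (LINT x|lborel. g x * h R x)"
      using h_le[OF R] by (intro integral_mono_AE' AE_I2) (auto simp: power2_eq_square nonneg intro!: mult_right_mono)
    with le show ?thesis by simp
  qed
  have "(\<lambda>n. LINT x|lborel. (h (real n) x)\<^sup>2) \<longlonglongrightarrow> (LINT x|lborel. (g x)\<^sup>2)"
  proof (rule integral_dominated_convergence[OF _ _ g2])
    show "AE x in lborel. (\<lambda>n. (h (real n) x)\<^sup>2) \<longlonglongrightarrow> (g x)\<^sup>2"
    proof (intro AE_I2 tendsto_eventually)
      fix x :: real
      show "\<forall>\<^sub>F n in sequentially. (h (real n) x)\<^sup>2 = (g x)\<^sup>2"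
        using eventually_ge_at_top[of "nat \<lceil>max \<bar>x\<bar> (g x)\<rceil>"]
        by eventually_elim (auto simp: h_def min_def)
    qed
    show "AE x in lborel. norm ((h (real n) x)\<^sup>2) \<le> (g x)\<^sup>2" for n
      using h_le[of "real n"] by (auto intro!: power_mono)
  qed auto
  then show ?thesis using key by (intro LIMSEQ_le_const2) auto
qed

lemma integrable_indicator_bounded:
  fixes f :: "real \<Rightarrow> 'b :: {banach, second_countable_topology}"
  assumes [measurable]: "f \<in> borel_measurable borel" and f: "\<And>x. norm (f x) \<le> c"
  shows "integrable lborel (\<lambda>u. indicator {p..q} u *\<^sub>R f u)"
proof (rule Bochner_Integration.integrable_bound)
  show "integrable lborel (\<lambda>u. c * indicator {p..q} u)" by simp
  show "AE u in lborel. norm (indicator {p..q} u *\<^sub>R f u) \<le> norm (c * indicator {p..q} u)"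
    using order_trans[OF f abs_ge_self] by (intro AE_I2) (auto simp: indicator_def)
qed measurable

subsection \<open>The sinc basis\<close>

lemma sin_divide_integral:
  assumes "0 \<le> T"
  shows "set_integrable lborel {0..T} (\<lambda>t. sin (t * \<theta>) / t)"
    and "(LINT t:{0..T}|lborel. sin (t * \<theta>) / t) = sgn \<theta> * Si (T * \<bar>\<theta>\<bar>)"
proof -
  have "norm (sin (t * \<theta>) / t) \<le> \<bar>\<theta>\<bar>" for t
    using abs_sin_x_le_abs_x[of "t * \<theta>"] by (cases "t = 0") (auto simp: divide_le_eq abs_mult mult.commute)
  then show "set_integrable lborel {0..T} (\<lambda>t. sin (t * \<theta>) / t)"
    unfolding set_integrable_def by (intro integrable_indicator_bounded) auto
  show "(LINT t:{0..T}|lborel. sin (t * \<theta>) / t) = sgn \<theta> * Si (T * \<bar>\<theta>\<bar>)"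
    using LBINT_I0c_sin_scale_divide[OF assms, of \<theta>] assms
    by (simp add: interval_integral_Icc zero_ereal_def)
qed

text \<open>A constant in place of the abbreviation \<^term>\<open>sinc\<close>, whose conditional the simplifier would
  split everywhere.\<close>

definition nsinc :: "real \<Rightarrow> real" where
  "nsinc x = sinc x"

lemma nsinc_measurable [measurable]: "nsinc \<in> borel_measurable borel"
  unfolding nsinc_def[abs_def] by measurable

lemma abs_nsinc_le: "\<bar>nsinc x\<bar> \<le> 1"
  using abs_sin_x_le_abs_x[of x] by (auto simp: nsinc_def divide_le_eq)

lemma nsinc_minus [simp]: "nsinc (- x) = nsinc x"
  by (simp add: nsinc_def)

lemma nsinc_nonzero: "x \<noteq> 0 \<Longrightarrow> nsinc x = sin x / x"
  by (simp add: nsinc_def)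

lemma sgn_Si_tendsto: "((\<lambda>T. sgn \<theta> * Si (T * \<bar>\<theta>\<bar>)) \<longlongrightarrow> sgn \<theta> * (pi / 2)) at_top"
proof (cases "\<theta> = 0")
  case False
  then have "filterlim (\<lambda>T. T * \<bar>\<theta>\<bar>) at_top at_top"
    by (intro filterlim_at_top_mult_tendsto_pos[OF tendsto_const] filterlim_ident) auto
  then show ?thesis
    by (intro tendsto_mult_left filterlim_compose[OF Si_at_top])
qed auto

lemma Re_scaleR_cis_of_real: "Re (a *\<^sub>R (cis y * complex_of_real r)) = a *\<^sub>R (cos y * r)"
  by simp

lemma integral_even_Icc:
  fixes k :: "real \<Rightarrow> real"
  assumes [measurable]: "k \<in> borel_measurable borel" and k: "\<And>x. \<bar>k x\<bar> \<le> c" "\<And>x. k (- x) = k x" and T: "0 \<le> T"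
  shows "(LINT u|lborel. indicator {-T..T} u *\<^sub>R k u) = 2 * (LINT u|lborel. indicator {0..T} u *\<^sub>R k u)"
proof -
  have int: "integrable lborel (\<lambda>u. indicator {a..b} u *\<^sub>R k u)" for a b
    by (rule integrable_indicator_bounded[of _ c]) (use k in auto)
  have "(LINT u|lborel. indicator {-T..T} u *\<^sub>R k u) = (LINT u|lborel. indicator {-T..0} u *\<^sub>R k u + indicator {0..T} u *\<^sub>R k u)"
    using T AE_lborel_singleton[of 0] by (intro integral_cong_AE) (auto simp: indicator_def)
  also have "\<dots> = (LINT u|lborel. indicator {-T..0} u *\<^sub>R k u) + (LINT u|lborel. indicator {0..T} u *\<^sub>R k u)"
    by (rule Bochner_Integration.integral_add[OF int int])
  also have "(LINT u|lborel. indicator {-T..0} u *\<^sub>R k u) = (LINT u|lborel. indicator {0..T} u *\<^sub>R k u)"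
    by (subst lborel_integral_real_affine[of "-1" _ 0])
      (auto simp: indicator_def k intro!: Bochner_Integration.integral_cong)
  finally show ?thesis by simp
qed

text \<open>Dirichlet's discontinuous integral: the imaginary part vanishes by symmetry, and the
  product of cosine and sine in the real part splits into two sine integrals. The points with
  \<open>\<bar>x\<bar> = c\<close> are excluded because one sign is 0 there and the limit is half
  the inner value.\<close>

lemma sinc_fourier_symmetric:
  assumes c: "c > 0" and x: "\<bar>x\<bar> \<noteq> c"
  shows "((\<lambda>T. LINT u|lborel. indicator {-T..T} u *\<^sub>R (cis (u * x) * of_real (nsinc (c * u))))
     \<longlongrightarrow> of_real (if \<bar>x\<bar> < c then pi / c else 0)) at_top"
proof -
  let ?h = "\<lambda>u. cis (u * x) * complex_of_real (nsinc (c * u))"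
  let ?k = "\<lambda>u. cos (u * x) * nsinc (c * u)"
  have k_int: "integrable lborel (\<lambda>u. indicator {a..b} u *\<^sub>R ?k u)" for a b
    by (rule integrable_indicator_bounded[of _ 1])
      (measurable, simp only: real_norm_def abs_mult, intro mult_le_one abs_nsinc_le, auto)
  have h_eq: "(LINT u|lborel. indicator {-T..T} u *\<^sub>R ?h u) =
      of_real (1 / c * (sgn (c + x) * Si (T * \<bar>c + x\<bar>) + sgn (c - x) * Si (T * \<bar>c - x\<bar>)))" if T: "0 \<le> T" for T
  proof -
    let ?I = "LINT u|lborel. indicator {-T..T} u *\<^sub>R ?h u"
    have "?I = (LINT u|lborel. indicator {-T..T} (0 + (-1) * u) *\<^sub>R ?h (0 + (-1) * u))"
      by (subst lborel_integral_real_affine[of "-1" _ 0]) auto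
    also have "\<dots> = (LINT u|lborel. cnj (indicator {-T..T} u *\<^sub>R ?h u))"
      by (intro Bochner_Integration.integral_cong) (auto simp: indicator_def cis_cnj)
    also have "\<dots> = cnj ?I" by (rule Bochner_Integration.integral_cnj)
    finally have "?I = cnj ?I" .
    moreover have "Im z = 0" if "z = cnj z" for z using that by (simp add: complex_eq_iff)
    ultimately have "Im ?I = 0" by blast
    moreover have "Re ?I = (LINT u|lborel. indicator {-T..T} u *\<^sub>R ?k u)"
    proof -
      have "integrable lborel (\<lambda>u. indicator {-T..T} u *\<^sub>R ?h u)"
        by (rule integrable_indicator_bounded[of _ 1])
          (measurable, simp only: norm_mult norm_cis norm_of_real mult_1 abs_nsinc_le)
      then have "Re ?I = (LINT u|lborel. Re (indicator {-T..T} u *\<^sub>R ?h u))" by (rule integral_Re[symmetric])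
      then show ?thesis by (simp only: Re_scaleR_cis_of_real)
    qed
    moreover have "(LINT u|lborel. indicator {-T..T} u *\<^sub>R ?k u) = 2 * (LINT u|lborel. indicator {0..T} u *\<^sub>R ?k u)"
      using T by (intro integral_even_Icc[of _ 1]) (auto simp: abs_mult intro!: mult_le_one abs_nsinc_le)
    moreover have "(LINT u|lborel. indicator {0..T} u *\<^sub>R ?k u) =
        (1 / (2 * c)) * (sgn (c + x) * Si (T * \<bar>c + x\<bar>) + sgn (c - x) * Si (T * \<bar>c - x\<bar>))"
    proof -
      have "(LINT u|lborel. indicator {0..T} u *\<^sub>R ?k u)
          = (LINT u|lborel. (1 / (2 * c)) * (indicator {0..T} u *\<^sub>R (sin (u * (c + x)) / u) + indicator {0..T} u *\<^sub>R (sin (u * (c - x)) / u)))"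
      proof (rule integral_cong_AE)
        have "cos (u * x) * nsinc (c * u) = 1 / (2 * c) * (sin (u * (c + x)) / u + sin (u * (c - x)) / u)" if "u \<noteq> 0" for u
          using that c by (simp add: nsinc_nonzero distrib_left right_diff_distrib sin_add sin_diff field_simps)
        then show "AE u in lborel. indicator {0..T} u *\<^sub>R ?k u = (1 / (2 * c)) * (indicator {0..T} u *\<^sub>R (sin (u * (c + x)) / u) + indicator {0..T} u *\<^sub>R (sin (u * (c - x)) / u))"
          using AE_lborel_singleton[of 0] by (auto simp: indicator_def)
      qed measurable
      also have "\<dots> = (1 / (2 * c)) * ((LINT u:{0..T}|lborel. sin (u * (c + x)) / u) + (LINT u:{0..T}|lborel. sin (u * (c - x)) / u))"
        using sin_divide_integral(1)[OF T] unfolding set_integrable_def set_lebesgue_integral_def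
        by (simp only: Bochner_Integration.integral_mult_right_zero Bochner_Integration.integral_add)
      finally show ?thesis by (simp only: sin_divide_integral(2)[OF T])
    qed
    ultimately show ?thesis using c by (auto simp: complex_eq_iff field_simps)
  qed
  have "((\<lambda>T. complex_of_real (1 / c * (sgn (c + x) * Si (T * \<bar>c + x\<bar>) + sgn (c - x) * Si (T * \<bar>c - x\<bar>))))
     \<longlongrightarrow> of_real (1 / c * (sgn (c + x) * (pi / 2) + sgn (c - x) * (pi / 2)))) at_top"
    by (rule tendsto_of_real[OF tendsto_mult_left[OF tendsto_add[OF sgn_Si_tendsto sgn_Si_tendsto]]])
  also have "1 / c * (sgn (c + x) * (pi / 2) + sgn (c - x) * (pi / 2)) = (if \<bar>x\<bar> < c then pi / c else 0)"
    using x c by (auto simp: sgn_if abs_if)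
  finally show ?thesis
    by (rule Lim_transform_eventually[OF _ eventually_mono[OF eventually_ge_at_top[of 0] h_eq[symmetric]]])
qed

text \<open>Translating \<open>phi m j\<close> to the origin moves the symmetric truncation window
  by j / m. The old and new windows differ only inside two intervals of length
  \<open>2 * \<bar>a\<bar>\<close> near -T and T, where sinc is at most 1 / (c (T - |a|)), so the
  shift is invisible in the limit.\<close>

lemma sinc_fourier_shift:
  assumes c: "c > 0" and x: "\<bar>x\<bar> \<noteq> c"
  shows "((\<lambda>T. LINT u|lborel. indicator {-T - a..T - a} u *\<^sub>R (cis (u * x) * of_real (nsinc (c * u))))
     \<longlongrightarrow> of_real (if \<bar>x\<bar> < c then pi / c else 0)) at_top"
proof -
  let ?h = "\<lambda>u. cis (u * x) * complex_of_real (nsinc (c * u))"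
  have h_int: "integrable lborel (\<lambda>u. indicator {p..q} u *\<^sub>R ?h u)" for p q
    by (rule integrable_indicator_bounded[of _ 1])
      (measurable, simp only: norm_mult norm_cis norm_of_real mult_1 abs_nsinc_le)
  let ?D = "\<lambda>T. (LINT u|lborel. indicator {-T - a..T - a} u *\<^sub>R ?h u) - (LINT u|lborel. indicator {-T..T} u *\<^sub>R ?h u)"
  have bound: "norm (?D T) \<le> 4 * \<bar>a\<bar> / (c * (T - \<bar>a\<bar>))" if T: "T > \<bar>a\<bar>" for T
  proof -
    let ?K = "1 / (c * (T - \<bar>a\<bar>))"
    let ?b = "\<lambda>u. ?K * (indicator {-T - \<bar>a\<bar>..-T + \<bar>a\<bar>} u + indicator {T - \<bar>a\<bar>..T + \<bar>a\<bar>} u)"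
    have D: "?D T = (LINT u|lborel. indicator {-T - a..T - a} u *\<^sub>R ?h u - indicator {-T..T} u *\<^sub>R ?h u)"
      by (rule Bochner_Integration.integral_diff[symmetric, OF h_int h_int])
    have B: "norm (LINT u|lborel. indicator {-T - a..T - a} u *\<^sub>R ?h u - indicator {-T..T} u *\<^sub>R ?h u) \<le> (LINT u|lborel. ?b u)"
    proof (rule Bochner_Integration.integral_norm_bound_integral)
      show "integrable lborel (\<lambda>u. indicator {-T - a..T - a} u *\<^sub>R ?h u - indicator {-T..T} u *\<^sub>R ?h u)"
        by (rule Bochner_Integration.integrable_diff[OF h_int h_int])
      show "integrable lborel ?b" by auto
      fix u
      have K: "norm (?h u) \<le> ?K" if "\<bar>u\<bar> \<ge> T - \<bar>a\<bar>"
      proof -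
        have u: "u \<noteq> 0" using that T by auto
        have "norm (?h u) = \<bar>nsinc (c * u)\<bar>"
          by (simp only: norm_mult norm_cis norm_of_real mult_1)
        also have "\<dots> = \<bar>sin (c * u)\<bar> / (c * \<bar>u\<bar>)"
          using u c by (simp add: nsinc_nonzero abs_mult)
        also have "\<dots> \<le> 1 / (c * (T - \<bar>a\<bar>))"
          using c u T that by (intro frac_le mult_left_mono) auto
        finally show ?thesis .
      qed
      have "0 \<le> ?K" using c T by simp
      then have b: "?K \<le> ?b u" if "u \<in> {-T - \<bar>a\<bar>..-T + \<bar>a\<bar>} \<union> {T - \<bar>a\<bar>..T + \<bar>a\<bar>}"
      proof -
        have "?K * 1 \<le> ?b u"
          using that by (intro mult_left_mono \<open>0 \<le> ?K\<close>) (auto simp: indicator_def)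
        then show ?thesis by simp
      qed
      have b0: "0 \<le> ?b u" using \<open>0 \<le> ?K\<close> by (auto simp: indicator_def)
      show "norm (indicator {-T - a..T - a} u *\<^sub>R ?h u - indicator {-T..T} u *\<^sub>R ?h u) \<le> ?b u"
      proof (cases "u \<in> {-T - a..T - a} \<longleftrightarrow> u \<in> {-T..T}")
        case True
        then have "indicator {-T - a..T - a} u = (indicator {-T..T} u :: real)"
          by (auto simp: indicator_def)
        then show ?thesis using b0 by simp
      next
        case False
        then have u: "u \<in> {-T - \<bar>a\<bar>..-T + \<bar>a\<bar>} \<union> {T - \<bar>a\<bar>..T + \<bar>a\<bar>}"
          by (auto simp: abs_if split: if_splits)
        then have "\<bar>u\<bar> \<ge> T - \<bar>a\<bar>" using T by auto
        moreover have "norm (indicator {-T - a..T - a} u *\<^sub>R ?h u - indicator {-T..T} u *\<^sub>R ?h u) = norm (?h u)"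
          using False by (auto simp: indicator_def)
        ultimately show ?thesis using K b[OF u] by linarith
      qed
    qed
    have I: "(LINT u|lborel. ?b u) = 4 * \<bar>a\<bar> / (c * (T - \<bar>a\<bar>))"
    proof -
      have "(LINT u|lborel. (indicator {-T - \<bar>a\<bar>..-T + \<bar>a\<bar>} u + indicator {T - \<bar>a\<bar>..T + \<bar>a\<bar>} u :: real)) = 4 * \<bar>a\<bar>"
        by (subst Bochner_Integration.integral_add) auto
      then show ?thesis by (simp only: Bochner_Integration.integral_mult_right_zero) simp
    qed
    show ?thesis unfolding D I[symmetric] by (rule B)
  qed
  have "((\<lambda>T. 4 * \<bar>a\<bar> / (c * (T - \<bar>a\<bar>))) \<longlongrightarrow> 0) at_top"
  proof (rule tendsto_divide_0[OF tendsto_const])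
    have "filterlim (\<lambda>T. - \<bar>a\<bar> + T) at_top at_top"
      by (rule filterlim_tendsto_add_at_top[OF tendsto_const filterlim_ident])
    then have "filterlim (\<lambda>T. c * (T - \<bar>a\<bar>)) at_top at_top"
      by (intro filterlim_tendsto_pos_mult_at_top[OF tendsto_const c]) simp
    then show "filterlim (\<lambda>T. c * (T - \<bar>a\<bar>)) at_infinity at_top"
      by (rule filterlim_at_top_imp_at_infinity)
  qed
  moreover have "\<forall>\<^sub>F T in at_top. norm (?D T) \<le> 4 * \<bar>a\<bar> / (c * (T - \<bar>a\<bar>))"
    by (rule eventually_mono[OF eventually_gt_at_top[of "\<bar>a\<bar>"] bound])
  ultimately have "(?D \<longlongrightarrow> 0) at_top"
    by (rule Lim_null_comparison[rotated])
  from tendsto_add[OF this sinc_fourier_symmetric[OF c x]] show ?thesis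
    by (simp only: diff_add_cancel add_0)
qed

lemma phi_fourier:
  assumes m: "m \<ge> 1" and x: "\<bar>x\<bar> \<noteq> pi * m"
  shows "((\<lambda>T. LINT t:{-T..T}|lborel. iexp (t * x) * of_real (phi m j t))
     \<longlongrightarrow> (if \<bar>x\<bar> < pi * m then cis (of_int j * x / m) / of_real (sqrt m) else 0)) at_top"
proof -
  let ?a = "of_int j / real m"
  let ?h = "\<lambda>u. cis (u * x) * complex_of_real (nsinc (pi * m * u))"
  have c: "pi * real m > 0" using m by simp
  have eq: "(LINT t:{-T..T}|lborel. iexp (t * x) * of_real (phi m j t))
      = cis (?a * x) * of_real (sqrt m) * (LINT u|lborel. indicator {-T - ?a..T - ?a} u *\<^sub>R ?h u)" for T
  proof -
    have "(LINT t:{-T..T}|lborel. iexp (t * x) * of_real (phi m j t))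
        = (LINT u|lborel. indicator {-T..T} (?a + 1 * u) *\<^sub>R (iexp ((?a + 1 * u) * x) * of_real (phi m j (?a + 1 * u))))"
      unfolding set_lebesgue_integral_def by (subst lborel_integral_real_affine[of 1 _ ?a]) auto
    also have "\<dots> = (LINT u|lborel. cis (?a * x) * of_real (sqrt m) * (indicator {-T - ?a..T - ?a} u *\<^sub>R ?h u))"
    proof (intro Bochner_Integration.integral_cong refl)
      fix u :: real
      have "pi * (m * (?a + 1 * u) - of_int j) = pi * m * u" using m by (simp add: field_simps)
      then have "phi m j (?a + 1 * u) = sqrt m * nsinc (pi * m * u)" unfolding phi_def nsinc_def by (simp only:)
      moreover have "iexp ((?a + 1 * u) * x) = cis (?a * x) * cis (u * x)"
        by (simp only: cis_conv_exp[symmetric] cis_mult) (simp add: algebra_simps)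
      moreover have "indicator {-T..T} (?a + 1 * u) = (indicator {-T - ?a..T - ?a} u :: real)"
        by (auto simp: indicator_def)
      ultimately show "indicator {-T..T} (?a + 1 * u) *\<^sub>R (iexp ((?a + 1 * u) * x) * of_real (phi m j (?a + 1 * u)))
          = cis (?a * x) * of_real (sqrt m) * (indicator {-T - ?a..T - ?a} u *\<^sub>R ?h u)"
        by (simp only: of_real_mult scaleR_conv_of_real mult_ac)
    qed
    finally show ?thesis by (simp only: Bochner_Integration.integral_mult_right_zero)
  qed
  have "((\<lambda>T. LINT t:{-T..T}|lborel. iexp (t * x) * of_real (phi m j t))
     \<longlongrightarrow> cis (?a * x) * of_real (sqrt m) * of_real (if \<bar>x\<bar> < pi * m then pi / (pi * m) else 0)) at_top"
    unfolding eq by (intro tendsto_mult_left sinc_fourier_shift c x)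
  also have "cis (?a * x) * of_real (sqrt m) * of_real (if \<bar>x\<bar> < pi * m then pi / (pi * m) else 0)
      = (if \<bar>x\<bar> < pi * m then cis (of_int j * x / m) / of_real (sqrt m) else 0)"
  proof -
    have "sqrt m * (pi / (pi * m)) = 1 / sqrt m"
      using m by (simp add: field_simps)
    then have "complex_of_real (sqrt m) * of_real (pi / (pi * m)) = of_real (1 / sqrt m)"
      by (simp only: of_real_mult[symmetric])
    then show ?thesis
      by (cases "\<bar>x\<bar> < pi * m") (simp_all only: mult.assoc if_True if_False of_real_0 mult_zero_right times_divide_eq_left,
        simp add: mult.commute)
  qed
  finally show ?thesis .
qed

section \<open>Finite sinc sums\<close>

definition phi_sum :: "nat \<Rightarrow> int set \<Rightarrow> (int \<Rightarrow> real) \<Rightarrow> real \<Rightarrow> real" where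
  "phi_sum m J a t = (\<Sum>j\<in>J. a j * phi m j t)"

lemma phi_sum_measurable [measurable]: "phi_sum m J a \<in> borel_measurable borel"
  unfolding phi_sum_def[abs_def] by measurable

text \<open>Fourier inversion: the sum is written as the transform of a function supported on the
  band, so that Plancherel for integrable functions becomes available.\<close>

lemma phi_sum_eq_ft:
  assumes m: "m \<ge> 1" and J: "finite J"
  shows "complex_of_real (phi_sum m J a t)
    = ft (\<lambda>x. indicator {- (pi * m)..pi * m} x *\<^sub>R ((\<Sum>j\<in>J. a j * cis (- (of_int j * x / m))) / of_real (sqrt m))) t / of_real (2 * pi)"
proof -
  have "complex_of_real (phi_sum m J a t)
      = (\<Sum>j\<in>J. a j * ((LINT x|band m. cis (t * x) * cis (- (of_int j * x / m))) / of_real (2 * pi * sqrt m)))"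
    unfolding phi_sum_def of_real_sum of_real_mult phi_eq_integral[OF m] ..
  also have "\<dots> = (\<Sum>j\<in>J. LINT x|band m. a j / of_real (sqrt m) * (cis (t * x) * cis (- (of_int j * x / m)))) / of_real (2 * pi)"
    by (simp add: sum_divide_distrib field_simps)
  also have "(\<Sum>j\<in>J. LINT x|band m. a j / of_real (sqrt m) * (cis (t * x) * cis (- (of_int j * x / m))))
      = (LINT x|band m. (\<Sum>j\<in>J. a j / of_real (sqrt m) * (cis (t * x) * cis (- (of_int j * x / m)))))"
    by (rule Bochner_Integration.integral_sum[symmetric]) (auto intro!: integrable_band bounded_borel_intros)
  also have "\<dots> = (LINT x|band m. (\<Sum>j\<in>J. a j * cis (- (of_int j * x / m))) / of_real (sqrt m) * cis (x * t))"
    unfolding sum_divide_distrib sum_distrib_right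
    by (intro Bochner_Integration.integral_cong sum.cong) (auto simp: mult_ac)
  also have "\<dots> = ft (\<lambda>x. indicator {- (pi * m)..pi * m} x *\<^sub>R ((\<Sum>j\<in>J. a j * cis (- (of_int j * x / m))) / of_real (sqrt m))) t"
    unfolding ft_def
    by (subst integral_band, measurable) (simp only: set_lebesgue_integral_def mult_scaleR_left)
  finally show ?thesis .
qed

text \<open>Plancherel is applied to the function on the band: it is bounded, integrable, and
  continuous off the two end points. Its energy is the sum of squares by Bessel's identity.\<close>

lemma
  assumes m: "m \<ge> 1" and J: "finite J"
  shows integrable_phi_sum_sq: "integrable lborel (\<lambda>t. (phi_sum m J a t)\<^sup>2)"
    and integral_phi_sum_sq: "(LINT t|lborel. (phi_sum m J a t)\<^sup>2) = (\<Sum>j\<in>J. (a j)\<^sup>2)"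
proof -
  let ?v = "\<lambda>x. (\<Sum>j\<in>J. complex_of_real (a j) * cis (of_int j * x / m)) / of_real (sqrt m)"
  let ?h = "\<lambda>x. (\<Sum>j\<in>J. complex_of_real (a j) * cis (- (of_int j * x / m))) / of_real (sqrt m)"
  let ?u = "\<lambda>x. indicator {- (pi * m)..pi * m} x *\<^sub>R ?h x"
  have bv: "bounded_borel ?v" and bh: "bounded_borel ?h"
    by (auto intro!: bounded_borel_intros)
  note [measurable] = bh[THEN bounded_borel_measurable]
  obtain c where c: "\<And>x. norm (?h x) \<le> c" "0 \<le> c" using bounded_borelE[OF bh] by blast
  have iu: "integrable lborel ?u"
    by (rule integrable_indicator_bounded[OF _ c(1)]) measurable
  have bu: "bounded_borel ?u"
    by (rule bounded_borelI[of _ c]) (use c in \<open>auto simp: indicator_def\<close>)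
  have cu: "AE s in lborel. isCont ?u s"
  proof -
    have "isCont ?u s" if s: "s \<noteq> pi * m" "s \<noteq> - (pi * m)" for s
    proof -
      have "continuous_on UNIV ?h" using m by (intro continuous_intros) auto
      then have "isCont ?h s" by (simp add: continuous_on_eq_continuous_at)
      show ?thesis
      proof (cases "\<bar>s\<bar> < pi * m")
        case True
        then have "s \<in> {- (pi * m)<..<pi * m}" by auto
        then have "\<forall>\<^sub>F x in nhds s. ?u x = ?h x"
          by (intro eventually_mono[OF eventually_nhds_in_open[OF open_greaterThanLessThan]]) auto
        then show ?thesis using \<open>isCont ?h s\<close> isCont_cong by fast
      next
        case False
        then have "s \<in> - {- (pi * m)..pi * m}" using s by auto
        then have "\<forall>\<^sub>F x in nhds s. ?u x = 0"
          by (intro eventually_mono[OF eventually_nhds_in_open[OF open_Compl[OF closed_atLeastAtMost]]]) auto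
        then show ?thesis using isCont_cong[of ?u "\<lambda>_. 0" s] by simp
      qed
    qed
    then show ?thesis
      using AE_lborel_singleton[of "pi * m"] AE_lborel_singleton[of "- (pi * m)"] by auto
  qed
  have sq: "(phi_sum m J a t)\<^sup>2 = (norm (ft ?u t))\<^sup>2 / (2 * pi)\<^sup>2" for t
  proof -
    have "\<bar>phi_sum m J a t\<bar> = norm (ft ?u t) / (2 * pi)"
      using arg_cong[OF phi_sum_eq_ft[OF m J, of a t], of norm] by (simp add: norm_divide)
    then have "\<bar>phi_sum m J a t\<bar>\<^sup>2 = (norm (ft ?u t) / (2 * pi))\<^sup>2" by (simp only:)
    then show ?thesis by (simp add: power_divide)
  qed
  show "integrable lborel (\<lambda>t. (phi_sum m J a t)\<^sup>2)"
    unfolding sq using plancherel_bounded(1)[OF iu bu cu] by (rule integrable_divide_zero[rotated])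
  have "(LINT t|lborel. (phi_sum m J a t)\<^sup>2) = (LINT x|lborel. (norm (?u x))\<^sup>2) / (2 * pi)"
    unfolding sq integral_divide_zero plancherel_bounded(2)[OF iu bu cu] by (simp add: power2_eq_square)
  also have "(LINT x|lborel. (norm (?u x))\<^sup>2) = (LINT x|band m. (norm (?h x))\<^sup>2)"
    by (subst integral_band) (auto simp: set_lebesgue_integral_def indicator_def intro!: Bochner_Integration.integral_cong)
  also have "\<dots> = (LINT x|band m. (norm (?v x))\<^sup>2)"
  proof -
    have "?h x = cnj (?v x)" for x by (simp add: cis_cnj)
    then show ?thesis by (simp only: complex_mod_cnj)
  qed
  also have "\<dots> / (2 * pi) = (\<Sum>j\<in>J. (a j)\<^sup>2)"
  proof -
    \<comment> \<open>A trigonometric polynomial with frequencies in J is its own projection, so its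
      Bessel defect is 0.\<close>
    have co: "trig_coeff m ?v j = a j" if "j \<in> J" for j
      using trig_coeff_sum_cis[OF m J that, of "\<lambda>j. complex_of_real (a j)"] .
    then have "trig_proj m J ?v x = ?v x" for x
      unfolding trig_proj_def by simp
    then have "(LINT x|band m. (norm (?v x - trig_proj m J ?v x))\<^sup>2) = 0"
      by (simp only: diff_self norm_zero) simp
    then have "(LINT x|band m. (norm (?v x))\<^sup>2) / (2 * pi) = (\<Sum>j\<in>J. (norm (trig_coeff m ?v j))\<^sup>2)"
      using bessel_identity[OF m J bv] by (simp only: div_0)
    also have "\<dots> = (\<Sum>j\<in>J. (a j)\<^sup>2)"
      using co by (intro sum.cong) (auto simp only: norm_of_real power2_abs)
    finally show ?thesis .
  qed
  finally show "(LINT t|lborel. (phi_sum m J a t)\<^sup>2) = (\<Sum>j\<in>J. (a j)\<^sup>2)" .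
qed

lemma l2norm_phi_sum: "m \<ge> 1 \<Longrightarrow> finite J \<Longrightarrow> (l2norm (phi_sum m J a))\<^sup>2 = (\<Sum>j\<in>J. (a j)\<^sup>2)"
  unfolding l2norm_def by (simp add: integral_phi_sum_sq sum_nonneg)

lemma integrable_mult_phi:
  assumes g: "integrable lborel g" and m: "m \<ge> 1"
  shows "integrable lborel (\<lambda>x. g x * phi m j x)"
proof (rule Bochner_Integration.integrable_bound)
  show "integrable lborel (\<lambda>x. sqrt m * g x)" using g by simp
  show "(\<lambda>x. g x * phi m j x) \<in> borel_measurable lborel"
    using g by (auto dest: borel_measurable_integrable)
  show "AE x in lborel. norm (g x * phi m j x) \<le> norm (sqrt m * g x)"
    using abs_phi_le[OF m] by (auto simp: abs_mult mult.commute intro!: mult_left_mono)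
qed

text \<open>The split into bias and variance: completing the square leaves two terms free of
  \<open>a\<close>, and the remaining one measures only the error in the coefficients.\<close>

lemma l2norm_diff_phi_sum:
  assumes m: "m \<ge> 1" and J: "finite J" and g: "integrable lborel g" and g2: "integrable lborel (\<lambda>x. (g x)\<^sup>2)"
  defines "c \<equiv> \<lambda>j. LINT x|lborel. g x * phi m j x"
  shows "(l2norm (\<lambda>x. g x - phi_sum m J a x))\<^sup>2 = (LINT x|lborel. (g x)\<^sup>2) - (\<Sum>j\<in>J. (c j)\<^sup>2) + (\<Sum>j\<in>J. (a j - c j)\<^sup>2)"
proof -
  have int: "integrable lborel (\<lambda>x. g x * phi_sum m J a x)"
    unfolding phi_sum_def sum_distrib_left
    using integrable_mult_right[OF integrable_mult_phi[OF g m]] by (auto simp: mult.left_commute intro!: Bochner_Integration.integrable_sum)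
  have cross: "(LINT x|lborel. g x * phi_sum m J a x) = (\<Sum>j\<in>J. a j * c j)"
  proof -
    have "(LINT x|lborel. g x * phi_sum m J a x) = (LINT x|lborel. (\<Sum>j\<in>J. a j * (g x * phi m j x)))"
      by (simp add: phi_sum_def sum_distrib_left mult.left_commute)
    also have "\<dots> = (\<Sum>j\<in>J. LINT x|lborel. a j * (g x * phi m j x))"
      by (intro Bochner_Integration.integral_sum integrable_mult_right integrable_mult_phi g m)
    finally show ?thesis by (simp add: c_def)
  qed
  have "(l2norm (\<lambda>x. g x - phi_sum m J a x))\<^sup>2 = (LINT x|lborel. (g x - phi_sum m J a x)\<^sup>2)"
    unfolding l2norm_def by (simp add: integral_nonneg_AE)
  also have "\<dots> = (LINT x|lborel. (g x)\<^sup>2 - 2 * (g x * phi_sum m J a x) + (phi_sum m J a x)\<^sup>2)"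
    by (simp add: power2_diff algebra_simps)
  also have "\<dots> = (LINT x|lborel. (g x)\<^sup>2) - 2 * (\<Sum>j\<in>J. a j * c j) + (\<Sum>j\<in>J. (a j)\<^sup>2)"
    using int g2 integrable_phi_sum_sq[OF m J]
    by (simp add: cross integral_phi_sum_sq[OF m J])
  also have "\<dots> = (LINT x|lborel. (g x)\<^sup>2) - (\<Sum>j\<in>J. (c j)\<^sup>2) + (\<Sum>j\<in>J. (a j - c j)\<^sup>2)"
    by (simp add: power2_diff sum.distrib sum_subtractf sum_distrib_left algebra_simps)
  finally show ?thesis .
qed

text \<open>With the coefficients of \<open>g\<close> itself, the left side of the previous identity
  is the squared norm of a residual.\<close>

lemma bessel_phi:
  assumes "m \<ge> 1" "finite J" "integrable lborel g" "integrable lborel (\<lambda>x. (g x)\<^sup>2)"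
  shows "(\<Sum>j\<in>J. (LINT x|lborel. g x * phi m j x)\<^sup>2) \<le> (LINT x|lborel. (g x)\<^sup>2)"
proof -
  have "0 \<le> (l2norm (\<lambda>x. g x - phi_sum m J (\<lambda>j. LINT x|lborel. g x * phi m j x) x))\<^sup>2" by simp
  then show ?thesis unfolding l2norm_diff_phi_sum[OF assms] by simp
qed

lemma fourier_phi_sum:
  assumes m: "m \<ge> 1" and J: "finite J" and x: "\<bar>x\<bar> \<noteq> pi * m"
  shows "fourier_real (phi_sum m J a) x
    = (if \<bar>x\<bar> < pi * m then (\<Sum>j\<in>J. a j * cis (of_int j * x / m)) / of_real (sqrt m) else 0)"
proof (rule fourierI)
  have "(LINT t:{-T..T}|lborel. iexp (t * x) * of_real (phi_sum m J a t))
      = (\<Sum>j\<in>J. a j * (LINT t:{-T..T}|lborel. iexp (t * x) * of_real (phi m j t)))" for T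
  proof -
    have int: "integrable lborel (\<lambda>t. indicator {-T..T} t *\<^sub>R (iexp (t * x) * of_real (phi m j t)))" for j
      using abs_phi_le[OF m, of j] by (intro integrable_indicator_bounded[of _ "sqrt m"])
        (auto simp: norm_mult cis_conv_exp[symmetric, unfolded of_real_mult])
    have "(LINT t:{-T..T}|lborel. iexp (t * x) * of_real (phi_sum m J a t))
        = (LINT t|lborel. (\<Sum>j\<in>J. of_real (a j) * (indicator {-T..T} t *\<^sub>R (iexp (t * x) * of_real (phi m j t)))))"
      unfolding set_lebesgue_integral_def phi_sum_def
      by (intro Bochner_Integration.integral_cong) (auto simp: sum_distrib_left scaleR_conv_of_real mult_ac)
    also have "\<dots> = (\<Sum>j\<in>J. LINT t|lborel. of_real (a j) * (indicator {-T..T} t *\<^sub>R (iexp (t * x) * of_real (phi m j t))))"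
      by (intro Bochner_Integration.integral_sum integrable_mult_right int)
    finally show ?thesis
      by (simp only: set_lebesgue_integral_def Bochner_Integration.integral_mult_right_zero)
  qed
  then have "((\<lambda>T. LINT t:{-T..T}|lborel. iexp (t * x) * of_real (phi_sum m J a t))
      \<longlongrightarrow> (\<Sum>j\<in>J. a j * (if \<bar>x\<bar> < pi * m then cis (of_int j * x / m) / of_real (sqrt m) else 0))) at_top"
    by (simp only:) (intro tendsto_sum tendsto_mult_left phi_fourier[OF m x])
  also have "(\<Sum>j\<in>J. a j * (if \<bar>x\<bar> < pi * m then cis (of_int j * x / m) / of_real (sqrt m) else 0))
      = (if \<bar>x\<bar> < pi * m then (\<Sum>j\<in>J. a j * cis (of_int j * x / m)) / of_real (sqrt m) else 0)"
    by (simp add: sum_divide_distrib)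
  finally show "((\<lambda>T. LINT t:{-T..T}|lborel. iexp (t * x) * of_real (phi_sum m J a t))
      \<longlongrightarrow> (if \<bar>x\<bar> < pi * m then (\<Sum>j\<in>J. a j * cis (of_int j * x / m)) / of_real (sqrt m) else 0)) at_top" .
qed

subsection \<open>The estimator\<close>

text \<open>Set to 0 off the band, so that it can be bounded on the whole line although the
  reciprocal of the transform may grow.\<close>

definition recip_band :: "(real \<Rightarrow> complex) \<Rightarrow> nat \<Rightarrow> real \<Rightarrow> complex" where
  "recip_band F m x = (if \<bar>x\<bar> \<le> pi * m then 1 / F x else 0)"

text \<open>The transform of a finite sinc sum vanishes off the band, so \<open>u_fun\<close> has
  compact support up to two points and the truncated integrals are constant once T is at least pi
  m.\<close>

lemma fourier_u_fun:
  assumes m: "m \<ge> 1" and J: "finite J" and bb: "bounded_borel (recip_band (fourier_real f\<epsilon>) m)"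
  shows "fourier (u_fun f\<epsilon> (phi_sum m J a)) z
    = (\<Sum>j\<in>J. a j * trig_coeff m (\<lambda>x. cis (z * x) * recip_band (fourier_real f\<epsilon>) m x) j)"
proof (rule fourierI)
  let ?\<psi> = "recip_band (fourier_real f\<epsilon>) m"
  let ?w = "\<lambda>x. (\<Sum>j\<in>J. a j / of_real (2 * pi * sqrt m) * (cis (z * x) * ?\<psi> x * cis (- (of_int j * x / m))))"
  note [measurable] = bb[THEN bounded_borel_measurable]
  have eq: "iexp (x * z) * u_fun f\<epsilon> (phi_sum m J a) x = ?w x" if "x \<notin> {pi * m, - (pi * m)}" for x
  proof -
    have x: "\<bar>- x\<bar> \<noteq> pi * m" using that by auto
    show ?thesis
    proof (cases "\<bar>x\<bar> < pi * m")
      case True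
      then have "u_fun f\<epsilon> (phi_sum m J a) x = 1 / (2 * pi) * ((\<Sum>j\<in>J. a j * cis (- (of_int j * x / m))) / of_real (sqrt m) * ?\<psi> x)"
        unfolding u_fun_def fourier_phi_sum[OF m J x] by (simp add: recip_band_def)
      moreover have "iexp (x * z) = cis (z * x)" by (simp add: cis_conv_exp mult.commute)
      moreover have "cis (z * x) * (of_real (1 / (2 * pi)) * ((\<Sum>j\<in>J. a j * cis (- (of_int j * x / m))) / of_real (sqrt m) * ?\<psi> x)) = ?w x"
        unfolding sum_divide_distrib sum_distrib_left sum_distrib_right
        by (intro sum.cong) (auto simp: mult_ac)
      ultimately show ?thesis by (simp only:)
    next
      case False
      then have "\<not> \<bar>x\<bar> \<le> pi * m" using x by auto
      then show ?thesis using False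
        unfolding u_fun_def fourier_phi_sum[OF m J x] by (simp add: recip_band_def)
    qed
  qed
  have "(LINT t:{-T..T}|lborel. iexp (t * z) * u_fun f\<epsilon> (phi_sum m J a) t)
      = (\<Sum>j\<in>J. a j * trig_coeff m (\<lambda>x. cis (z * x) * ?\<psi> x) j)" if T: "T \<ge> pi * m" for T
  proof -
    have "(LINT t:{-T..T}|lborel. iexp (t * z) * u_fun f\<epsilon> (phi_sum m J a) t) = (LINT t:{-T..T}|lborel. ?w t)"
      unfolding set_lebesgue_integral_def
    \<comment> \<open>At the two ends of the band the transform of \<open>phi\<close> was not
      determined; they are a null set.\<close>
    proof (rule integral_discrete_difference[where X = "{pi * m, - (pi * m)}"])
      show "indicator {-T..T} x *\<^sub>R (iexp (x * z) * u_fun f\<epsilon> (phi_sum m J a) x) = indicator {-T..T} x *\<^sub>R ?w x"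
        if "x \<notin> {pi * m, - (pi * m)}" for x
        unfolding eq[OF that] ..
    qed auto
    also have "\<dots> = (LINT t:{- (pi * m)..pi * m}|lborel. ?w t)"
      unfolding set_lebesgue_integral_def
      by (rule Bochner_Integration.integral_cong) (use T in \<open>auto simp: indicator_def recip_band_def\<close>)
    also have "\<dots> = (LINT t|band m. ?w t)"
      by (rule integral_band[symmetric]) measurable
    also have "\<dots> = (\<Sum>j\<in>J. LINT t|band m. a j / of_real (2 * pi * sqrt m) * (cis (z * t) * ?\<psi> t * cis (- (of_int j * t / m))))"
      by (intro Bochner_Integration.integral_sum integrable_band bounded_borel_intros bb) auto
    finally show ?thesis by (simp add: trig_coeff_def)
  qed
  then show "((\<lambda>T. LINT t:{-T..T}|lborel. iexp (t * z) * u_fun f\<epsilon> (phi_sum m J a) t)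
      \<longlongrightarrow> (\<Sum>j\<in>J. a j * trig_coeff m (\<lambda>x. cis (z * x) * ?\<psi> x) j)) at_top"
    by (intro tendsto_eventually eventually_mono[OF eventually_ge_at_top[of "pi * m"]])
qed

definition U_coeff :: "(real \<Rightarrow> real) \<Rightarrow> nat \<Rightarrow> int \<Rightarrow> real \<Rightarrow> real" where
  "U_coeff f\<epsilon> m j z = Re (trig_coeff m (\<lambda>x. cis (z * x) * recip_band (fourier_real f\<epsilon>) m x) j)"

text \<open>In coordinates the contrast is a sum of squares around \<open>h\<close> minus a
  constant. \<open>arg_min\<close> chooses among minimisers, so the argument shows that the
  minimiser is unique as a function.\<close>

lemma estimator_eq:
  assumes m: "m \<ge> 1" and n: "n \<ge> 1" and bb: "bounded_borel (recip_band (fourier_real f\<epsilon>) m)"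
  shows "estimator f\<epsilon> m k n z = phi_sum m {j. \<bar>j\<bar> \<le> k} (\<lambda>j. (\<Sum>i=1..n. U_coeff f\<epsilon> m j (z i)) / n)"
proof -
  let ?J = "{j. \<bar>j\<bar> \<le> k}"
  define h where "h j = (\<Sum>i=1..n. U_coeff f\<epsilon> m j (z i)) / n" for j
  have Sm: "t \<in> Sm m k \<longleftrightarrow> (\<exists>a. t = phi_sum m ?J a)" for t
    unfolding Sm_def phi_sum_def by auto
  have con: "contrast f\<epsilon> n z (phi_sum m ?J a) = (\<Sum>j\<in>?J. (a j - h j)\<^sup>2) - (\<Sum>j\<in>?J. (h j)\<^sup>2)" for a
  proof -
    have "contrast f\<epsilon> n z (phi_sum m ?J a) = (\<Sum>j\<in>?J. (a j)\<^sup>2) - 2 / n * (\<Sum>i=1..n. \<Sum>j\<in>?J. a j * U_coeff f\<epsilon> m j (z i))"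
      unfolding contrast_def fourier_u_fun[OF m finite_abs_le_int bb] l2norm_phi_sum[OF m finite_abs_le_int] U_coeff_def
      using n by (simp add: sum_subtractf right_diff_distrib flip: sum_distrib_left)
    also have "(\<Sum>i=1..n. \<Sum>j\<in>?J. a j * U_coeff f\<epsilon> m j (z i)) = n * (\<Sum>j\<in>?J. a j * h j)"
    proof -
      have "(\<Sum>i=1..n. \<Sum>j\<in>?J. a j * U_coeff f\<epsilon> m j (z i)) = (\<Sum>j\<in>?J. \<Sum>i=1..n. a j * U_coeff f\<epsilon> m j (z i))"
        by (rule sum.swap)
      also have "\<dots> = (\<Sum>j\<in>?J. n * (a j * h j))"
        using n by (intro sum.cong) (simp_all add: h_def flip: sum_distrib_left)
      finally show ?thesis by (simp only: sum_distrib_left)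
    qed
    finally show ?thesis
      using n by (simp add: power2_diff sum.distrib sum_subtractf sum_distrib_left algebra_simps)
  qed
  have min: "is_arg_min (contrast f\<epsilon> n z) (\<lambda>t. t \<in> Sm m k) t \<longleftrightarrow> t = phi_sum m ?J h" for t
  proof
    assume *: "is_arg_min (contrast f\<epsilon> n z) (\<lambda>t. t \<in> Sm m k) t"
    then obtain a where t: "t = phi_sum m ?J a" by (auto simp: is_arg_min_def Sm)
    have "phi_sum m ?J h \<in> Sm m k" by (auto simp: Sm)
    then have "contrast f\<epsilon> n z t \<le> contrast f\<epsilon> n z (phi_sum m ?J h)"
      using * by (auto simp: is_arg_min_def not_less)
    then have "(\<Sum>j\<in>?J. (a j - h j)\<^sup>2) \<le> 0" by (simp add: t con)
    then have "(\<Sum>j\<in>?J. (a j - h j)\<^sup>2) = 0" by (intro antisym sum_nonneg) auto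
    then have "\<forall>j\<in>?J. a j = h j" by (subst (asm) sum_nonneg_eq_0_iff) auto
    then show "t = phi_sum m ?J h" unfolding t phi_sum_def by auto
  next
    assume t: "t = phi_sum m ?J h"
    show "is_arg_min (contrast f\<epsilon> n z) (\<lambda>t. t \<in> Sm m k) t"
      unfolding is_arg_min_def
    proof (intro conjI notI)
      show "t \<in> Sm m k" using t by (auto simp: Sm)
      assume "\<exists>y. y \<in> Sm m k \<and> contrast f\<epsilon> n z y < contrast f\<epsilon> n z t"
      then obtain a where "contrast f\<epsilon> n z (phi_sum m ?J a) < contrast f\<epsilon> n z (phi_sum m ?J h)"
        by (auto simp: Sm t)
      moreover have "0 \<le> (\<Sum>j\<in>?J. (a j - h j)\<^sup>2)" by (intro sum_nonneg) auto
      ultimately show False by (simp add: con)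
    qed
  qed
  show ?thesis
    unfolding estimator_def arg_min_def min h_def[symmetric] by simp
qed

subsection \<open>The squared bias\<close>

text \<open>The factor cancels the denominator of sinc and leaves a bounded sine.\<close>

lemma abs_int_mult_phi_le:
  assumes "m \<ge> 1"
  shows "\<bar>(real m * x - of_int j) * phi m j x\<bar> \<le> sqrt m / pi"
proof (cases "real m * x = of_int j")
  case False
  then have "(real m * x - of_int j) * phi m j x = sqrt m * sin (pi * (real m * x - of_int j)) / pi"
    by (simp add: phi_def)
  also have "\<bar>\<dots>\<bar> \<le> sqrt m / pi"
    by (simp add: abs_mult divide_le_cancel mult_left_le)
  finally show ?thesis .
qed simp

text \<open>By telescoping: 1 / (n + 1)^2 is at most 1 / n - 1 / (n + 1).\<close>

lemma sum_inverse_squares_tail: "1 \<le> k \<Longrightarrow> (\<Sum>j\<in>{k<..K}. 1 / (real j)\<^sup>2) \<le> 1 / k"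
proof -
  assume k: "1 \<le> k"
  show ?thesis
  proof (cases "k \<le> K")
    case True
    then have "(\<Sum>j\<in>{k<..K}. 1 / (real j)\<^sup>2) \<le> 1 / k - 1 / K"
    proof (induction K rule: dec_induct)
      case (step n)
      have "{k<..Suc n} = insert (Suc n) {k<..n}" using step by auto
      then have "(\<Sum>j\<in>{k<..Suc n}. 1 / (real j)\<^sup>2) \<le> 1 / k - 1 / n + 1 / (real (Suc n))\<^sup>2"
        using step by simp
      also have "1 / (real (Suc n))\<^sup>2 \<le> 1 / n - 1 / Suc n"
      proof -
        have "1 / (real (Suc n))\<^sup>2 \<le> 1 / (real n * real (Suc n))"
          using step k by (intro divide_left_mono) (auto simp: power2_eq_square)
        also have "\<dots> = 1 / n - 1 / Suc n"
          using step k by (simp add: field_simps)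
        finally show ?thesis .
      qed
      finally show ?case by simp
    qed simp
    then show ?thesis by (rule order_trans) simp
  qed simp
qed

lemma sum_int_tail:
  assumes k: "1 \<le> k" and f: "\<And>j. j \<noteq> 0 \<Longrightarrow> f j \<le> D / (real_of_int j)\<^sup>2" and D: "0 \<le> D"
  shows "(\<Sum>j | int k < \<bar>j\<bar> \<and> \<bar>j\<bar> \<le> int K. f j) \<le> 2 * D / k"
proof -
  have eq: "{j. int k < \<bar>j\<bar> \<and> \<bar>j\<bar> \<le> int K} = int ` {k<..K} \<union> (\<lambda>j. - int j) ` {k<..K}"
  proof (intro equalityI subsetI)
    fix j assume j: "j \<in> {j. int k < \<bar>j\<bar> \<and> \<bar>j\<bar> \<le> int K}"
    then have "nat \<bar>j\<bar> \<in> {k<..K}" "j = int (nat \<bar>j\<bar>) \<or> j = - int (nat \<bar>j\<bar>)" by auto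
    then show "j \<in> int ` {k<..K} \<union> (\<lambda>j. - int j) ` {k<..K}" by blast
  qed auto
  have "(\<Sum>j | int k < \<bar>j\<bar> \<and> \<bar>j\<bar> \<le> int K. f j) = (\<Sum>j\<in>{k<..K}. f (int j)) + (\<Sum>j\<in>{k<..K}. f (- int j))"
    unfolding eq by (subst sum.union_disjoint) (auto simp: sum.reindex inj_on_def)
  also have "\<dots> \<le> (\<Sum>j\<in>{k<..K}. D * (1 / (real j)\<^sup>2)) + (\<Sum>j\<in>{k<..K}. D * (1 / (real j)\<^sup>2))"
    using f k by (intro add_mono sum_mono) (auto intro!: order_trans[OF f])
  also have "\<dots> = 2 * (D * (\<Sum>j\<in>{k<..K}. 1 / (real j)\<^sup>2))"
    by (simp add: sum_distrib_left)
  also have "\<dots> \<le> 2 * (D * (1 / k))"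
    using sum_inverse_squares_tail[OF k] D by (intro mult_left_mono) auto
  finally show ?thesis by simp
qed

lemma ft_eq_char:
  assumes "\<And>x. 0 \<le> g x" "g \<in> borel_measurable borel"
  shows "ft (\<lambda>t. complex_of_real (g t)) x = char (density lborel g) x"
  unfolding char_def ft_def using assms
  by (subst integral_density) (auto simp: cis_conv_exp scaleR_conv_of_real mult.commute)

context
  fixes g :: "real \<Rightarrow> real" and m :: nat
  assumes nonneg: "\<And>x. 0 \<le> g x" and g: "integrable lborel g" and g1: "(LINT x|lborel. g x) = 1"
    and g2: "integrable lborel (\<lambda>x. (g x)\<^sup>2)" and m: "m \<ge> 1"
begin

lemma g_meas [measurable]: "g \<in> borel_measurable borel"
  using g by (auto dest: borel_measurable_integrable)

lemma real_distribution_g: "real_distribution (density lborel g)"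
proof -
  have "emeasure (density lborel g) (space (density lborel g)) = 1"
    using nonneg g g1 by (simp add: emeasure_density nn_integral_eq_integral)
  then interpret prob_space "density lborel g" by (rule prob_spaceI)
  show ?thesis by standard simp
qed

lemma sum_phi_coeff_tendsto:
  "(\<lambda>K. \<Sum>j | \<bar>j\<bar> \<le> int K. (LINT x|lborel. g x * phi m j x)\<^sup>2)
    \<longlonglongrightarrow> (LINT x|band m. (norm (fourier_real g x))\<^sup>2) / (2 * pi)"
  using parseval_band[OF real_distribution_g m] nonneg g
  by (simp add: integral_density fourier_eq_ft ft_eq_char)

text \<open>Parseval on the band combined with Bessel on the line. It is applied to the noise
  density in the proof that \<open>\<gamma>\<close> exceeds 1/2.\<close>

lemma integral_band_fourier_le:
  "(LINT x|band m. (norm (fourier_real g x))\<^sup>2) / (2 * pi) \<le> (LINT x|lborel. (g x)\<^sup>2)"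
  by (rule LIMSEQ_le_const2[OF sum_phi_coeff_tendsto])
    (use bessel_phi[OF m _ g g2] in auto)

text \<open>Write j as m x - (m x - j) under the integral. The part with m x is controlled by the
  second moment of g^2 and the unit norm of \<open>phi\<close>; in the other part the factor cancels
  the denominator of sinc.\<close>

lemma phi_coeff_decay:
  assumes M2: "0 < M2" and int: "integrable lborel (\<lambda>x. x\<^sup>2 * (g x)\<^sup>2)" and le: "(LINT x|lborel. x\<^sup>2 * (g x)\<^sup>2) \<le> M2"
    and j: "j \<noteq> 0"
  shows "(LINT x|lborel. g x * phi m j x)\<^sup>2 \<le> (m * sqrt M2 + sqrt m / pi)\<^sup>2 / (real_of_int j)\<^sup>2"
proof -
  let ?l = "sqrt M2"
  have l: "0 < ?l" using M2 by simp
  have phi2: "integrable lborel (\<lambda>x. (phi m j x)\<^sup>2)" "(LINT x|lborel. (phi m j x)\<^sup>2) = 1"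
    using integrable_phi_sum_sq[OF m, of "{j}" "\<lambda>_. 1"] integral_phi_sum_sq[OF m, of "{j}" "\<lambda>_. 1"]
    by (simp_all add: phi_sum_def)
  \<comment> \<open>The inequality of the means in place of Cauchy-Schwarz; the weight sqrt M2
    balances the two terms, so the integrated bound is exactly sqrt M2.\<close>
  have amgm: "\<bar>x * g x * phi m j x\<bar> \<le> (x\<^sup>2 * (g x)\<^sup>2 / ?l + ?l * (phi m j x)\<^sup>2) / 2" for x
  proof -
    have "0 \<le> (\<bar>x * g x\<bar> - ?l * \<bar>phi m j x\<bar>)\<^sup>2 / (2 * ?l)" using l by simp
    also have "\<dots> = (x\<^sup>2 * (g x)\<^sup>2 / ?l + ?l * (phi m j x)\<^sup>2) / 2 - \<bar>x * g x * phi m j x\<bar>"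
      using l by (simp add: power2_diff power_mult_distrib abs_mult field_simps power2_eq_square)
    finally show ?thesis by simp
  qed
  have i1: "integrable lborel (\<lambda>x. (x\<^sup>2 * (g x)\<^sup>2 / ?l + ?l * (phi m j x)\<^sup>2) / 2)"
    using int phi2 by auto
  have i2: "integrable lborel (\<lambda>x. x * g x * phi m j x)"
    by (rule Bochner_Integration.integrable_bound[OF i1])
      (measurable, intro AE_I2, unfold real_norm_def, rule order_trans[OF amgm abs_ge_self])
  have b2: "\<bar>LINT x|lborel. x * g x * phi m j x\<bar> \<le> ?l"
  proof -
    have "\<bar>LINT x|lborel. x * g x * phi m j x\<bar> \<le> (LINT x|lborel. (x\<^sup>2 * (g x)\<^sup>2 / ?l + ?l * (phi m j x)\<^sup>2) / 2)"
      using integral_abs_bound_integral[OF i2 i1] amgm by auto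
    also have "\<dots> = ((LINT x|lborel. x\<^sup>2 * (g x)\<^sup>2) / ?l + ?l) / 2"
      using int phi2 by simp
    also have "\<dots> \<le> (M2 / ?l + ?l) / 2"
      using le l by (intro divide_right_mono add_right_mono) auto
    also have "\<dots> = ?l" using M2 by (simp add: real_div_sqrt)
    finally show ?thesis .
  qed
  have i3: "integrable lborel (\<lambda>x. g x * ((m * x - of_int j) * phi m j x))"
  proof (rule Bochner_Integration.integrable_bound[OF integrable_mult_left[OF g, of "sqrt m / pi"]])
    show "AE x in lborel. norm (g x * ((m * x - of_int j) * phi m j x)) \<le> norm (g x * (sqrt m / pi))"
    proof (intro AE_I2)
      fix x :: real
      have "g x * \<bar>(m * x - of_int j) * phi m j x\<bar> \<le> g x * (sqrt m / pi)"
        by (intro mult_left_mono abs_int_mult_phi_le m nonneg)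
      then show "norm (g x * ((m * x - of_int j) * phi m j x)) \<le> norm (g x * (sqrt m / pi))"
        using nonneg[of x] by (simp add: abs_mult)
    qed
  qed measurable
  have b3: "\<bar>LINT x|lborel. g x * ((m * x - of_int j) * phi m j x)\<bar> \<le> sqrt m / pi"
  proof -
    have "\<bar>LINT x|lborel. g x * ((m * x - of_int j) * phi m j x)\<bar> \<le> (LINT x|lborel. g x * (sqrt m / pi))"
      using abs_int_mult_phi_le[OF m] nonneg
      by (intro integral_abs_bound_integral i3 integrable_mult_left g)
        (simp only: abs_mult[of "g _"] abs_of_nonneg[OF nonneg], intro mult_left_mono abs_int_mult_phi_le m nonneg)
    then show ?thesis using g1 by simp
  qed
  have "of_int j * (LINT x|lborel. g x * phi m j x) = (LINT x|lborel. m * (x * g x * phi m j x) - g x * ((m * x - of_int j) * phi m j x))"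
    by (subst integral_mult_right_zero[symmetric]) (simp add: algebra_simps)
  also have "\<dots> = m * (LINT x|lborel. x * g x * phi m j x) - (LINT x|lborel. g x * ((m * x - of_int j) * phi m j x))"
    by (subst Bochner_Integration.integral_diff[OF integrable_mult_right[OF i2] i3]) simp
  finally have eq: "of_int j * (LINT x|lborel. g x * phi m j x)
    = m * (LINT x|lborel. x * g x * phi m j x) - (LINT x|lborel. g x * ((m * x - of_int j) * phi m j x))" .
  have "\<bar>of_int j * (LINT x|lborel. g x * phi m j x)\<bar> \<le> m * ?l + sqrt m / pi"
  proof -
    have "\<bar>m * (LINT x|lborel. x * g x * phi m j x)\<bar> \<le> m * ?l"
      using b2 by (simp add: abs_mult mult_left_mono)
    then show ?thesis using b3 unfolding eq by linarith
  qed
  then have "\<bar>of_int j * (LINT x|lborel. g x * phi m j x)\<bar>\<^sup>2 \<le> (m * ?l + sqrt m / pi)\<^sup>2"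
    by (intro power_mono) auto
  then show ?thesis using j by (simp add: field_simps power_mult_distrib)
qed

text \<open>The weight of the smoothness class is at least 1 everywhere, which gives integrability,
  and at least 1 / \<open>?w\<close> outside the band, which gives the bound.\<close>

lemma fourier_tail_le:
  assumes cl: "g \<in> smoothness_class s r b C1" and pars: "0 \<le> s" "0 \<le> r" "0 \<le> b"
  shows "integrable lborel (\<lambda>x. (norm (fourier_real g x))\<^sup>2)"
    and "(LINT x|lborel. (norm (fourier_real g x))\<^sup>2) - (LINT x|band m. (norm (fourier_real g x))\<^sup>2)
      \<le> C1 * (((real m)\<^sup>2 * pi\<^sup>2 + 1) powr (- s) * exp (- 2 * b * pi powr r * real m powr r))"
proof -
  let ?F = "\<lambda>x. (norm (fourier_real g x))\<^sup>2"
  let ?W = "\<lambda>x. (x\<^sup>2 + 1) powr s * exp (2 * b * pow0 \<bar>x\<bar> r)"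
  let ?w = "((real m)\<^sup>2 * pi\<^sup>2 + 1) powr (- s) * exp (- 2 * b * pi powr r * real m powr r)"
  have cg: "integrable lborel (\<lambda>t. complex_of_real (g t))" using g by simp
  have F_eq: "fourier_real g = ft g" by (rule ext) (rule fourier_eq_ft[OF cg])
  have [measurable]: "fourier_real g \<in> borel_measurable borel"
    unfolding F_eq by measurable
  have W: "integrable lborel (\<lambda>x. ?F x * ?W x)" "(LINT x|lborel. ?F x * ?W x) \<le> C1"
    using cl by (auto simp: smoothness_class_def mult.assoc)
  have pow0_nonneg: "0 \<le> pow0 \<bar>x\<bar> r" for x by (simp add: pow0_def)
  have W1: "1 \<le> ?W x" for x
  proof -
    have "1 \<le> (x\<^sup>2 + 1) powr s" using pars by (intro ge_one_powr_ge_zero) auto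
    moreover have "1 \<le> exp (2 * b * pow0 \<bar>x\<bar> r)" using pars pow0_nonneg by simp
    ultimately show ?thesis using mult_mono[of 1 _ 1] by fastforce
  qed
  show FI: "integrable lborel ?F"
  proof (rule Bochner_Integration.integrable_bound[OF W(1)])
    show "AE x in lborel. norm (?F x) \<le> norm (?F x * ?W x)"
    proof (intro AE_I2)
      fix x
      have "?F x * 1 \<le> ?F x * ?W x" by (intro mult_left_mono W1) simp
      then show "norm (?F x) \<le> norm (?F x * ?W x)" by simp
    qed
  qed measurable
  have w0: "0 \<le> ?w" by simp
  have ww: "1 \<le> ?w * ?W x" if x: "\<bar>x\<bar> > pi * m" for x
  proof -
    have "(pi * m)\<^sup>2 \<le> \<bar>x\<bar>\<^sup>2" using x by (intro power_mono) auto
    then have le: "((real m)\<^sup>2 * pi\<^sup>2 + 1) powr s \<le> (x\<^sup>2 + 1) powr s"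
      using pars by (intro powr_mono2) (auto simp: power_mult_distrib mult.commute)
    then have 1: "1 \<le> ((real m)\<^sup>2 * pi\<^sup>2 + 1) powr (- s) * (x\<^sup>2 + 1) powr s"
    proof -
      have "0 < (real m)\<^sup>2 * pi\<^sup>2 + 1" by (intro add_nonneg_pos) auto
      then have "0 < ((real m)\<^sup>2 * pi\<^sup>2 + 1) powr s" by simp
      then show ?thesis
        using le by (simp only: powr_minus inverse_eq_divide mult_1_left times_divide_eq_left le_divide_eq_1_pos)
    qed
    \<comment> \<open>For r = 0 both sides are 1: \<open>m \<ge> 1\<close> keeps the bases of
      \<open>powr\<close> positive, and \<open>pow0\<close> is 1 by definition.\<close>
    have "pi powr r * real m powr r \<le> pow0 \<bar>x\<bar> r"
      using x pars m by (auto simp: pow0_def powr_mult[symmetric] intro!: powr_mono2)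
    then have "2 * b * (pi powr r * real m powr r) \<le> 2 * b * pow0 \<bar>x\<bar> r"
      using pars by (intro mult_left_mono) auto
    then have 2: "1 \<le> exp (- 2 * b * pi powr r * real m powr r) * exp (2 * b * pow0 \<bar>x\<bar> r)"
      by (simp add: mult_exp_exp mult.assoc)
    from mult_mono[OF 1 2] show ?thesis by (simp add: mult_ac)
  qed
  have band: "(LINT x|band m. ?F x) = (LINT x|lborel. indicator {- (pi * m)..pi * m} x *\<^sub>R ?F x)"
    by (subst integral_band) (auto simp: set_lebesgue_integral_def)
  have band_int: "integrable lborel (\<lambda>x. indicator {- (pi * m)..pi * m} x *\<^sub>R ?F x)"
    using integrable_mult_indicator[OF _ FI] by simp
  have "(LINT x|lborel. ?F x) - (LINT x|band m. ?F x) = (LINT x|lborel. ?F x - indicator {- (pi * m)..pi * m} x *\<^sub>R ?F x)"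
    unfolding band by (rule Bochner_Integration.integral_diff[symmetric, OF FI band_int])
  also have "\<dots> \<le> (LINT x|lborel. ?w * (?F x * ?W x))"
  proof (rule integral_mono)
    fix x
    show "?F x - indicator {- (pi * m)..pi * m} x *\<^sub>R ?F x \<le> ?w * (?F x * ?W x)"
    proof (cases "\<bar>x\<bar> \<le> pi * m")
      case True
      then show ?thesis by (auto simp: indicator_def intro!: mult_nonneg_nonneg)
    next
      case False
      then have "?F x * 1 \<le> ?F x * (?w * ?W x)" by (intro mult_left_mono ww) auto
      moreover have "x \<notin> {- (pi * m)..pi * m}" using False by auto
      ultimately show ?thesis by (simp add: mult_ac)
    qed
  qed (use FI band_int W(1) in auto)
  also have "\<dots> = ?w * (LINT x|lborel. ?F x * ?W x)" by simp
  also have "\<dots> \<le> ?w * C1" by (intro mult_left_mono W(2) w0)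
  finally show "(LINT x|lborel. ?F x) - (LINT x|band m. ?F x) \<le> C1 * ?w" by (simp add: mult.commute)
qed

text \<open>The missing energy is that of the transform outside the band plus that of the
  coefficients beyond k. Since \<open>k\<close> is at least n, the latter have index beyond n and
  their decay like 1 / j^2 leaves a term of order 1 / n.\<close>

lemma squared_bias_le:
  assumes M2: "0 < M2" and int: "integrable lborel (\<lambda>x. x\<^sup>2 * (g x)\<^sup>2)" and le: "(LINT x|lborel. x\<^sup>2 * (g x)\<^sup>2) \<le> M2"
    and cl: "g \<in> smoothness_class s r b C1" and pars: "0 \<le> s" "0 \<le> r" "0 \<le> b"
    and n: "1 \<le> n" and k: "int n \<le> k"
  shows "(LINT x|lborel. (g x)\<^sup>2) - (\<Sum>j | \<bar>j\<bar> \<le> k. (LINT x|lborel. g x * phi m j x)\<^sup>2)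
    \<le> C1 / (2 * pi) * ((real m)\<^sup>2 * pi\<^sup>2 + 1) powr (- s) * exp (- 2 * b * pi powr r * real m powr r)
      + 2 * (m * sqrt M2 + sqrt m / pi)\<^sup>2 / n"
proof -
  let ?c = "\<lambda>j. (LINT x|lborel. g x * phi m j x)\<^sup>2" and ?D = "(m * sqrt M2 + sqrt m / pi)\<^sup>2"
  have cg: "integrable lborel (\<lambda>t. complex_of_real (g t))" using g by simp
  have F_eq: "fourier_real g = ft g" by (rule ext) (rule fourier_eq_ft[OF cg])
  have "(\<Sum>j | \<bar>j\<bar> \<le> int K. ?c j) \<le> (\<Sum>j | \<bar>j\<bar> \<le> k. ?c j) + 2 * ?D / n" for K
  proof -
    have fin: "finite {j. int n < \<bar>j\<bar> \<and> \<bar>j\<bar> \<le> int K}"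
      by (rule finite_subset[OF _ finite_abs_le_int[of "int K"]]) auto
    have "(\<Sum>j | \<bar>j\<bar> \<le> int K. ?c j) \<le> (\<Sum>j\<in>{j. \<bar>j\<bar> \<le> k} \<union> {j. int n < \<bar>j\<bar> \<and> \<bar>j\<bar> \<le> int K}. ?c j)"
      using k fin by (intro sum_mono2) auto
    also have "\<dots> \<le> (\<Sum>j | \<bar>j\<bar> \<le> k. ?c j) + (\<Sum>j | int n < \<bar>j\<bar> \<and> \<bar>j\<bar> \<le> int K. ?c j)"
      using fin by (subst sum_Un) (auto intro!: sum_nonneg)
    also have "(\<Sum>j | int n < \<bar>j\<bar> \<and> \<bar>j\<bar> \<le> int K. ?c j) \<le> 2 * ?D / n"
      by (rule sum_int_tail[OF n phi_coeff_decay[OF M2 int le]]) auto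
    finally show ?thesis by simp
  qed
  then have "(LINT x|band m. (norm (fourier_real g x))\<^sup>2) / (2 * pi) \<le> (\<Sum>j | \<bar>j\<bar> \<le> k. ?c j) + 2 * ?D / n"
    by (intro LIMSEQ_le_const2[OF sum_phi_coeff_tendsto]) auto
  moreover have "(LINT x|lborel. (g x)\<^sup>2) \<le> (LINT x|lborel. (norm (fourier_real g x))\<^sup>2) / (2 * pi)"
    using plancherel_lower[OF g g2 nonneg] fourier_tail_le(1)[OF cl pars] unfolding F_eq by simp
  moreover have "(LINT x|lborel. (norm (fourier_real g x))\<^sup>2) / (2 * pi) - (LINT x|band m. (norm (fourier_real g x))\<^sup>2) / (2 * pi)
      \<le> C1 / (2 * pi) * ((real m)\<^sup>2 * pi\<^sup>2 + 1) powr (- s) * exp (- 2 * b * pi powr r * real m powr r)"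
    using divide_right_mono[OF fourier_tail_le(2)[OF cl pars], of "2 * pi"] by (simp add: diff_divide_distrib mult.assoc)
  ultimately show ?thesis by linarith
qed

end

declare g_meas [measurable del]

subsection \<open>Deconvolution\<close>

context
  fixes f :: "real \<Rightarrow> real" and m :: nat and D :: real
  assumes m: "m \<ge> 1" and bb: "bounded_borel (recip_band (fourier_real f) m)"
    and D: "(LINT x|band m. (norm (recip_band (fourier_real f) m x))\<^sup>2) / (2 * pi) \<le> D"
begin

lemma U_coeff_measurable: "U_coeff f m j \<in> borel_measurable borel"
proof -
  note [measurable] = bb[THEN bounded_borel_measurable]
  interpret finite_measure "band m" by (rule finite_measure_band)
  show ?thesis unfolding U_coeff_def[abs_def] trig_coeff_def by measurable
qed

text \<open>The factor \<open>cis (z * x)\<close> has modulus 1, so the bound from Bessel is the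
  same for every z.\<close>

lemma sum_U_coeff_sq_le:
  assumes J: "finite J"
  shows "(\<Sum>j\<in>J. (U_coeff f m j z)\<^sup>2) \<le> D"
proof -
  let ?w = "\<lambda>x. cis (z * x) * recip_band (fourier_real f) m x"
  have "bounded_borel ?w" by (intro bounded_borel_intros bb) auto
  then have "(\<Sum>j\<in>J. (norm (trig_coeff m ?w j))\<^sup>2) \<le> (LINT x|band m. (norm (?w x))\<^sup>2) / (2 * pi)"
    by (rule bessel_ineq[OF m J])
  also have "\<dots> \<le> D" using D by (simp add: norm_mult)
  moreover have "(\<Sum>j\<in>J. (U_coeff f m j z)\<^sup>2) \<le> (\<Sum>j\<in>J. (norm (trig_coeff m ?w j))\<^sup>2)"
    unfolding U_coeff_def by (intro sum_mono) (metis abs_Re_le_cmod norm_ge_zero power2_abs power_mono abs_ge_zero)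
  ultimately show ?thesis by simp
qed

lemma abs_U_coeff_le: "\<bar>U_coeff f m j z\<bar> \<le> sqrt D"
  using sum_U_coeff_sq_le[of "{j}" z] by (intro real_le_rsqrt) simp

text \<open>Cauchy-Schwarz for the kernel: with the values of \<open>phi\<close> at a point as
  \<open>b\<close> it bounds the kernel, with their differences at two points it bounds the
  increments.\<close>

lemma abs_sum_U_coeff_mult_le:
  assumes J: "finite J" and b: "(\<Sum>j\<in>J. (b j)\<^sup>2) \<le> B"
  shows "\<bar>\<Sum>j\<in>J. U_coeff f m j z * b j\<bar> \<le> sqrt (B * D)"
proof -
  have "\<bar>\<Sum>j\<in>J. U_coeff f m j z * b j\<bar> \<le> (\<Sum>j\<in>J. \<bar>U_coeff f m j z\<bar> * \<bar>b j\<bar>)"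
    by (rule order_trans[OF sum_abs]) (simp add: abs_mult)
  also have "\<dots> \<le> L2_set (\<lambda>j. U_coeff f m j z) J * L2_set b J"
    by (rule L2_set_mult_ineq)
  also have "\<dots> \<le> sqrt D * sqrt B"
    unfolding L2_set_def using sum_U_coeff_sq_le[OF J] b by (intro mult_mono) (auto simp: sum_nonneg order_trans[OF sum_nonneg sum_U_coeff_sq_le[OF J]])
  finally show ?thesis by (simp add: real_sqrt_mult mult.commute)
qed

text \<open>Averaging over the noise multiplies the exponential at frequency y by the transform of
  \<open>f\<close> at y, which cancels the reciprocal on the band and leaves the coefficient of a
  pure exponential.\<close>

lemma U_coeff_deconvolution:
  assumes nonneg: "\<And>x. 0 \<le> f x" and f: "integrable lborel f" and f1: "(LINT x|lborel. f x) = 1"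
    and nz: "\<And>x. fourier_real f x \<noteq> 0"
  shows "(LINT e|density lborel f. U_coeff f m j (x + e)) = phi m j x"
proof -
  have [measurable]: "f \<in> borel_measurable borel" using f by auto
  let ?N = "density lborel f"
  have "emeasure ?N (space ?N) = 1"
    using nonneg f f1 by (simp add: emeasure_density nn_integral_eq_integral)
  then interpret prob_space ?N by (rule prob_spaceI)
  let ?\<psi> = "recip_band (fourier_real f) m"
  note [measurable] = bb[THEN bounded_borel_measurable]
  interpret B: finite_measure "band m" by (rule finite_measure_band)
  obtain c where c: "\<And>x. norm (?\<psi> x) \<le> c" "0 \<le> c" using bounded_borelE[OF bb] by blast
  let ?I = "\<lambda>e. LINT y|band m. cis ((x + e) * y) * ?\<psi> y * cis (- (of_int j * y / m))"
  have F_eq: "fourier_real f y = (LINT e|?N. cis (e * y))" for y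
    using f nonneg by (simp add: fourier_eq_ft ft_eq_char char_def cis_conv_exp mult.commute)
  have int: "integrable ?N ?I"
  proof (rule integrable_const_bound[of _ "c * measure (band m) UNIV"])
    show "AE e in ?N. norm (?I e) \<le> c * measure (band m) UNIV"
    proof (intro AE_I2)
      fix e
      have "norm (?I e) \<le> (LINT y|band m. c)"
        by (rule Bochner_Integration.integral_norm_bound_integral)
          (auto simp: norm_mult c intro!: integrable_band bounded_borel_intros bb)
      then show "norm (?I e) \<le> c * measure (band m) UNIV" by (simp add: mult.commute)
    qed
  qed measurable
  have "(LINT e|?N. ?I e) = (LINT y|band m. LINT e|?N. cis ((x + e) * y) * ?\<psi> y * cis (- (of_int j * y / m)))"
    by (rule finite_pair_Fubini[of _ _ _ c]) (auto simp: finite_measure_band norm_mult c intro: finite_measure_axioms)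
  also have "\<dots> = (LINT y|band m. cis (x * y) * cis (- (of_int j * y / m)))"
  proof (rule integral_cong_AE)
    show "AE y in band m. (LINT e|?N. cis ((x + e) * y) * ?\<psi> y * cis (- (of_int j * y / m)))
      = cis (x * y) * cis (- (of_int j * y / m))"
      using AE_band[of m]
    proof eventually_elim
      case (elim y)
      have split: "cis ((x + e) * y) = cis (e * y) * cis (x * y)" for e
        by (simp add: cis_mult algebra_simps)
      have "(LINT e|?N. cis ((x + e) * y) * ?\<psi> y * cis (- (of_int j * y / m)))
        = (LINT e|?N. cis (e * y) * (cis (x * y) * ?\<psi> y * cis (- (of_int j * y / m))))"
        unfolding split by (simp only: mult_ac)
      also have "\<dots> = fourier_real f y * (cis (x * y) * ?\<psi> y * cis (- (of_int j * y / m)))"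
        unfolding F_eq by (rule Bochner_Integration.integral_mult_left_zero)
      also have "\<dots> = cis (x * y) * cis (- (of_int j * y / m))"
        using elim nz[of y] by (simp add: recip_band_def)
      finally show ?case .
    qed
  qed measurable
  finally have "(LINT e|?N. ?I e) / of_real (2 * pi * sqrt m) = of_real (phi m j x)"
    unfolding phi_eq_integral[OF m] by simp
  then have "(LINT e|?N. ?I e / of_real (2 * pi * sqrt m)) = of_real (phi m j x)" by simp
  moreover have "(LINT e|?N. U_coeff f m j (x + e)) = Re (LINT e|?N. ?I e / of_real (2 * pi * sqrt m))"
    unfolding U_coeff_def trig_coeff_def by (rule integral_Re) (use int in auto)
  ultimately show ?thesis by simp
qed

end

subsection \<open>Conditional distributions\<close>

text \<open>A bound valid for all sets passes to averages of indicators. Averaging rather than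
  summing over level sets keeps the constant at \<open>d\<close>, whatever the number of
  levels.\<close>

lemma integral_unit_diff_le:
  assumes "prob_space K" "prob_space P" and sets: "sets K = sets P"
    and h: "h \<in> borel_measurable P" and h01: "\<And>x. 0 \<le> h x" "\<And>x. h x \<le> 1"
    and d: "\<And>A. A \<in> sets P \<Longrightarrow> measure K A \<le> measure P A + d"
  shows "(LINT x|K. h x) \<le> (LINT x|P. h x) + d"
proof (rule field_le_epsilon)
  interpret K: prob_space K by fact
  interpret P: prob_space P by fact
  have space: "space K = space P" by (rule sets_eq_imp_space_eq[OF sets])
  have [measurable]: "h \<in> borel_measurable P" "h \<in> borel_measurable K"
    using h by (simp_all cong: measurable_cong_sets add: sets)
  fix e :: real assume "0 < e"
  then obtain N0 where "1 / real (Suc N0) < e" by (rule nat_approx_posE)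
  then obtain N where N: "0 < N" "1 / real N < e" by blast
  let ?A = "\<lambda>k. {x \<in> space P. real k \<le> N * h x}"
  have A: "?A k \<in> sets P" "?A k \<in> sets K" for k by (simp_all add: sets)
  \<comment> \<open>\<open>h\<close> rounded down to multiples of \<open>1 / N\<close>, as an average of indicators of level sets\<close>
  define s where "s x = (\<Sum>k=1..N. indicator (?A k) x) / real N" for x
  have s_eq: "s x = real (nat \<lfloor>N * h x\<rfloor>) / N" if "x \<in> space P" for x
  proof -
    have "(\<Sum>k=1..N. indicator (?A k) x :: real) = real (card {k\<in>{1..N}. real k \<le> N * h x})"
      using that by (simp add: indicator_def sum.If_cases Int_def)
    also have "{k\<in>{1..N}. real k \<le> N * h x} = {1..nat \<lfloor>N * h x\<rfloor>}"
    proof -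
      have "N * h x \<le> N" using h01(2)[of x] by (simp add: mult_left_le)
      then have "nat \<lfloor>N * h x\<rfloor> \<le> N" by linarith
      moreover have "real k \<le> N * h x \<longleftrightarrow> k \<le> nat \<lfloor>N * h x\<rfloor>" if "1 \<le> k" for k
        using that by linarith
      ultimately show ?thesis by auto
    qed
    finally show ?thesis by (simp add: s_def)
  qed
  have s: "s x \<le> h x" "h x \<le> s x + 1 / N" if "x \<in> space P" for x
  proof -
    have "real (nat \<lfloor>N * h x\<rfloor>) = of_int \<lfloor>N * h x\<rfloor>" using h01(1)[of x] by simp
    then have "real (nat \<lfloor>N * h x\<rfloor>) \<le> N * h x" "N * h x \<le> real (nat \<lfloor>N * h x\<rfloor>) + 1" by linarith+
    then show "s x \<le> h x" "h x \<le> s x + 1 / N"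
      using N by (simp_all add: s_eq[OF that] field_simps)
  qed
  have ind: "integrable P (indicator (?A k) :: _ \<Rightarrow> real)" "integrable K (indicator (?A k) :: _ \<Rightarrow> real)" for k
    using A by (auto intro!: P.integrable_const_bound[of _ 1] K.integrable_const_bound[of _ 1])
  have int: "integrable P s" "integrable K s" "integrable P h" "integrable K h"
  proof -
    show "integrable P s" "integrable K s" unfolding s_def[abs_def]
      by (intro integrable_divide_zero Bochner_Integration.integrable_sum ind)+
    show "integrable P h" "integrable K h"
      by (intro P.integrable_const_bound[of _ 1] K.integrable_const_bound[of _ 1] AE_I2; simp add: h01)+
  qed
  have Ps: "(LINT x|P. s x) = (\<Sum>k=1..N. measure P (?A k)) / N"
    unfolding s_def integral_divide_zero by (subst Bochner_Integration.integral_sum[OF ind(1)]) (use A in simp)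
  have Ks: "(LINT x|K. s x) = (\<Sum>k=1..N. measure K (?A k)) / N"
    unfolding s_def integral_divide_zero by (subst Bochner_Integration.integral_sum[OF ind(2)]) (use A in simp)
  have "(LINT x|K. h x) \<le> (LINT x|K. s x + 1 / N)"
    by (rule integral_mono[OF int(4)]) (auto simp: int(2) space s(2))
  also have "\<dots> = (LINT x|K. s x) + 1 / N"
    by (subst Bochner_Integration.integral_add[OF int(2)]) (simp_all add: K.prob_space)
  also have "(LINT x|K. s x) \<le> (\<Sum>k=1..N. measure P (?A k) + d) / N"
    unfolding Ks using d[OF A(1)] by (intro divide_right_mono sum_mono) auto
  also have "\<dots> = (LINT x|P. s x) + d"
    using N(1) by (simp add: Ps sum.distrib add_divide_distrib)
  also have "(LINT x|P. s x) \<le> (LINT x|P. h x)"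
    by (rule integral_mono[OF int(1,3) s(1)])
  also have "1 / real N \<le> e" using N(2) by simp
  finally show "(LINT x|K. h x) \<le> (LINT x|P. h x) + d + e" by simp
qed

text \<open>The affine map from [-c, c] to [0, 1] brings \<open>h\<close> into the range of the
  previous lemma; its slope is the origin of the factor 2 c.\<close>

lemma abs_integral_diff_le_total_variation:
  assumes KP: "prob_space K" "prob_space P" and sets: "sets K = sets P"
    and h: "h \<in> borel_measurable P" and hc: "\<And>x. \<bar>h x\<bar> \<le> c" and c: "0 < c"
  shows "ennreal (\<bar>(LINT x|K. h x) - (LINT x|P. h x)\<bar> / (2 * c)) \<le> (\<Squnion>A\<in>sets P. ennreal \<bar>measure K A - measure P A\<bar>)"
    (is "_ \<le> ?S")
proof -
  interpret K: prob_space K by (rule KP)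
  interpret P: prob_space P by (rule KP)
  have [measurable]: "h \<in> borel_measurable P" "h \<in> borel_measurable K"
    using h by (simp_all cong: measurable_cong_sets add: sets)
  \<comment> \<open>Needed to read the extended supremum as a real number.\<close>
  have "?S \<le> 1"
  proof (rule SUP_least)
    fix A assume "A \<in> sets P"
    have "0 \<le> measure K A" "measure K A \<le> 1" "0 \<le> measure P A" "measure P A \<le> 1" by auto
    then have "\<bar>measure K A - measure P A\<bar> \<le> 1" by linarith
    then show "ennreal \<bar>measure K A - measure P A\<bar> \<le> 1" by simp
  qed
  then have fin: "?S < \<top>" by (rule order_le_less_trans) simp
  then obtain d where d: "?S = ennreal d" "0 \<le> d" by (cases ?S) auto
  have dA: "\<bar>measure K A - measure P A\<bar> \<le> d" if "A \<in> sets P" for A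
    using SUP_upper[OF that, of "\<lambda>A. ennreal \<bar>measure K A - measure P A\<bar>"] d by simp
  have dA1: "measure K A \<le> measure P A + d" and dA2: "measure P A \<le> measure K A + d" if "A \<in> sets P" for A
    using dA[OF that] by linarith+
  let ?h = "\<lambda>x. (h x + c) / (2 * c)"
  have h01: "0 \<le> ?h x" "?h x \<le> 1" for x using hc[of x] c by (simp_all add: abs_le_iff)
  have int: "integrable K h" "integrable P h"
    using hc by (auto intro!: K.integrable_const_bound[of _ c] P.integrable_const_bound[of _ c])
  have "(LINT x|K. ?h x) \<le> (LINT x|P. ?h x) + d"
    by (rule integral_unit_diff_le[OF KP sets _ h01 dA1]) measurable
  moreover have "(LINT x|P. ?h x) \<le> (LINT x|K. ?h x) + d"
    by (rule integral_unit_diff_le[OF KP(2,1) sets[symmetric] _ h01 dA2]) (measurable, simp add: sets)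
  ultimately have "\<bar>(LINT x|K. h x) - (LINT x|P. h x)\<bar> / (2 * c) \<le> d"
  proof -
    have 1: "(LINT x|K. ?h x) = ((LINT x|K. h x) + c) / (2 * c)"
      using int by (simp add: K.prob_space)
    have 2: "(LINT x|P. ?h x) = ((LINT x|P. h x) + c) / (2 * c)"
      using int by (simp add: P.prob_space)
    assume "(LINT x|K. ?h x) \<le> (LINT x|P. ?h x) + d" "(LINT x|P. ?h x) \<le> (LINT x|K. ?h x) + d"
    moreover have "\<bar>(LINT x|K. h x) - (LINT x|P. h x)\<bar> / (2 * c) = \<bar>(LINT x|K. h x) / (2 * c) - (LINT x|P. h x) / (2 * c)\<bar>"
      using c by (simp flip: diff_divide_distrib)
    ultimately show ?thesis unfolding 1 2 unfolding add_divide_distrib by linarith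
  qed
  then show ?thesis using d by (simp add: ennreal_leI)
qed

lemma prob_kernel_measurable:
  assumes "K \<in> F \<rightarrow>\<^sub>M prob_algebra borel" "subalgebra M F"
  shows "K \<in> M \<rightarrow>\<^sub>M subprob_algebra borel"
  by (rule measurable_prob_algebraD[OF measurable_from_subalg[OF assms(2,1)]])

context prob_space
begin

text \<open>The definition of a conditional distribution speaks of one set at a time. Reweighting M
  by \<open>u\<close> turns this into an identity between two measures, against which any bounded
  \<open>h\<close> can be integrated.\<close>

lemma cond_distr_integral_nonneg:
  fixes u :: "'a \<Rightarrow> real" and h :: "real \<times> real \<Rightarrow> real"
  assumes K: "is_cond_distr M F W K" and F: "subalgebra M F" and W [measurable]: "W \<in> borel_measurable M"
    and u [measurable]: "u \<in> borel_measurable F" and uc: "\<And>\<omega>. 0 \<le> u \<omega>" "\<And>\<omega>. u \<omega> \<le> c"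
    and h [measurable]: "h \<in> borel_measurable borel" and hc: "\<And>w. 0 \<le> h w" "\<And>w. h w \<le> c'"
  shows "(LINT \<omega>|M. u \<omega> * h (W \<omega>)) = (LINT \<omega>|M. u \<omega> * (LINT w|K \<omega>. h w))"
proof -
  have [measurable]: "u \<in> borel_measurable M" by (rule measurable_from_subalg[OF F u])
  have KF: "K \<in> F \<rightarrow>\<^sub>M prob_algebra borel" using K by (simp add: is_cond_distr_def)
  have KM [measurable]: "K \<in> M \<rightarrow>\<^sub>M subprob_algebra borel" by (rule prob_kernel_measurable[OF KF F])
  have sp: "prob_space (K \<omega>)" "sets (K \<omega>) = sets borel" if "\<omega> \<in> space M" for \<omega>
    using measurable_space[OF measurable_from_subalg[OF F KF] that] by (auto simp: space_prob_algebra)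
  let ?D = "density M (\<lambda>\<omega>. ennreal (u \<omega>))"
  have KD: "K \<in> ?D \<rightarrow>\<^sub>M subprob_algebra borel" using KM by simp
  have ne: "space ?D \<noteq> {}" using not_empty by simp
  \<comment> \<open>On each set this is the defining property of conditional expectation, tested
    against the F-measurable \<open>u\<close>.\<close>
  have eq: "distr ?D borel W = ?D \<bind> K"
  proof (rule measure_eqI)
    show s: "sets (distr ?D borel W) = sets (?D \<bind> K)"
      using sets_bind[OF sets_kernel[OF KD] ne] by simp
    fix A assume "A \<in> sets (distr ?D borel W)"
    then have A [measurable]: "A \<in> sets borel" by simp
    interpret sigma_finite_subalgebra M F
      by (rule finite_measure_subalgebra_is_sigma_finite) (simp add: finite_measure_subalgebra_def finite_measure_subalgebra_axioms_def F finite_measure_axioms)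
    have int: "integrable M (\<lambda>\<omega>. u \<omega> * indicator A (W \<omega>))"
      using uc by (intro integrable_const_bound[of _ c]) (auto simp: indicator_def intro: order_trans[OF uc])
    have "emeasure (distr ?D borel W) A = (\<integral>\<^sup>+\<omega>. ennreal (u \<omega>) * indicator (W -` A \<inter> space M) \<omega> \<partial>M)"
      by (simp add: emeasure_distr emeasure_density)
    also have "\<dots> = (\<integral>\<^sup>+\<omega>. ennreal (u \<omega> * indicator A (W \<omega>)) \<partial>M)"
      by (intro nn_integral_cong) (auto simp: indicator_def)
    also have "\<dots> = ennreal (LINT \<omega>|M. u \<omega> * indicator A (W \<omega>))"
      using int uc by (intro nn_integral_eq_integral) auto
    also have "\<dots> = ennreal (LINT \<omega>|M. u \<omega> * real_cond_exp M F (\<lambda>\<omega>. indicator A (W \<omega>)) \<omega>)"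
      by (subst real_cond_exp_intg(2)[OF int]) (auto)
    also have "(LINT \<omega>|M. u \<omega> * real_cond_exp M F (\<lambda>\<omega>. indicator A (W \<omega>)) \<omega>) = (LINT \<omega>|M. u \<omega> * measure (K \<omega>) A)"
    proof (rule integral_cong_AE)
      show "AE \<omega> in M. u \<omega> * real_cond_exp M F (\<lambda>\<omega>. indicator A (W \<omega>)) \<omega> = u \<omega> * measure (K \<omega>) A"
      proof -
        have "AE \<omega> in M. measure (K \<omega>) A = real_cond_exp M F (\<lambda>\<omega>. indicator A (W \<omega>)) \<omega>"
          using K A by (simp add: is_cond_distr_def)
        then show ?thesis by eventually_elim simp
      qed
    qed measurable
    also have "ennreal \<dots> = (\<integral>\<^sup>+\<omega>. ennreal (u \<omega> * measure (K \<omega>) A) \<partial>M)"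
    proof (rule nn_integral_eq_integral[symmetric])
      show "integrable M (\<lambda>\<omega>. u \<omega> * measure (K \<omega>) A)"
      proof (rule integrable_const_bound[of _ c])
        show "AE \<omega> in M. norm (u \<omega> * measure (K \<omega>) A) \<le> c"
        proof (intro AE_I2)
          fix \<omega> assume "\<omega> \<in> space M"
          then interpret K: prob_space "K \<omega>" by (rule sp)
          have "u \<omega> * measure (K \<omega>) A \<le> c * 1" using uc order_trans[OF uc] by (intro mult_mono) auto
          then show "norm (u \<omega> * measure (K \<omega>) A) \<le> c" using uc by simp
        qed
      qed measurable
    qed (use uc in auto)
    also have "\<dots> = (\<integral>\<^sup>+\<omega>. ennreal (u \<omega>) * emeasure (K \<omega>) A \<partial>M)"
    proof (intro nn_integral_cong)
      fix \<omega> assume "\<omega> \<in> space M"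
      then interpret K: prob_space "K \<omega>" by (rule sp)
      show "ennreal (u \<omega> * measure (K \<omega>) A) = ennreal (u \<omega>) * emeasure (K \<omega>) A"
        using uc by (simp add: ennreal_mult K.emeasure_eq_measure)
    qed
    also have "\<dots> = emeasure (?D \<bind> K) A"
      by (subst emeasure_bind[OF ne KD A]) (simp add: nn_integral_density)
    finally show "emeasure (distr ?D borel W) A = emeasure (?D \<bind> K) A" .
  qed
  have bound: "0 \<le> u \<omega> * y \<and> u \<omega> * y \<le> c * c'" if "0 \<le> y" "y \<le> c'" for \<omega> y
    using that uc by (auto intro!: mult_mono order_trans[OF uc])
  have Kh: "0 \<le> (LINT w|K \<omega>. h w)" "(LINT w|K \<omega>. h w) \<le> c'" "integrable (K \<omega>) h" if "\<omega> \<in> space M" for \<omega>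
  proof -
    interpret K: prob_space "K \<omega>" by (rule sp[OF that])
    have [measurable]: "h \<in> borel_measurable (K \<omega>)"
      using h by (simp cong: measurable_cong_sets add: sp(2)[OF that])
    show int: "integrable (K \<omega>) h" using hc by (intro K.integrable_const_bound[of _ c']) auto
    show "0 \<le> (LINT w|K \<omega>. h w)" using hc by simp
    show "(LINT w|K \<omega>. h w) \<le> c'" using hc by (intro K.integral_le_const int) auto
  qed
  have [measurable]: "(\<lambda>\<omega>. LINT w|K \<omega>. h w) \<in> borel_measurable M"
    by (rule measurable_compose[OF KM integral_measurable_subprob_algebra]) simp
  have "ennreal (LINT \<omega>|M. u \<omega> * h (W \<omega>)) = (\<integral>\<^sup>+\<omega>. ennreal (u \<omega> * h (W \<omega>)) \<partial>M)"
    using bound hc by (intro nn_integral_eq_integral[symmetric] integrable_const_bound[of _ "c * c'"]) auto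
  also have "\<dots> = (\<integral>\<^sup>+w. ennreal (h w) \<partial>distr ?D borel W)"
    using uc hc by (simp add: nn_integral_distr nn_integral_density ennreal_mult)
  also have "\<dots> = (\<integral>\<^sup>+\<omega>. ennreal (u \<omega>) * (\<integral>\<^sup>+w. ennreal (h w) \<partial>K \<omega>) \<partial>M)"
    unfolding eq by (subst nn_integral_bind[OF _ KD]) (auto simp: nn_integral_density)
  also have "\<dots> = (\<integral>\<^sup>+\<omega>. ennreal (u \<omega> * (LINT w|K \<omega>. h w)) \<partial>M)"
    using Kh hc uc by (intro nn_integral_cong) (simp add: nn_integral_eq_integral ennreal_mult)
  also have "\<dots> = ennreal (LINT \<omega>|M. u \<omega> * (LINT w|K \<omega>. h w))"
    using bound Kh by (intro nn_integral_eq_integral integrable_const_bound[of _ "c * c'"]) auto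
  finally show ?thesis
    using bound Kh hc by (subst (asm) ennreal_inj) (auto intro!: integral_nonneg_AE)
qed

text \<open>Shift both factors to be nonnegative and apply the previous lemma to u + c and to the
  constant c; in the difference only the product of \<open>u\<close> and \<open>h\<close> remains,
  up to terms common to both sides.\<close>

lemma cond_distr_integral:
  fixes u :: "'a \<Rightarrow> real" and h :: "real \<times> real \<Rightarrow> real"
  assumes K: "is_cond_distr M F W K" and F: "subalgebra M F" and W [measurable]: "W \<in> borel_measurable M"
    and u [measurable]: "u \<in> borel_measurable F" and uc: "\<And>\<omega>. \<bar>u \<omega>\<bar> \<le> c"
    and h [measurable]: "h \<in> borel_measurable borel" and hc: "\<And>w. \<bar>h w\<bar> \<le> c'"
  shows "(LINT \<omega>|M. u \<omega> * h (W \<omega>)) = (LINT \<omega>|M. u \<omega> * (LINT w|K \<omega>. h w))"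
    and "integrable M (\<lambda>\<omega>. u \<omega> * (LINT w|K \<omega>. h w))"
proof -
  have [measurable]: "u \<in> borel_measurable M" by (rule measurable_from_subalg[OF F u])
  have KF: "K \<in> F \<rightarrow>\<^sub>M prob_algebra borel" using K by (simp add: is_cond_distr_def)
  have KM [measurable]: "K \<in> M \<rightarrow>\<^sub>M subprob_algebra borel" by (rule prob_kernel_measurable[OF KF F])
  have sp: "prob_space (K \<omega>)" "sets (K \<omega>) = sets borel" if "\<omega> \<in> space M" for \<omega>
    using measurable_space[OF measurable_from_subalg[OF F KF] that] by (auto simp: space_prob_algebra)
  have [measurable]: "(\<lambda>\<omega>. LINT w|K \<omega>. h w) \<in> borel_measurable M"
    by (rule measurable_compose[OF KM integral_measurable_subprob_algebra]) simp
  have Kh: "\<bar>LINT w|K \<omega>. h w\<bar> \<le> c'" "(LINT w|K \<omega>. h w + c') = (LINT w|K \<omega>. h w) + c'" if "\<omega> \<in> space M" for \<omega>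
  proof -
    interpret K: prob_space "K \<omega>" by (rule sp[OF that])
    have [measurable]: "h \<in> borel_measurable (K \<omega>)"
      using h by (simp cong: measurable_cong_sets add: sp(2)[OF that])
    have int: "integrable (K \<omega>) h" using hc by (intro K.integrable_const_bound[of _ c']) auto
    show "\<bar>LINT w|K \<omega>. h w\<bar> \<le> c'"
      using K.integral_le_const[OF int, of c'] K.integral_ge_const[OF int, of "- c'"] hc by (auto simp: abs_le_iff minus_le_iff)
    show "(LINT w|K \<omega>. h w + c') = (LINT w|K \<omega>. h w) + c'" using int by (simp add: K.prob_space)
  qed
  have c0: "0 \<le> c" "0 \<le> c'" using uc abs_ge_zero order_trans hc by blast+
  have prod: "\<bar>u \<omega> * y\<bar> \<le> c * c'" if "\<bar>y\<bar> \<le> c'" for \<omega> y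
    using mult_mono[OF uc that c0(1) abs_ge_zero] by (simp add: abs_mult)
  have int_u: "integrable M u" using uc by (intro integrable_const_bound[of _ c]) auto
  have int_h: "integrable M (\<lambda>\<omega>. h (W \<omega>))" using hc by (intro integrable_const_bound[of _ c']) auto
  have int_uh: "integrable M (\<lambda>\<omega>. u \<omega> * h (W \<omega>))"
    by (intro integrable_const_bound[of _ "c * c'"] AE_I2) (simp add: prod hc, measurable)
  have int_K: "integrable M (\<lambda>\<omega>. LINT w|K \<omega>. h w)"
    using Kh by (intro integrable_const_bound[of _ c']) auto
  show int_uK: "integrable M (\<lambda>\<omega>. u \<omega> * (LINT w|K \<omega>. h w))"
    by (intro integrable_const_bound[of _ "c * c'"] AE_I2) (simp add: prod Kh, measurable)
  have shift: "0 \<le> h w + c'" "h w + c' \<le> 2 * c'" for w using hc[of w] by linarith+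
  have shift': "0 \<le> u \<omega> + c" "u \<omega> + c \<le> 2 * c" for \<omega> using uc[of \<omega>] by linarith+
  have *: "(LINT \<omega>|M. v \<omega> * (h (W \<omega>) + c')) = (LINT \<omega>|M. v \<omega> * ((LINT w|K \<omega>. h w) + c'))"
    if "v \<in> borel_measurable F" "\<And>\<omega>. 0 \<le> v \<omega>" "\<And>\<omega>. v \<omega> \<le> 2 * c" for v
  proof -
    have "(LINT \<omega>|M. v \<omega> * (h (W \<omega>) + c')) = (LINT \<omega>|M. v \<omega> * (LINT w|K \<omega>. h w + c'))"
      by (intro cond_distr_integral_nonneg[OF K F W that, where c' = "2 * c'"] shift) measurable
    also have "\<dots> = (LINT \<omega>|M. v \<omega> * ((LINT w|K \<omega>. h w) + c'))"
      by (intro Bochner_Integration.integral_cong) (auto simp: Kh)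
    finally show ?thesis .
  qed
  have "(LINT \<omega>|M. (u \<omega> + c) * (h (W \<omega>) + c')) = (LINT \<omega>|M. (u \<omega> + c) * ((LINT w|K \<omega>. h w) + c'))"
    by (intro * shift') measurable
  moreover have "(LINT \<omega>|M. c * (h (W \<omega>) + c')) = (LINT \<omega>|M. c * ((LINT w|K \<omega>. h w) + c'))"
    using c0 by (intro *) auto
  ultimately show "(LINT \<omega>|M. u \<omega> * h (W \<omega>)) = (LINT \<omega>|M. u \<omega> * (LINT w|K \<omega>. h w))"
    using int_u int_h int_uh int_K int_uK by (auto simp: distrib_left distrib_right)
qed

end

subsection \<open>The volatility model\<close>

lemma fst_borel_measurable [measurable]: "fst \<in> borel_measurable (borel :: ('b :: topological_space \<times> 'c :: topological_space) measure)"
  by (intro borel_measurable_continuous_onI continuous_intros)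

lemma snd_borel_measurable [measurable]: "snd \<in> borel_measurable (borel :: ('b :: topological_space \<times> 'c :: topological_space) measure)"
  by (intro borel_measurable_continuous_onI continuous_intros)

lemma (in prob_space) density_function_props:
  assumes "distributed M lborel X (\<lambda>x. ennreal (f x))" "\<And>x. 0 \<le> f x"
  shows "integrable lborel f" "(LINT x|lborel. f x) = 1"
  using distributed_integrable[OF assms(1), of "\<lambda>_. 1"] distributed_integral[OF assms(1), of "\<lambda>_. 1"] assms(2)
  by (simp_all add: prob_space)

context volatility_model
begin

abbreviation Z :: "nat \<Rightarrow> 'a \<Rightarrow> real" where "Z \<equiv> log_sq Y"
abbreviation X :: "nat \<Rightarrow> 'a \<Rightarrow> real" where "X \<equiv> log_sq \<sigma>"

lemma Y_\<sigma>_measurable [measurable]: "Y t \<in> borel_measurable M" "\<sigma> t \<in> borel_measurable M"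
proof -
  have "(\<lambda>\<omega>. (Y t \<omega>, \<sigma> t \<omega>)) \<in> borel_measurable M"
    using stationary by (simp add: strictly_stationary_def)
  from measurable_compose[OF this fst_borel_measurable] measurable_compose[OF this snd_borel_measurable]
  show "Y t \<in> borel_measurable M" "\<sigma> t \<in> borel_measurable M" by simp_all
qed

lemma \<eta>_measurable [measurable]: "\<eta> i \<in> borel_measurable M"
  using \<eta>_indep by (simp add: indep_vars_def)

lemma log_sq_measurable [measurable]:
  "log_sq Y t \<in> borel_measurable M" "log_sq \<sigma> t \<in> borel_measurable M" "log_sq \<eta> i \<in> borel_measurable M"
  unfolding log_sq_def[abs_def] by measurable

lemma W_proc_measurable [measurable]: "W_proc Y \<sigma> t \<in> borel_measurable M"
  unfolding W_proc_def[abs_def] by measurable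

lemma AE_log_sq_nonzero:
  assumes "distributed M lborel (log_sq U t) (\<lambda>x. ennreal (f x))"
  shows "AE \<omega> in M. U t \<omega> \<noteq> 0"
proof -
  have "AE \<omega> in M. log_sq U t \<omega> \<noteq> 0"
    using AE_lborel_singleton[of "0 :: real"] by (subst distributed_AE2[OF assms]) auto
  then show ?thesis by eventually_elim (auto simp: log_sq_def)
qed

lemma AE_log_sq_Y: "AE \<omega> in M. Z t \<omega> = X t \<omega> + log_sq \<eta> (int t) \<omega>"
  using AE_log_sq_nonzero[OF X_density[of t]] AE_log_sq_nonzero[OF \<epsilon>_density[of "int t"]] AE_space
proof eventually_elim
  case (elim \<omega>)
  then show ?case using Y_eq[of \<omega> t] by (simp add: log_sq_def power_mult_distrib ln_mult)
qed

lemma stationary_Z: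
  assumes [measurable]: "u \<in> borel_measurable borel" "v \<in> borel_measurable borel"
  shows "(LINT \<omega>|M. u (Z i \<omega>) * v (Z (i + k) \<omega>)) = (LINT \<omega>|M. u (Z 0 \<omega>) * v (Z k \<omega>) :: real)"
proof -
  let ?P = "Pi\<^sub>M UNIV (\<lambda>_ :: nat. borel :: (real \<times> real) measure)"
  let ?\<Phi> = "\<lambda>p :: nat \<Rightarrow> real \<times> real. u (ln ((fst (p 0))\<^sup>2)) * v (ln ((fst (p k))\<^sup>2))"
  let ?V = "\<lambda>h \<omega> t. (Y (t + h) \<omega>, \<sigma> (t + h) \<omega>)"
  have V: "?V h \<in> M \<rightarrow>\<^sub>M ?P" for h by (rule measurable_abs_UNIV) simp
  have [measurable]: "?\<Phi> \<in> borel_measurable ?P" by measurable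
  have "(LINT \<omega>|M. ?\<Phi> (?V h \<omega>)) = (LINT p|distr M ?P (?V h). ?\<Phi> p)" for h
    by (rule integral_distr[symmetric, OF V]) measurable
  moreover have "distr M ?P (?V i) = distr M ?P (?V 0)"
    using stationary by (simp add: strictly_stationary_def)
  ultimately have "(LINT \<omega>|M. ?\<Phi> (?V i \<omega>)) = (LINT \<omega>|M. ?\<Phi> (?V 0 \<omega>))" by (simp only:)
  then show ?thesis by (simp add: log_sq_def add.commute)
qed

text \<open>The past block at time t holds \<open>\<sigma>\<close> up to t but \<open>\<eta>\<close>
  only up to t - 1. For \<open>t \<ge> 1\<close> it determines Z 0 and X t, while the noise at time
  t belongs to the future block.\<close>

lemma distr_past_future:
  assumes t: "t \<ge> 1"
  shows "distr M borel (\<lambda>\<omega>. (Z 0 \<omega>, X t \<omega>)) \<Otimes>\<^sub>M distr M borel (log_sq \<eta> (int t))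
    = distr M (borel \<Otimes>\<^sub>M borel) (\<lambda>\<omega>. ((Z 0 \<omega>, X t \<omega>), log_sq \<eta> (int t) \<omega>))"
proof (rule pair_measure_eqI)
  let ?W = "\<lambda>\<omega>. (Z 0 \<omega>, X t \<omega>)" and ?e = "log_sq \<eta> (int t)"
  let ?p = "\<lambda>\<omega>. \<lambda>i\<in>{0..t}. (\<sigma> i \<omega>, \<eta> (int i - 1) \<omega>)" and ?P = "Pi\<^sub>M {0..t} (\<lambda>_. borel :: (real \<times> real) measure)"
  let ?f = "\<lambda>\<omega>. \<lambda>i\<in>{int t..}. \<eta> i \<omega>" and ?F = "Pi\<^sub>M {int t..} (\<lambda>_. borel :: real measure)"
  show "sigma_finite_measure (distr M borel ?W)" "sigma_finite_measure (distr M borel ?e)"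
    by (intro prob_space_imp_sigma_finite prob_space_distr; measurable)+
  show "sets (distr M borel ?W \<Otimes>\<^sub>M distr M borel ?e) = sets (distr M (borel \<Otimes>\<^sub>M borel) (\<lambda>\<omega>. (?W \<omega>, ?e \<omega>)))"
    by (simp cong: sets_pair_measure_cong)
  fix A B assume "A \<in> sets (distr M borel ?W)" "B \<in> sets (distr M borel ?e)"
  then have [measurable]: "A \<in> sets borel" "B \<in> sets borel" by simp_all
  have "?W -` A \<inter> space M \<in> sets (vimage_algebra (space M) ?p ?P)"
  proof -
    \<comment> \<open>\<open>\<eta> 0\<close> sits in the component with index 1, as the second
      entries of the block lag by one; the first square is thus that of Y 0.\<close>
    let ?h = "\<lambda>q. (ln ((fst (q 0) * snd (q (Suc 0)))\<^sup>2), ln ((fst (q t))\<^sup>2)) :: real \<times> real"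
    have "(\<lambda>q. q i) \<in> ?P \<rightarrow>\<^sub>M borel" if "i \<le> t" for i
      using that by (intro measurable_component_singleton) auto
    from this[of 0] this[of t] this[of "Suc 0"] t
    have [measurable]: "(\<lambda>q. q 0) \<in> ?P \<rightarrow>\<^sub>M borel" "(\<lambda>q. q t) \<in> ?P \<rightarrow>\<^sub>M borel" "(\<lambda>q. q (Suc 0)) \<in> ?P \<rightarrow>\<^sub>M borel"
      by simp_all
    have h: "?h \<in> ?P \<rightarrow>\<^sub>M borel" by measurable
    have p: "?p \<in> vimage_algebra (space M) ?p ?P \<rightarrow>\<^sub>M ?P"
      by (rule measurable_vimage_algebra1) (auto simp: space_PiM)
    have "?W -` A \<inter> space M = (\<lambda>\<omega>. ?h (?p \<omega>)) -` A \<inter> space M"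
      using t Y_eq[of _ 0] by (auto simp: log_sq_def)
    then show ?thesis
      using measurable_sets[OF measurable_compose[OF p h], of A] by simp
  qed
  moreover have "?e -` B \<inter> space M \<in> sets (vimage_algebra (space M) ?f ?F)"
  proof -
    let ?h = "\<lambda>q. ln ((q (int t))\<^sup>2) :: real"
    have [measurable]: "(\<lambda>q. q (int t)) \<in> ?F \<rightarrow>\<^sub>M borel"
      by (intro measurable_component_singleton) auto
    have h: "?h \<in> ?F \<rightarrow>\<^sub>M borel" by measurable
    have f: "?f \<in> vimage_algebra (space M) ?f ?F \<rightarrow>\<^sub>M ?F"
      by (rule measurable_vimage_algebra1) (auto simp: space_PiM)
    have "?e -` B \<inter> space M = (\<lambda>\<omega>. ?h (?f \<omega>)) -` B \<inter> space M"
      by (auto simp: log_sq_def)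
    then show ?thesis
      using measurable_sets[OF measurable_compose[OF f h], of B] by simp
  qed
  ultimately have "prob ((?W -` A \<inter> space M) \<inter> (?e -` B \<inter> space M)) = prob (?W -` A \<inter> space M) * prob (?e -` B \<inter> space M)"
    by (rule indep_setD[OF indep_future])
  moreover have "(\<lambda>\<omega>. (?W \<omega>, ?e \<omega>)) -` (A \<times> B) \<inter> space M = (?W -` A \<inter> space M) \<inter> (?e -` B \<inter> space M)" by auto
  ultimately show "emeasure (distr M borel ?W) A * emeasure (distr M borel ?e) B
    = emeasure (distr M (borel \<Otimes>\<^sub>M borel) (\<lambda>\<omega>. (?W \<omega>, ?e \<omega>))) (A \<times> B)"
    by (simp add: emeasure_distr emeasure_eq_measure ennreal_mult)
qed

lemma W_proc_subalgebra: "subalgebra M (vimage_algebra (space M) (W_proc Y \<sigma> 0) borel)"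
  unfolding subalgebra_def by (intro conjI sets_image_in_sets) simp_all

lemma integrable_f\<epsilon>: "integrable lborel f\<epsilon>" and integral_f\<epsilon>: "(LINT x|lborel. f\<epsilon> x) = 1"
  using density_function_props[OF \<epsilon>_density f\<epsilon>_nonneg] by auto

lemma integrable_g: "integrable lborel g" and integral_g: "(LINT x|lborel. g x) = 1"
  using density_function_props[OF X_density g_nonneg] by auto

context
  fixes m :: nat and D :: real
  assumes m: "m \<ge> 1" and bb: "bounded_borel (recip_band (fourier_real f\<epsilon>) m)"
    and D: "(LINT x|band m. (norm (recip_band (fourier_real f\<epsilon>) m x))\<^sup>2) / (2 * pi) \<le> D" and D0: "0 < D"
    and nz: "\<And>x. fourier_real f\<epsilon> x \<noteq> 0"
begin

abbreviation U :: "int \<Rightarrow> real \<Rightarrow> real" where "U \<equiv> U_coeff f\<epsilon> m"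
abbreviation coeff :: "int \<Rightarrow> real" where "coeff j \<equiv> (LINT x|lborel. g x * phi m j x)"

lemmas U_facts = U_coeff_measurable[OF m bb D] sum_U_coeff_sq_le[OF m bb D] abs_U_coeff_le[OF m bb D]
  abs_sum_U_coeff_mult_le[OF m bb D]

lemma expectation_phi_X: "(LINT \<omega>|M. phi m j (X t \<omega>)) = coeff j"
  by (rule distributed_integral[OF X_density, symmetric]) (auto simp: g_nonneg)

text \<open>Fubini on the product law of (Z 0, X t) and the noise at t: the inner integral over the
  noise is the deconvolution identity.\<close>

lemma expectation_mult_U_Z:
  assumes u [measurable]: "u \<in> borel_measurable borel" and uc: "\<And>z. \<bar>u z\<bar> \<le> c" and t: "t \<ge> 1"
  shows "(LINT \<omega>|M. u (Z 0 \<omega>) * U j (Z t \<omega>)) = (LINT \<omega>|M. u (Z 0 \<omega>) * phi m j (X t \<omega>))"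
proof -
  note [measurable] = U_facts(1)
  let ?W = "\<lambda>\<omega>. (Z 0 \<omega>, X t \<omega>)" and ?e = "log_sq \<eta> (int t)"
  let ?P = "distr M borel ?W" and ?Q = "distr M borel ?e"
  interpret P: prob_space ?P by (rule prob_space_distr) measurable
  interpret Q: prob_space ?Q by (rule prob_space_distr) measurable
  interpret PQ: pair_prob_space ?P ?Q ..
  have Q: "?Q = density lborel f\<epsilon>"
    using distributed_distr_eq_density[OF \<epsilon>_density, of "int t"] by (simp cong: distr_cong)
  have prod: "?P \<Otimes>\<^sub>M ?Q = distr M (borel \<Otimes>\<^sub>M borel) (\<lambda>\<omega>. (?W \<omega>, ?e \<omega>))"
    by (rule distr_past_future[OF t])
  let ?H = "\<lambda>(w, e). u (fst w) * U j (snd w + e)"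
  have [measurable]: "?H \<in> borel_measurable (borel \<Otimes>\<^sub>M borel)" by measurable
  have H: "norm (?H p) \<le> c * sqrt D" for p
    using mult_mono[OF uc U_facts(3) order_trans[OF abs_ge_zero uc] abs_ge_zero]
    by (cases p) (simp add: abs_mult)
  have int: "integrable (?P \<Otimes>\<^sub>M ?Q) ?H"
    by (rule PQ.P.integrable_const_bound[OF AE_I2[OF H]]) (simp add: prod)
  have "(LINT \<omega>|M. u (Z 0 \<omega>) * U j (Z t \<omega>)) = (LINT \<omega>|M. ?H (?W \<omega>, ?e \<omega>))"
    by (rule integral_cong_AE) (use AE_log_sq_Y[of t] in auto)
  also have "\<dots> = (LINT p|(?P \<Otimes>\<^sub>M ?Q). ?H p)"
    unfolding prod by (rule integral_distr[symmetric]) measurable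
  also have "\<dots> = (LINT w|?P. LINT e|?Q. u (fst w) * U j (snd w + e))"
    using PQ.integral_fst'[OF int] by simp
  also have "\<dots> = (LINT w|?P. u (fst w) * phi m j (snd w))"
    unfolding Q using U_coeff_deconvolution[OF m bb D f\<epsilon>_nonneg integrable_f\<epsilon> integral_f\<epsilon> nz] by simp
  also have "\<dots> = (LINT \<omega>|M. u (Z 0 \<omega>) * phi m j (X t \<omega>))"
    by (subst integral_distr) auto
  finally show ?thesis .
qed

lemma expectation_U_Z: "(LINT \<omega>|M. U j (Z i \<omega>)) = coeff j"
proof -
  note [measurable] = U_facts(1)
  \<comment> \<open>The noise can be integrated out only at times from 1 on; stationarity brings
    every time, including 0, to time 1.\<close>
  have "(LINT \<omega>|M. U j (Z i \<omega>)) = (LINT \<omega>|M. U j (Z 1 \<omega>))"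
    using stationary_Z[of "\<lambda>_. 1" "U j" i 0] stationary_Z[of "\<lambda>_. 1" "U j" 1 0] by simp
  also have "\<dots> = coeff j"
    using expectation_mult_U_Z[of "\<lambda>_. 1" 1 1 j] expectation_phi_X by simp
  finally show ?thesis .
qed

lemma integrable_U_Z:
  "integrable M (\<lambda>\<omega>. U j (Z i \<omega>))" "integrable M (\<lambda>\<omega>. U j (Z i \<omega>) * U j' (Z l \<omega>))"
  "integrable M (\<lambda>\<omega>. U j (Z i \<omega>) * phi m j' (X l \<omega>))"
proof -
  note [measurable] = U_facts(1)
  have b: "\<bar>U j z * y\<bar> \<le> sqrt D * c" if "\<bar>y\<bar> \<le> c" for j z y c
    using mult_mono[OF U_facts(3) that _ abs_ge_zero, of j z] D0 by (simp add: abs_mult)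
  show "integrable M (\<lambda>\<omega>. U j (Z i \<omega>))"
    by (rule integrable_const_bound[of _ "sqrt D"]) (auto simp: U_facts(3))
  show "integrable M (\<lambda>\<omega>. U j (Z i \<omega>) * U j' (Z l \<omega>))"
    by (rule integrable_const_bound[of _ "sqrt D * sqrt D"]) (auto intro!: b U_facts(3) simp del: real_sqrt_mult_self)
  show "integrable M (\<lambda>\<omega>. U j (Z i \<omega>) * phi m j' (X l \<omega>))"
    by (rule integrable_const_bound[of _ "sqrt D * sqrt m"]) (auto intro!: b abs_phi_le[OF m])
qed

text \<open>Given \<open>Z 0\<close> and \<open>X k\<close>, the mean of \<open>U j (Z k)\<close> is \<open>phi m j (X k)\<close>: this is the sum over \<open>J\<close> of
  the covariances of the empirical coefficients at lag \<open>k\<close>.\<close>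

definition lag_cov :: "int set \<Rightarrow> nat \<Rightarrow> real" where
  "lag_cov J k = (LINT \<omega>|M. (\<Sum>j\<in>J. U j (Z 0 \<omega>) * (phi m j (X k \<omega>) - coeff j)))"

text \<open>Stationarity moves the earlier time to 0, and the noise at the later time is integrated
  out. Centring the later factor alone is then enough.\<close>

lemma lag_cov_eq:
  assumes k: "k \<ge> 1"
  shows "(LINT \<omega>|M. (\<Sum>j\<in>J. (U j (Z i \<omega>) - coeff j) * (U j (Z (i + k) \<omega>) - coeff j))) = lag_cov J k"
proof -
  note [measurable] = U_facts(1)
  have "(LINT \<omega>|M. (\<Sum>j\<in>J. (U j (Z i \<omega>) - coeff j) * (U j (Z (i + k) \<omega>) - coeff j)))
    = (\<Sum>j\<in>J. LINT \<omega>|M. (U j (Z i \<omega>) - coeff j) * (U j (Z (i + k) \<omega>) - coeff j))"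
    by (rule Bochner_Integration.integral_sum) (simp add: integrable_U_Z left_diff_distrib right_diff_distrib)
  also have "\<dots> = (\<Sum>j\<in>J. LINT \<omega>|M. U j (Z 0 \<omega>) * (phi m j (X k \<omega>) - coeff j))"
  proof (rule sum.cong)
    fix j
    have "(LINT \<omega>|M. (U j (Z i \<omega>) - coeff j) * (U j (Z (i + k) \<omega>) - coeff j))
      = (LINT \<omega>|M. U j (Z i \<omega>) * U j (Z (i + k) \<omega>)) - coeff j * coeff j"
      using integrable_U_Z by (simp add: left_diff_distrib right_diff_distrib expectation_U_Z prob_space)
    also have "(LINT \<omega>|M. U j (Z i \<omega>) * U j (Z (i + k) \<omega>)) = (LINT \<omega>|M. U j (Z 0 \<omega>) * phi m j (X k \<omega>))"
      using expectation_mult_U_Z[OF U_facts(1,3) k] by (simp add: stationary_Z)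
    also have "\<dots> - coeff j * coeff j = (LINT \<omega>|M. U j (Z 0 \<omega>) * (phi m j (X k \<omega>) - coeff j))"
      using integrable_U_Z by (simp add: right_diff_distrib expectation_U_Z)
    finally show "(LINT \<omega>|M. (U j (Z i \<omega>) - coeff j) * (U j (Z (i + k) \<omega>) - coeff j))
      = (LINT \<omega>|M. U j (Z 0 \<omega>) * (phi m j (X k \<omega>) - coeff j))" .
  qed simp
  also have "\<dots> = lag_cov J k"
    unfolding lag_cov_def
    by (rule Bochner_Integration.integral_sum[symmetric]) (simp add: integrable_U_Z right_diff_distrib)
  finally show ?thesis .
qed

text \<open>Given W at time 0 the kernel is a fixed function of W at time k, so the covariance is
  the mean difference of its integrals under the conditional and the marginal law. The division by
  \<open>c\<close> is there to make the kernel an admissible test function for the coefficient at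
  hand.\<close>

lemma lag_cov_cond_distr:
  assumes J: "finite J" and K: "is_cond_distr M (vimage_algebra (space M) (W_proc Y \<sigma> 0) borel) (W_proc Y \<sigma> k) K"
    and c: "0 < c"
  defines "h \<equiv> \<lambda>\<omega> w. \<Sum>j\<in>J. U j (Z 0 \<omega>) * phi m j (snd w)"
  shows "ennreal (\<bar>lag_cov J k\<bar> / c) \<le> (\<integral>\<^sup>+\<omega>. ennreal (\<bar>(LINT w|K \<omega>. h \<omega> w) - (LINT w|distr M borel (W_proc Y \<sigma> k). h \<omega> w)\<bar> / c) \<partial>M)"
proof -
  note [measurable] = U_facts(1)
  let ?F = "vimage_algebra (space M) (W_proc Y \<sigma> 0) borel" and ?P = "distr M borel (W_proc Y \<sigma> k)"
  have sp: "prob_space (K \<omega>)" "sets (K \<omega>) = sets borel" if "\<omega> \<in> space M" for \<omega>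
    using K measurable_space[of K ?F "prob_algebra borel" \<omega>] that by (auto simp: space_prob_algebra is_cond_distr_def)
  have int: "integrable (K \<omega>) (\<lambda>w. phi m j (snd w))" if "\<omega> \<in> space M" for \<omega> j
  proof -
    interpret K: prob_space "K \<omega>" by (rule sp[OF that])
    have "(\<lambda>w. phi m j (snd w)) \<in> borel_measurable borel" by measurable
    then have "(\<lambda>w. phi m j (snd w)) \<in> borel_measurable (K \<omega>)"
      by (simp cong: measurable_cong_sets add: sp(2)[OF that])
    then show ?thesis by (intro K.integrable_const_bound[of _ "sqrt m"]) (simp_all add: abs_phi_le[OF m])
  qed
  have P: "(LINT w|?P. h \<omega> w) = (\<Sum>j\<in>J. U j (Z 0 \<omega>) * coeff j)" for \<omega>
  proof -
    have "(LINT w|?P. h \<omega> w) = (LINT \<omega>'|M. (\<Sum>j\<in>J. U j (Z 0 \<omega>) * phi m j (X k \<omega>')))"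
      unfolding h_def by (subst integral_distr) (simp_all add: W_proc_def)
    also have "\<dots> = (\<Sum>j\<in>J. LINT \<omega>'|M. U j (Z 0 \<omega>) * phi m j (X k \<omega>'))"
      by (intro Bochner_Integration.integral_sum integrable_mult_right integrable_const_bound[of _ "sqrt m"])
        (simp_all add: abs_phi_le[OF m])
    finally show ?thesis by (simp add: expectation_phi_X)
  qed
  have eq: "(LINT w|K \<omega>. h \<omega> w) - (LINT w|?P. h \<omega> w)
      = (\<Sum>j\<in>J. U j (Z 0 \<omega>) * (LINT w|K \<omega>. phi m j (snd w)) - U j (Z 0 \<omega>) * coeff j)" if "\<omega> \<in> space M" for \<omega>
  proof -
    have "(LINT w|K \<omega>. h \<omega> w) = (\<Sum>j\<in>J. U j (Z 0 \<omega>) * (LINT w|K \<omega>. phi m j (snd w)))"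
      unfolding h_def by (subst Bochner_Integration.integral_sum) (use int[OF that] in auto)
    then show ?thesis by (simp add: P sum_subtractf)
  qed
  \<comment> \<open>Z 0 is the first coordinate of W at time 0, hence measurable for the
    conditioning field.\<close>
  have UF: "(\<lambda>\<omega>. U j (Z 0 \<omega>)) \<in> borel_measurable ?F" for j
  proof -
    have "(\<lambda>\<omega>. U j (fst (W_proc Y \<sigma> 0 \<omega>))) \<in> borel_measurable ?F"
      by (rule measurable_compose[OF measurable_vimage_algebra1]) auto
    then show ?thesis by (simp add: W_proc_def)
  qed
  note ce = cond_distr_integral[OF K W_proc_subalgebra W_proc_measurable UF U_facts(3), of "\<lambda>w. phi m _ (snd w)" "sqrt m"]
  have ce: "(LINT \<omega>|M. U j (Z 0 \<omega>) * phi m j (X k \<omega>)) = (LINT \<omega>|M. U j (Z 0 \<omega>) * (LINT w|K \<omega>. phi m j (snd w)))"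
    "integrable M (\<lambda>\<omega>. U j (Z 0 \<omega>) * (LINT w|K \<omega>. phi m j (snd w)))" for j
    using ce[of j j] abs_phi_le[OF m] by (simp_all add: W_proc_def)
  have "lag_cov J k = (\<Sum>j\<in>J. LINT \<omega>|M. U j (Z 0 \<omega>) * phi m j (X k \<omega>) - U j (Z 0 \<omega>) * coeff j)"
    unfolding lag_cov_def
    by (subst Bochner_Integration.integral_sum) (simp_all add: integrable_U_Z right_diff_distrib)
  also have "\<dots> = (\<Sum>j\<in>J. LINT \<omega>|M. U j (Z 0 \<omega>) * (LINT w|K \<omega>. phi m j (snd w)) - U j (Z 0 \<omega>) * coeff j)"
    by (intro sum.cong) (simp_all add: integrable_U_Z ce)
  also have "\<dots> = (LINT \<omega>|M. (\<Sum>j\<in>J. U j (Z 0 \<omega>) * (LINT w|K \<omega>. phi m j (snd w)) - U j (Z 0 \<omega>) * coeff j))"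
    by (rule Bochner_Integration.integral_sum[symmetric]) (simp add: integrable_U_Z ce(2))
  finally have cov: "lag_cov J k = (LINT \<omega>|M. (LINT w|K \<omega>. h \<omega> w) - (LINT w|?P. h \<omega> w))"
    by (simp add: eq cong: Bochner_Integration.integral_cong)
  have "integrable M (\<lambda>\<omega>. (LINT w|K \<omega>. h \<omega> w) - (LINT w|?P. h \<omega> w))"
    by (subst Bochner_Integration.integrable_cong[OF refl eq]) (simp_all add: integrable_U_Z ce(2))
  then have "ennreal \<bar>(LINT \<omega>|M. ((LINT w|K \<omega>. h \<omega> w) - (LINT w|?P. h \<omega> w)) / c)\<bar>
      \<le> (\<integral>\<^sup>+\<omega>. ennreal \<bar>((LINT w|K \<omega>. h \<omega> w) - (LINT w|?P. h \<omega> w)) / c\<bar> \<partial>M)"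
    using integral_norm_bound_ennreal[of M "\<lambda>\<omega>. ((LINT w|K \<omega>. h \<omega> w) - (LINT w|?P. h \<omega> w)) / c"] by simp
  then show ?thesis using c by (simp add: cov)
qed

text \<open>For each fixed outcome the kernel is bounded by sqrt (m D), uniformly in J, so total
  variation controls the difference of its integrals. The coefficient is an infimum over versions,
  hence the argument for an arbitrary one.\<close>

lemma lag_cov_le_beta1:
  assumes J: "finite J"
  shows "ennreal (\<bar>lag_cov J k\<bar> / (2 * sqrt (m * D))) \<le> beta1 M Y \<sigma> k"
  unfolding beta1_def beta_coeff_def
proof (rule INF_greatest)
  note [measurable] = U_facts(1)
  let ?F = "vimage_algebra (space M) (W_proc Y \<sigma> 0) borel" and ?P = "distr M borel (W_proc Y \<sigma> k)"
  let ?h = "\<lambda>\<omega> w. \<Sum>j\<in>J. U j (Z 0 \<omega>) * phi m j (snd w)"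
  have c: "0 < sqrt (m * D)" using m D0 by simp
  fix K assume "K \<in> {K. is_cond_distr M ?F (W_proc Y \<sigma> k) K}"
  then have K: "is_cond_distr M ?F (W_proc Y \<sigma> k) K" by simp
  have 1: "ennreal (\<bar>lag_cov J k\<bar> / (2 * sqrt (m * D)))
    \<le> (\<integral>\<^sup>+\<omega>. ennreal (\<bar>(LINT w|K \<omega>. ?h \<omega> w) - (LINT w|?P. ?h \<omega> w)\<bar> / (2 * sqrt (m * D))) \<partial>M)"
    by (rule lag_cov_cond_distr[OF J K]) (use c in simp)
  have 2: "(\<integral>\<^sup>+\<omega>. ennreal (\<bar>(LINT w|K \<omega>. ?h \<omega> w) - (LINT w|?P. ?h \<omega> w)\<bar> / (2 * sqrt (m * D))) \<partial>M)
    \<le> (\<integral>\<^sup>+\<omega>. (\<Squnion>A\<in>sets ?P. ennreal \<bar>measure (K \<omega>) A - measure ?P A\<bar>) \<partial>M)"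
  proof (rule nn_integral_mono)
    fix \<omega> assume "\<omega> \<in> space M"
    then have "K \<omega> \<in> space (prob_algebra borel)"
      using K measurable_space[of K ?F "prob_algebra borel" \<omega>] by (simp add: is_cond_distr_def)
    then have sp: "prob_space (K \<omega>)" "sets (K \<omega>) = sets ?P" by (auto simp: space_prob_algebra)
    show "ennreal (\<bar>(LINT w|K \<omega>. ?h \<omega> w) - (LINT w|?P. ?h \<omega> w)\<bar> / (2 * sqrt (m * D)))
        \<le> (\<Squnion>A\<in>sets ?P. ennreal \<bar>measure (K \<omega>) A - measure ?P A\<bar>)"
    proof (rule abs_integral_diff_le_total_variation[OF sp(1) _ sp(2) _ _ c])
      show "prob_space ?P" by (rule prob_space_distr) measurable
      show "?h \<omega> \<in> borel_measurable ?P" by measurable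
      show "\<bar>?h \<omega> w\<bar> \<le> sqrt (m * D)" for w
        by (rule U_facts(4)[OF J sum_phi_sq_le[OF m J]])
    qed
  qed
  show "ennreal (\<bar>lag_cov J k\<bar> / (2 * sqrt (m * D)))
    \<le> (\<integral>\<^sup>+\<omega>. (\<Squnion>A\<in>sets borel. ennreal \<bar>measure (K \<omega>) A - measure ?P A\<bar>) \<partial>M)"
    using order_trans[OF 1 2] by simp
qed

text \<open>The kernel depends on the second coordinate only; divided by its Lipschitz constant it
  belongs to \<open>Lip1\<close> for each outcome.\<close>

lemma lag_cov_le_tau1:
  assumes J: "finite J"
  shows "ennreal (\<bar>lag_cov J k\<bar> / (pi * m * sqrt (m * D))) \<le> tau1 M Y \<sigma> k"
  unfolding tau1_def tau_coeff_def
proof (rule INF_greatest)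
  note [measurable] = U_facts(1)
  let ?F = "vimage_algebra (space M) (W_proc Y \<sigma> 0) borel" and ?P = "distr M borel (W_proc Y \<sigma> k)"
  let ?h = "\<lambda>\<omega> w. \<Sum>j\<in>J. U j (Z 0 \<omega>) * phi m j (snd w)" and ?c = "pi * m * sqrt (m * D)"
  have c: "0 < ?c" using m D0 by simp
  fix K assume "K \<in> {K. is_cond_distr M ?F (W_proc Y \<sigma> k) K}"
  then have K: "is_cond_distr M ?F (W_proc Y \<sigma> k) K" by simp
  have 1: "ennreal (\<bar>lag_cov J k\<bar> / ?c)
    \<le> (\<integral>\<^sup>+\<omega>. ennreal (\<bar>(LINT w|K \<omega>. ?h \<omega> w) - (LINT w|?P. ?h \<omega> w)\<bar> / ?c) \<partial>M)"
    by (rule lag_cov_cond_distr[OF J K c])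
  have 2: "(\<integral>\<^sup>+\<omega>. ennreal (\<bar>(LINT w|K \<omega>. ?h \<omega> w) - (LINT w|?P. ?h \<omega> w)\<bar> / ?c) \<partial>M)
    \<le> (\<integral>\<^sup>+\<omega>. (\<Squnion>h\<in>Lip1. ennreal \<bar>(LINT w|K \<omega>. h w) - (LINT w|?P. h w)\<bar>) \<partial>M)"
  proof (rule nn_integral_mono)
    fix \<omega>
    have "(\<lambda>w. ?h \<omega> w / ?c) \<in> Lip1"
      unfolding Lip1_def
    proof (intro CollectI allI)
      fix v w :: "real \<times> real"
      have eq: "?h \<omega> v - ?h \<omega> w = (\<Sum>j\<in>J. U j (Z 0 \<omega>) * (phi m j (snd v) - phi m j (snd w)))"
        by (simp add: right_diff_distrib sum_subtractf)
      have "sqrt (m * (pi * m * \<bar>snd v - snd w\<bar>)\<^sup>2 * D) = ?c * \<bar>snd v - snd w\<bar>"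
        by (simp add: real_sqrt_mult abs_mult)
      moreover have "?c * \<bar>snd v - snd w\<bar> \<le> ?c * l1norm (v - w)"
        using c by (intro mult_left_mono) (auto simp: l1norm_def)
      ultimately have "\<bar>?h \<omega> v - ?h \<omega> w\<bar> \<le> ?c * l1norm (v - w)"
        unfolding eq using U_facts(4)[OF J sum_phi_diff_sq_le[OF m J], of "Z 0 \<omega>" "snd v" "snd w"] by linarith
      then show "\<bar>?h \<omega> v / ?c - ?h \<omega> w / ?c\<bar> \<le> l1norm (v - w)"
        using c by (simp only: diff_divide_distrib[symmetric] abs_divide abs_of_pos divide_le_eq if_True mult.commute)
    qed
    from SUP_upper[OF this, of "\<lambda>h. ennreal \<bar>(LINT w|K \<omega>. h w) - (LINT w|?P. h w)\<bar>"]
    show "ennreal (\<bar>(LINT w|K \<omega>. ?h \<omega> w) - (LINT w|?P. ?h \<omega> w)\<bar> / ?c)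
        \<le> (\<Squnion>h\<in>Lip1. ennreal \<bar>(LINT w|K \<omega>. h w) - (LINT w|?P. h w)\<bar>)"
      using c by (simp only: integral_divide_zero diff_divide_distrib[symmetric] abs_div_pos)
  qed
  show "ennreal (\<bar>lag_cov J k\<bar> / ?c)
    \<le> (\<integral>\<^sup>+\<omega>. (\<Squnion>h\<in>Lip1. ennreal \<bar>(LINT w|K \<omega>. h w) - (LINT w|?P. h w)\<bar>) \<partial>M)"
    by (rule order_trans[OF 1 2])
qed

text \<open>In each row of the n by n matrix of summed covariances the diagonal entry is at most D
  and either side of it is a partial sum of \<open>e\<close>, so a row is at most D + 2 E; there are
  n rows and a factor 1 / n^2.\<close>

lemma variance_term_le:
  assumes J: "finite J" and n: "n \<ge> 1"
    and e: "\<And>k. k \<ge> 1 \<Longrightarrow> lag_cov J k \<le> e k" and E: "\<And>K. (\<Sum>k=1..K. e k) \<le> E"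
  shows "integrable M (\<lambda>\<omega>. \<Sum>j\<in>J. ((\<Sum>i=1..n. U j (Z i \<omega>)) / n - coeff j)\<^sup>2)"
    and "(LINT \<omega>|M. (\<Sum>j\<in>J. ((\<Sum>i=1..n. U j (Z i \<omega>)) / n - coeff j)\<^sup>2)) \<le> (D + 2 * E) / n"
proof -
  let ?V = "\<lambda>i j \<omega>. U j (Z i \<omega>) - coeff j"
  define C where "C i l = (LINT \<omega>|M. (\<Sum>j\<in>J. ?V i j \<omega> * ?V l j \<omega>))" for i l
  have int: "integrable M (\<lambda>\<omega>. ?V i j \<omega> * ?V l j \<omega>)" for i l j
    by (simp add: integrable_U_Z left_diff_distrib right_diff_distrib)
  have expand: "(\<Sum>j\<in>J. ((\<Sum>i=1..n. U j (Z i \<omega>)) / n - coeff j)\<^sup>2)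
      = (\<Sum>i=1..n. \<Sum>l=1..n. \<Sum>j\<in>J. ?V i j \<omega> * ?V l j \<omega>) / n\<^sup>2" for \<omega>
  proof -
    have "((\<Sum>i=1..n. U j (Z i \<omega>)) / n - coeff j)\<^sup>2 = (\<Sum>i=1..n. \<Sum>l=1..n. ?V i j \<omega> * ?V l j \<omega>) / n\<^sup>2" for j
    proof -
      have "(\<Sum>i=1..n. U j (Z i \<omega>)) / n - coeff j = (\<Sum>i=1..n. ?V i j \<omega>) / n"
        using n by (simp add: sum_subtractf field_simps)
      then show ?thesis by (simp add: power_divide power2_eq_square[of "sum _ _"] sum_product)
    qed
    then have "(\<Sum>j\<in>J. ((\<Sum>i=1..n. U j (Z i \<omega>)) / n - coeff j)\<^sup>2)
      = (\<Sum>j\<in>J. \<Sum>i=1..n. \<Sum>l=1..n. ?V i j \<omega> * ?V l j \<omega>) / n\<^sup>2" by (simp add: sum_divide_distrib)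
    also have "(\<Sum>j\<in>J. \<Sum>i=1..n. \<Sum>l=1..n. ?V i j \<omega> * ?V l j \<omega>) = (\<Sum>i=1..n. \<Sum>j\<in>J. \<Sum>l=1..n. ?V i j \<omega> * ?V l j \<omega>)"
      by (rule sum.swap)
    also have "\<dots> = (\<Sum>i=1..n. \<Sum>l=1..n. \<Sum>j\<in>J. ?V i j \<omega> * ?V l j \<omega>)"
      by (intro sum.cong refl sum.swap)
    finally show ?thesis .
  qed
  show "integrable M (\<lambda>\<omega>. \<Sum>j\<in>J. ((\<Sum>i=1..n. U j (Z i \<omega>)) / n - coeff j)\<^sup>2)"
    unfolding expand by (intro integrable_divide_zero Bochner_Integration.integrable_sum int)
  \<comment> \<open>Variances are bounded by second moments, whose sum over J is at most D already
    pointwise.\<close>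
  have diag: "C i i \<le> D" for i
  proof -
    have "C i i = (\<Sum>j\<in>J. LINT \<omega>|M. ?V i j \<omega> * ?V i j \<omega>)"
      unfolding C_def by (rule Bochner_Integration.integral_sum) (rule int)
    also have "\<dots> = (\<Sum>j\<in>J. (LINT \<omega>|M. U j (Z i \<omega>) * U j (Z i \<omega>)) - coeff j * coeff j)"
      using integrable_U_Z by (simp add: left_diff_distrib right_diff_distrib expectation_U_Z prob_space)
    also have "\<dots> \<le> (\<Sum>j\<in>J. LINT \<omega>|M. U j (Z i \<omega>) * U j (Z i \<omega>))"
      by (intro sum_mono) simp
    also have "\<dots> = (LINT \<omega>|M. (\<Sum>j\<in>J. U j (Z i \<omega>) * U j (Z i \<omega>)))"
      by (rule Bochner_Integration.integral_sum[symmetric]) (rule integrable_U_Z)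
    also have "\<dots> \<le> D"
      using U_facts(2)[OF J] by (intro integral_le_const Bochner_Integration.integrable_sum integrable_U_Z AE_I2)
        (simp add: power2_eq_square)
    finally show ?thesis .
  qed
  have off: "C i l \<le> e (l - i)" "C l i \<le> e (l - i)" if "i < l" for i l
  proof -
    have "C i l = lag_cov J (l - i)"
      unfolding C_def using lag_cov_eq[where k = "l - i" and J = J and i = i] that by simp
    moreover have "C l i = C i l" unfolding C_def by (simp add: mult.commute)
    ultimately show "C i l \<le> e (l - i)" "C l i \<le> e (l - i)" using e[of "l - i"] that by simp_all
  qed
  have row: "(\<Sum>l=1..n. C i l) \<le> D + 2 * E" if i: "i \<in> {1..n}" for i
  proof -
    have "{1..n} = {1..<i} \<union> ({i} \<union> {i<..n})" using i by auto
    then have "(\<Sum>l=1..n. C i l) = (\<Sum>l\<in>{1..<i}. C i l) + (C i i + (\<Sum>l\<in>{i<..n}. C i l))"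
      by (simp only:) (subst sum.union_disjoint; force)+
    also have "\<dots> \<le> (\<Sum>l\<in>{1..<i}. e (i - l)) + (D + (\<Sum>l\<in>{i<..n}. e (l - i)))"
      using off diag by (intro add_mono sum_mono) auto
    also have "(\<Sum>l\<in>{1..<i}. e (i - l)) = (\<Sum>k=1..i - 1. e k)"
      by (rule sum.reindex_bij_witness[of _ "\<lambda>k. i - k" "\<lambda>l. i - l"]) auto
    also have "(\<Sum>l\<in>{i<..n}. e (l - i)) = (\<Sum>k=1..n - i. e k)"
      by (rule sum.reindex_bij_witness[of _ "\<lambda>k. i + k" "\<lambda>l. l - i"]) auto
    finally show ?thesis using E[of "i - 1"] E[of "n - i"] by simp
  qed
  have "(LINT \<omega>|M. (\<Sum>j\<in>J. ((\<Sum>i=1..n. U j (Z i \<omega>)) / n - coeff j)\<^sup>2)) = (\<Sum>i=1..n. \<Sum>l=1..n. C i l) / n\<^sup>2"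
    unfolding expand C_def integral_divide_zero
    by (subst Bochner_Integration.integral_sum, intro Bochner_Integration.integrable_sum int)
      (subst Bochner_Integration.integral_sum, intro Bochner_Integration.integrable_sum int, rule refl)
  also have "\<dots> \<le> (\<Sum>i=1..n. D + 2 * E) / n\<^sup>2"
    by (intro divide_right_mono sum_mono row) auto
  also have "\<dots> = (D + 2 * E) / n"
    using n by (simp add: power2_eq_square)
  finally show "(LINT \<omega>|M. (\<Sum>j\<in>J. ((\<Sum>i=1..n. U j (Z i \<omega>)) / n - coeff j)\<^sup>2)) \<le> (D + 2 * E) / n" .
qed

end

end

subsection \<open>Rates\<close>

text \<open>Up to the constant \<open>\<kappa>0\<^sup>2\<close>, the inverse square of the assumed
  lower bound for the transform of the noise density.\<close>

definition weight :: "real \<Rightarrow> real \<Rightarrow> real \<Rightarrow> real \<Rightarrow> real" where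
  "weight \<gamma> \<mu> \<delta> x = (x\<^sup>2 + 1) powr \<gamma> * exp (2 * \<mu> * pow0 \<bar>x\<bar> \<delta>)"

lemma pow0_measurable [measurable]: "(\<lambda>x. pow0 x a) \<in> borel_measurable borel"
  unfolding pow0_def by measurable

lemma weight_measurable [measurable]: "weight \<gamma> \<mu> \<delta> \<in> borel_measurable borel"
  unfolding weight_def[abs_def] by measurable

lemma weight_nonneg: "0 \<le> weight \<gamma> \<mu> \<delta> x"
  by (simp add: weight_def)

lemma pow0_mono: "0 \<le> a \<Longrightarrow> 0 \<le> x \<Longrightarrow> x \<le> y \<Longrightarrow> pow0 x a \<le> pow0 y a"
  by (auto simp: pow0_def intro!: powr_mono2)

lemma weight_mono:
  assumes "0 \<le> \<gamma>" "0 \<le> \<mu>" "0 \<le> \<delta>" "\<bar>x\<bar> \<le> \<bar>y\<bar>"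
  shows "weight \<gamma> \<mu> \<delta> x \<le> weight \<gamma> \<mu> \<delta> y"
proof -
  have "x\<^sup>2 \<le> y\<^sup>2" using assms(4) by (simp add: abs_le_square_iff)
  then show ?thesis
    unfolding weight_def using assms by (intro mult_mono powr_mono2) (auto intro!: mult_left_mono pow0_mono)
qed

lemma integral_band_weight:
  assumes par: "0 \<le> \<gamma>" "0 \<le> \<mu>" "0 \<le> \<delta>"
  shows "(LINT x|band m. weight \<gamma> \<mu> \<delta> x) = 2 * (LINT x|lborel. indicator {0..pi * m} x *\<^sub>R weight \<gamma> \<mu> \<delta> x)"
proof -
  \<comment> \<open>Cut off at the band to be bounded on the whole line, as the reflection lemma
    requires.\<close>
  let ?k = "\<lambda>x. indicator {- (pi * m)..pi * m} x * weight \<gamma> \<mu> \<delta> x"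
  have b: "\<bar>?k x\<bar> \<le> weight \<gamma> \<mu> \<delta> (pi * m)" for x
    using weight_mono[OF par, of x "pi * m"] by (auto simp: indicator_def weight_nonneg)
  have "(LINT x|band m. weight \<gamma> \<mu> \<delta> x) = (LINT x|lborel. indicator {- (pi * m)..pi * m} x *\<^sub>R ?k x)"
    by (subst integral_band) (auto simp: set_lebesgue_integral_def indicator_def intro!: Bochner_Integration.integral_cong)
  also have "\<dots> = 2 * (LINT x|lborel. indicator {0..pi * m} x *\<^sub>R ?k x)"
    by (rule integral_even_Icc[OF _ b]) (auto simp: indicator_def weight_def)
  also have "(LINT x|lborel. indicator {0..pi * m} x *\<^sub>R ?k x) = (LINT x|lborel. indicator {0..pi * m} x *\<^sub>R weight \<gamma> \<mu> \<delta> x)"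
    by (intro Bochner_Integration.integral_cong) (auto simp: indicator_def)
  finally show ?thesis .
qed

lemma Gamma_rate_nonneg: "0 \<le> Gamma_rate \<gamma> \<mu> \<delta> m"
  by (simp add: Gamma_rate_def)

lemma Gamma_rate_pos: "m \<ge> 1 \<Longrightarrow> 0 < Gamma_rate \<gamma> \<mu> \<delta> m"
  unfolding Gamma_rate_def by (intro mult_pos_pos) (auto simp: add_nonneg_eq_0_iff)

text \<open>The derivative of the rate dominates \<open>\<mu> * \<delta>\<close> times the weight
  for large x. Half of its leading term is given up to absorb the term with 1 -
  \<open>\<delta>\<close>, whose sign is unknown; the term from the polynomial factor is
  nonnegative. Small x contribute only a constant.\<close>

lemma integral_weight_le_exp:
  assumes par: "0 \<le> \<gamma>" "0 < \<mu>" "0 < \<delta>"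
  shows "\<exists>c\<ge>0. \<forall>m::nat. (LINT x|lborel. indicator {0..pi * m} x *\<^sub>R weight \<gamma> \<mu> \<delta> x) \<le> c + Gamma_rate \<gamma> \<mu> \<delta> m / (\<mu> * \<delta>)"
proof -
  let ?h = "weight \<gamma> \<mu> \<delta>"
  \<comment> \<open>\<open>G\<close> is the rate at \<open>x = pi * m\<close>; the leading term of its derivative is \<open>2 * \<mu> * \<delta>\<close> times the weight.\<close>
  define G where "G x = (x\<^sup>2 + 1) powr \<gamma> * (x powr (1 - \<delta>) * exp (2 * \<mu> * x powr \<delta>))" for x :: real
  define G' where "G' x = \<gamma> * (x\<^sup>2 + 1) powr (\<gamma> - 1) * (2 * x) * (x powr (1 - \<delta>) * exp (2 * \<mu> * x powr \<delta>))
    + (x\<^sup>2 + 1) powr \<gamma> * ((1 - \<delta>) * x powr (- \<delta>) * exp (2 * \<mu> * x powr \<delta>)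
      + x powr (1 - \<delta>) * (exp (2 * \<mu> * x powr \<delta>) * (2 * \<mu> * (\<delta> * x powr (\<delta> - 1)))))" for x :: real
  have sq: "0 < x\<^sup>2 + 1" for x :: real by (simp add: add_nonneg_pos)
  have G: "(G has_real_derivative G' x) (at x)" if x: "0 < x" for x
  proof -
    have 1: "((\<lambda>x. (x\<^sup>2 + 1) powr \<gamma>) has_real_derivative \<gamma> * (x\<^sup>2 + 1) powr (\<gamma> - 1) * (2 * x)) (at x)"
      using sq[of x] by (auto intro!: derivative_eq_intros)
    have 2: "((\<lambda>x. x powr (1 - \<delta>)) has_real_derivative (1 - \<delta>) * x powr (- \<delta>)) (at x)"
      using has_real_derivative_powr[OF x, of "1 - \<delta>"] by simp
    have 3: "((\<lambda>x. exp (2 * \<mu> * x powr \<delta>)) has_real_derivative exp (2 * \<mu> * x powr \<delta>) * (2 * \<mu> * (\<delta> * x powr (\<delta> - 1)))) (at x)"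
      by (rule DERIV_fun_exp[OF DERIV_cmult[OF has_real_derivative_powr[OF x]]])
    show ?thesis
      unfolding G_def[abs_def] G'_def using DERIV_mult[OF 1 DERIV_mult[OF 2 3]] by (simp add: algebra_simps)
  qed
  \<comment> \<open>Beyond \<open>x1\<close> the term of unknown sign is smaller than half of the
    leading one.\<close>
  have "((\<lambda>x. \<bar>1 - \<delta>\<bar> * x powr (- \<delta>)) \<longlongrightarrow> \<bar>1 - \<delta>\<bar> * 0) at_top"
    using par by (intro tendsto_mult_left tendsto_neg_powr filterlim_ident) auto
  then have "\<forall>\<^sub>F x in at_top. \<bar>1 - \<delta>\<bar> * x powr (- \<delta>) < \<mu> * \<delta>"
    using par by (intro order_tendstoD) auto
  then obtain x1 where x1: "\<And>x. x \<ge> x1 \<Longrightarrow> \<bar>1 - \<delta>\<bar> * x powr (- \<delta>) < \<mu> * \<delta>"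
    by (auto simp: eventually_at_top_linorder)
  \<comment> \<open>At least 1, to stay away from 0, where the powers of x may be singular.\<close>
  define x0 where "x0 = max 1 x1"
  have x0: "1 \<le> x0" "x1 \<le> x0" by (auto simp: x0_def)
  have hG: "?h x \<le> G' x / (\<mu> * \<delta>)" if x: "x \<ge> x0" for x
  proof -
    have pos: "0 < x" using x x0 by simp
    let ?E = "exp (2 * \<mu> * x powr \<delta>)" and ?A = "(x\<^sup>2 + 1) powr \<gamma>"
    have "x powr (1 - \<delta>) * x powr (\<delta> - 1) = 1" using pos by (simp add: powr_add[symmetric])
    then have split: "x powr (1 - \<delta>) * (?E * (2 * \<mu> * (\<delta> * x powr (\<delta> - 1)))) = ?E * (2 * \<mu> * \<delta>)"
      by algebra
    then have "G' x = \<gamma> * (x\<^sup>2 + 1) powr (\<gamma> - 1) * (2 * x) * (x powr (1 - \<delta>) * ?E)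
        + ?A * ?E * ((1 - \<delta>) * x powr (- \<delta>) + 2 * \<mu> * \<delta>)"
      unfolding G'_def split by (simp add: algebra_simps)
    moreover have "0 \<le> \<gamma> * (x\<^sup>2 + 1) powr (\<gamma> - 1) * (2 * x) * (x powr (1 - \<delta>) * ?E)"
      using par pos by simp
    moreover have "?A * ?E * (\<mu> * \<delta>) \<le> ?A * ?E * ((1 - \<delta>) * x powr (- \<delta>) + 2 * \<mu> * \<delta>)"
    proof (intro mult_left_mono)
      have "\<bar>(1 - \<delta>) * x powr (- \<delta>)\<bar> < \<mu> * \<delta>" using x1[of x] x x0 by (simp add: abs_mult)
      then show "\<mu> * \<delta> \<le> (1 - \<delta>) * x powr (- \<delta>) + 2 * \<mu> * \<delta>" by linarith
    qed auto
    ultimately have "?A * ?E * (\<mu> * \<delta>) \<le> G' x" by linarith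
    then show ?thesis using par pos by (simp add: weight_def pow0_def le_divide_eq)
  qed
  have cont: "continuous_on {x0..a} G'" for a
    unfolding G'_def using x0 sq by (intro continuous_intros) (auto simp: less_imp_neq[symmetric])
  have Gnn: "0 \<le> G x" for x by (simp add: G_def)
  have le: "(LINT x|lborel. indicator {0..pi * m} x *\<^sub>R ?h x) \<le> x0 * ?h x0 + Gamma_rate \<gamma> \<mu> \<delta> m / (\<mu> * \<delta>)" for m :: nat
  proof -
    let ?a = "pi * m"
    have I: "integrable lborel (\<lambda>x. indicator {x0..?a} x *\<^sub>R G' x)"
      "(LINT x|lborel. indicator {x0..?a} x *\<^sub>R G' x) \<le> G ?a"
    proof -
      show "integrable lborel (\<lambda>x. indicator {x0..?a} x *\<^sub>R G' x)"
        using borel_integrable_atLeastAtMost'[OF cont] by (simp add: set_integrable_def)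
      show "(LINT x|lborel. indicator {x0..?a} x *\<^sub>R G' x) \<le> G ?a"
      proof (cases "x0 \<le> ?a")
        case True
        have "(LINT x|lborel. indicator {x0..?a} x *\<^sub>R G' x) = G ?a - G x0"
        proof (rule integral_FTC_Icc[OF True _ cont])
          fix x assume "x0 \<le> x"
          then have "(G has_real_derivative G' x) (at x)" using x0 by (intro G) auto
          then show "(G has_vector_derivative G' x) (at x within {x0..?a})"
            unfolding has_real_derivative_iff_has_vector_derivative by (rule has_vector_derivative_at_within)
        qed
        then show ?thesis using Gnn[of x0] by simp
      next
        case False
        then show ?thesis using Gnn[of ?a] by simp
      qed
    qed
    have "(LINT x|lborel. indicator {0..?a} x *\<^sub>R ?h x)
      \<le> (LINT x|lborel. indicator {0..x0} x *\<^sub>R ?h x0 + indicator {x0..?a} x *\<^sub>R G' x / (\<mu> * \<delta>))"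
    proof (rule integral_mono)
      show "integrable lborel (\<lambda>x. indicator {0..?a} x *\<^sub>R ?h x)"
      proof (rule Bochner_Integration.integrable_bound[of _ "\<lambda>x. indicator {0..?a} x *\<^sub>R ?h ?a"])
        show "AE x in lborel. norm (indicator {0..?a} x *\<^sub>R ?h x) \<le> norm (indicator {0..?a} x *\<^sub>R ?h ?a)"
          using weight_mono[of \<gamma> \<mu> \<delta> _ ?a] par by (auto simp: indicator_def weight_nonneg)
      qed auto
      show "integrable lborel (\<lambda>x. indicator {0..x0} x *\<^sub>R ?h x0 + indicator {x0..?a} x *\<^sub>R G' x / (\<mu> * \<delta>))"
        using I(1) by auto
      fix x
      consider "x \<notin> {0..?a}" | "x \<in> {0..?a}" "x < x0" | "x \<in> {0..?a}" "x0 \<le> x" by linarith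
      then show "indicator {0..?a} x *\<^sub>R ?h x \<le> indicator {0..x0} x *\<^sub>R ?h x0 + indicator {x0..?a} x *\<^sub>R G' x / (\<mu> * \<delta>)"
      proof cases
        case 1
        then have "x \<notin> {x0..?a}" using x0 by auto
        then show ?thesis using 1 weight_nonneg[of \<gamma> \<mu> \<delta> x0] by (simp add: indicator_def)
      next
        case 2
        then show ?thesis using weight_mono[of \<gamma> \<mu> \<delta> x x0] par by (simp add: indicator_def)
      next
        case 3
        then have "0 \<le> indicator {0..x0} x *\<^sub>R ?h x0" "x \<in> {x0..?a}" by (auto simp: weight_nonneg)
        then show ?thesis using 3 hG[OF 3(2)] by (simp only: indicator_simps scaleR_one)
      qed
    qed
    also have "\<dots> = x0 * ?h x0 + (LINT x|lborel. indicator {x0..?a} x *\<^sub>R G' x) / (\<mu> * \<delta>)"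
      by (subst Bochner_Integration.integral_add) (use I(1) x0 in auto)
    also have "\<dots> \<le> x0 * ?h x0 + G ?a / (\<mu> * \<delta>)"
      using I(2) par by (intro add_left_mono divide_right_mono) auto
    also have "G ?a = Gamma_rate \<gamma> \<mu> \<delta> m"
      by (simp add: G_def Gamma_rate_def add.commute mult.assoc)
    finally show ?thesis .
  qed
  show ?thesis
    by (rule exI[of _ "x0 * ?h x0"]) (use le x0 weight_nonneg[of \<gamma> \<mu> \<delta> x0] in auto)
qed

lemma integral_weight_le_poly:
  assumes "0 \<le> \<gamma>" "0 \<le> \<mu>"
  shows "(LINT x|lborel. indicator {0..pi * m} x *\<^sub>R weight \<gamma> \<mu> 0 x) \<le> Gamma_rate \<gamma> \<mu> 0 m"
proof -
  let ?a = "pi * real m"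
  have "(LINT x|lborel. indicator {0..?a} x *\<^sub>R weight \<gamma> \<mu> 0 x) \<le> (LINT x|lborel. indicator {0..?a} x *\<^sub>R weight \<gamma> \<mu> 0 ?a)"
  proof (rule integral_mono')
    show "integrable lborel (\<lambda>x. indicator {0..?a} x *\<^sub>R weight \<gamma> \<mu> 0 ?a)" by auto
    show "indicator {0..?a} x *\<^sub>R weight \<gamma> \<mu> 0 x \<le> indicator {0..?a} x *\<^sub>R weight \<gamma> \<mu> 0 ?a" for x
      using weight_mono[of \<gamma> \<mu> 0 x ?a] assms by (auto simp: indicator_def)
  qed (auto simp: weight_nonneg)
  also have "\<dots> = ?a * weight \<gamma> \<mu> 0 ?a" by simp
  also have "\<dots> \<le> Gamma_rate \<gamma> \<mu> 0 m"
    \<comment> \<open>The exponential factors agree because pi m to the power 0 is 1, which fails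
      for \<open>powr\<close> at m = 0; there both sides vanish.\<close>
    by (cases "m = 0") (auto simp: weight_def Gamma_rate_def pow0_def add.commute)
  finally show ?thesis .
qed

lemma integral_weight_le:
  assumes "0 \<le> \<gamma>" "0 \<le> \<mu>" "0 \<le> \<delta>" "\<delta> > 0 \<Longrightarrow> \<mu> > 0"
  shows "\<exists>c\<ge>0. \<forall>m::nat. (LINT x|lborel. indicator {0..pi * m} x *\<^sub>R weight \<gamma> \<mu> \<delta> x)
    \<le> c + 2 * Gamma_rate \<gamma> \<mu> \<delta> m / R_const \<mu> \<delta>"
proof (cases "\<delta> = 0")
  case True
  then show ?thesis
    using integral_weight_le_poly[OF assms(1,2)] Gamma_rate_nonneg[of \<gamma> \<mu> 0]
    by (intro exI[of _ 0]) (auto simp: R_const_def intro: order_trans[OF _ mult_right_mono[of 1 2, simplified]])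
next
  case False
  then have "2 * Gamma_rate \<gamma> \<mu> \<delta> m / R_const \<mu> \<delta> = Gamma_rate \<gamma> \<mu> \<delta> m / (\<mu> * \<delta>)" for m
    by (simp add: R_const_def)
  then show ?thesis using integral_weight_le_exp[of \<gamma> \<mu> \<delta>] False assms by auto
qed

text \<open>For \<open>\<delta> = 0\<close> the rate is at least m to the power
  \<open>2 * \<gamma> + 1\<close>. The exponents p = 1, 2, 3 are used, with thresholds 0, 1/2 and 1
  for \<open>\<gamma>\<close>: for the covariances under beta, the truncated coefficients, and the
  covariances under tau.\<close>

lemma Gamma_rate_dominates:
  assumes par: "0 \<le> \<gamma>" "0 \<le> \<mu>" "0 \<le> \<delta>" "\<delta> > 0 \<Longrightarrow> \<mu> > 0" and p: "\<delta> > 0 \<or> p < 2 * \<gamma> + 1"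
  shows "(\<lambda>m. real m powr p / Gamma_rate \<gamma> \<mu> \<delta> m) \<longlonglongrightarrow> 0"
proof (cases "\<delta> = 0")
  case True
  have "(\<lambda>m. real m powr (p - (2 * \<gamma> + 1))) \<longlonglongrightarrow> 0"
    using p True by (intro tendsto_neg_powr filterlim_real_sequentially) auto
  then show ?thesis
  proof (rule tendsto_sandwich[OF _ _ tendsto_const, rotated 2])
    show "\<forall>\<^sub>F m in sequentially. 0 \<le> real m powr p / Gamma_rate \<gamma> \<mu> \<delta> m"
      by (simp add: Gamma_rate_nonneg)
    show "\<forall>\<^sub>F m in sequentially. real m powr p / Gamma_rate \<gamma> \<mu> \<delta> m \<le> real m powr (p - (2 * \<gamma> + 1))"
      using eventually_ge_at_top[of 1]
    proof eventually_elim
      case (elim m)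
      have pm: "real m \<le> pi * m" using pi_gt3 by (simp add: mult_le_cancel_right1)
      have "real m powr (2 * \<gamma> + 1) = (real m powr 2) powr \<gamma> * real m powr 1 * 1"
        by (simp only: powr_powr powr_add[symmetric] mult_1_right)
      also have "\<dots> \<le> (1 + (pi * m)\<^sup>2) powr \<gamma> * (pi * m) powr 1 * exp (2 * \<mu> * (pi * m) powr 0)"
      proof (intro mult_mono powr_mono2)
        have "(real m)\<^sup>2 \<le> (pi * m)\<^sup>2" using pm by (intro power_mono) auto
        then have "(real m)\<^sup>2 \<le> 1 + (pi * m)\<^sup>2" by linarith
        then show "real m powr 2 \<le> 1 + (pi * m)\<^sup>2" by simp
      qed (use par pm in auto)
      also have "\<dots> = Gamma_rate \<gamma> \<mu> \<delta> m" using True by (simp add: Gamma_rate_def)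
      finally have "real m powr p / Gamma_rate \<gamma> \<mu> \<delta> m \<le> real m powr p / real m powr (2 * \<gamma> + 1)"
        using elim by (intro divide_left_mono) (auto simp: Gamma_rate_pos)
      then show ?case by (simp add: powr_diff)
    qed
  qed
next
  case False
  then have d: "0 < \<delta>" "0 < \<mu>" using par by auto
  have "((\<lambda>x::real. x powr p / ((pi * x) powr (1 - \<delta>) * exp (2 * \<mu> * (pi * x) powr \<delta>))) \<longlongrightarrow> 0) at_top"
    using d by real_asymp
  from filterlim_compose[OF this filterlim_real_sequentially]
  have "(\<lambda>m. real m powr p / ((pi * m) powr (1 - \<delta>) * exp (2 * \<mu> * (pi * m) powr \<delta>))) \<longlonglongrightarrow> 0" .
  then show ?thesis
  proof (rule tendsto_sandwich[OF _ _ tendsto_const, rotated 2])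
    show "\<forall>\<^sub>F m in sequentially. 0 \<le> real m powr p / Gamma_rate \<gamma> \<mu> \<delta> m"
      by (simp add: Gamma_rate_nonneg)
    show "\<forall>\<^sub>F m in sequentially. real m powr p / Gamma_rate \<gamma> \<mu> \<delta> m
        \<le> real m powr p / ((pi * m) powr (1 - \<delta>) * exp (2 * \<mu> * (pi * m) powr \<delta>))"
      using eventually_ge_at_top[of 1]
    proof eventually_elim
      case (elim m)
      let ?E = "(pi * m) powr (1 - \<delta>) * exp (2 * \<mu> * (pi * m) powr \<delta>)"
      have "1 * ?E \<le> (1 + (pi * m)\<^sup>2) powr \<gamma> * ?E"
        using par by (intro mult_right_mono ge_one_powr_ge_zero) auto
      then have "?E \<le> Gamma_rate \<gamma> \<mu> \<delta> m" by (simp add: Gamma_rate_def mult.assoc)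
      then show ?case using elim by (intro divide_left_mono mult_pos_pos) (auto simp: Gamma_rate_pos)
    qed
  qed
qed

text \<open>Otherwise the squared modulus of the transform is at least a multiple of 1 / (1 + x) for
  x \<ge> 0, whose integral over the band grows like ln m, while the energy on every band is bounded
  by that of \<open>f\<close>.\<close>

lemma decay_exponent_gt_half:
  assumes nonneg: "\<And>x. 0 \<le> f x" and f: "integrable lborel f" and f1: "(LINT x|lborel. f x) = 1"
    and f2: "integrable lborel (\<lambda>x. (f x)\<^sup>2)" and c: "0 < c" and \<gamma>: "0 \<le> \<gamma>"
    and lower: "\<And>x. c * (x\<^sup>2 + 1) powr (- \<gamma> / 2) \<le> cmod (fourier_real f x)"
  shows "1 / 2 < \<gamma>"
proof (rule ccontr)
  assume "\<not> 1 / 2 < \<gamma>"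
  then have \<gamma>: "\<gamma> \<le> 1 / 2" by simp
  let ?F = "\<lambda>x. (cmod (fourier_real f x))\<^sup>2" and ?I = "LINT x|lborel. (f x)\<^sup>2"
  have F_eq: "fourier_real f = ft f"
    using f by (intro ext fourier_eq_ft) simp
  have [measurable]: "f \<in> borel_measurable borel" "fourier_real f \<in> borel_measurable borel"
    using f unfolding F_eq by (auto dest: borel_measurable_integrable)
  have norm_F: "cmod (fourier_real f x) \<le> 1" for x
    using norm_ft_le[of "\<lambda>x. complex_of_real (f x)" x] f1 nonneg by (simp add: F_eq)
  have low: "c\<^sup>2 / (1 + x) \<le> ?F x" if x: "0 \<le> x" for x
  proof -
    have 1: "0 < x\<^sup>2 + 1" by (simp add: add_nonneg_pos)
    have "(x\<^sup>2 + 1) powr \<gamma> \<le> (x\<^sup>2 + 1) powr (1 / 2)"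
      using \<gamma> by (intro powr_mono) auto
    also have "\<dots> \<le> 1 + x"
      using x 1 by (auto simp: powr_half_sqrt power2_eq_square algebra_simps intro!: real_le_lsqrt)
    finally have "1 / (1 + x) \<le> (x\<^sup>2 + 1) powr (- \<gamma>)"
      using x 1 by (simp add: powr_minus divide_simps)
    then have "c\<^sup>2 * (1 / (1 + x)) \<le> c\<^sup>2 * (x\<^sup>2 + 1) powr (- \<gamma>)" by (intro mult_left_mono) auto
    also have "\<dots> = (c * (x\<^sup>2 + 1) powr (- \<gamma> / 2))\<^sup>2"
      using 1 by (simp add: power_mult_distrib power2_eq_square powr_add[symmetric])
    also have "\<dots> \<le> ?F x"
      using lower[of x] c by (intro power_mono) auto
    finally show ?thesis by simp
  qed
  have bound: "c\<^sup>2 * ln (1 + pi * m) \<le> 2 * pi * ?I" if m: "m \<ge> 1" for m :: nat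
  proof -
    let ?a = "pi * real m"
    have a: "0 \<le> ?a" by simp
    have cont: "continuous_on {0..?a} (\<lambda>x. c\<^sup>2 / (1 + x))" by (intro continuous_intros) auto
    have "c\<^sup>2 * ln (1 + ?a) = c\<^sup>2 * ln (1 + ?a) - c\<^sup>2 * ln (1 + 0)" by simp
    also have "\<dots> = (LINT x|lborel. indicator {0..?a} x *\<^sub>R (c\<^sup>2 / (1 + x)))"
    proof (rule integral_FTC_Icc[OF a _ cont, symmetric])
      fix x :: real assume x: "0 \<le> x"
      have "((\<lambda>x. c\<^sup>2 * ln (1 + x)) has_real_derivative c\<^sup>2 / (1 + x)) (at x)"
        using x by (auto intro!: derivative_eq_intros)
      then show "((\<lambda>x. c\<^sup>2 * ln (1 + x)) has_vector_derivative c\<^sup>2 / (1 + x)) (at x within {0..?a})"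
        unfolding has_real_derivative_iff_has_vector_derivative by (rule has_vector_derivative_at_within)
    qed
    also have "\<dots> \<le> (LINT x|lborel. indicator {- ?a..?a} x *\<^sub>R ?F x)"
    proof (rule integral_mono)
      show "integrable lborel (\<lambda>x. indicator {0..?a} x *\<^sub>R (c\<^sup>2 / (1 + x)))"
        using borel_integrable_atLeastAtMost'[OF cont] by (simp add: set_integrable_def)
      show "integrable lborel (\<lambda>x. indicator {- ?a..?a} x *\<^sub>R ?F x)"
        using norm_F by (intro integrable_indicator_bounded[of _ 1]) (auto intro: power_le_one)
      show "indicator {0..?a} x *\<^sub>R (c\<^sup>2 / (1 + x)) \<le> indicator {- ?a..?a} x *\<^sub>R ?F x" for x
        using low[of x] by (auto simp: indicator_def)
    qed
    also have "\<dots> = (LINT x|band m. ?F x)"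
      by (subst integral_band) (auto simp: set_lebesgue_integral_def)
    also have "\<dots> \<le> 2 * pi * ?I"
      using integral_band_fourier_le[OF nonneg f f1 f2 m] by (simp add: field_simps)
    finally show ?thesis .
  qed
  have "filterlim (\<lambda>m::nat. c\<^sup>2 * ln (1 + pi * m)) at_top at_top"
    using c by real_asymp
  then have "\<forall>\<^sub>F m in sequentially. 2 * pi * ?I < c\<^sup>2 * ln (1 + pi * real m)"
    by (simp add: filterlim_at_top_dense)
  then have "\<forall>\<^sub>F m in sequentially. False"
    using eventually_ge_at_top[of 1] by eventually_elim (use bound in \<open>force simp: not_less\<close>)
  then show False by simp
qed

section \<open>Assembling the risk bound\<close>

lemma partial_sums_le_suminf_ennreal:
  fixes b :: "nat \<Rightarrow> ennreal"
  assumes "(\<Sum>i. b (Suc i)) = ennreal B" "0 \<le> B"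
  shows "k \<ge> 1 \<Longrightarrow> b k = ennreal (enn2real (b k))" "(\<Sum>k=1..K. enn2real (b k)) \<le> B"
proof -
  have le: "(\<Sum>i\<in>I. b (Suc i)) \<le> ennreal B" if "finite I" for I
    using sum_le_suminf[of "\<lambda>i. b (Suc i)" I] that assms(1) by simp
  have fin: "b k < \<top>" if "k \<ge> 1" for k
  proof -
    have "b k \<le> ennreal B" using le[of "{k - 1}"] that by simp
    then show ?thesis by (rule order_le_less_trans) simp
  qed
  then show eq: "k \<ge> 1 \<Longrightarrow> b k = ennreal (enn2real (b k))" for k by (simp add: ennreal_enn2real)
  have "(\<Sum>k=1..K. b k) = (\<Sum>i<K. b (Suc i))"
    by (rule sum.reindex_bij_witness[of _ Suc "\<lambda>k. k - 1"]) auto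
  then have "(\<Sum>k=1..K. b k) \<le> ennreal B" using le[of "{..<K}"] by simp
  moreover have "(\<Sum>k=1..K. b k) = ennreal (\<Sum>k=1..K. enn2real (b k))"
    using eq by (subst sum_ennreal[symmetric]) (auto intro!: sum.cong)
  ultimately show "(\<Sum>k=1..K. enn2real (b k)) \<le> B" using assms(2) by simp
qed

text \<open>Both kinds of dependence in one statement: \<open>c\<close> is the scale at which a lag
  covariance is bounded by its coefficient, so \<open>c * B\<close> bounds the partial sums of the
  covariances.\<close>

lemma (in volatility_model) risk_le:
  assumes m: "m \<ge> 1" and bb: "bounded_borel (recip_band (fourier_real f\<epsilon>) m)"
    and D: "(LINT x|band m. (norm (recip_band (fourier_real f\<epsilon>) m x))\<^sup>2) / (2 * pi) \<le> D" and D0: "0 < D"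
    and nz: "\<And>x. fourier_real f\<epsilon> x \<noteq> 0"
    and g2: "integrable lborel (\<lambda>x. (g x)\<^sup>2)"
    and M2: "0 < M2" and int: "integrable lborel (\<lambda>x. x\<^sup>2 * (g x)\<^sup>2)" and le: "(LINT x|lborel. x\<^sup>2 * (g x)\<^sup>2) \<le> M2"
    and cl: "g \<in> smoothness_class s r b C1" and pars: "0 \<le> s" "0 \<le> r" "0 \<le> b"
    and n: "1 \<le> n" and k: "int n \<le> k" and B: "0 \<le> B"
    and dep: "(\<Sum>i. beta1 M Y \<sigma> (Suc i)) = ennreal B \<and> c = 2 * sqrt (m * D) \<or>
      (\<Sum>i. tau1 M Y \<sigma> (Suc i)) = ennreal B \<and> c = pi * m * sqrt (m * D)"
  shows "(\<integral>\<^sup>+\<omega>. ennreal ((l2norm (\<lambda>x. g x - estimator f\<epsilon> m k n (\<lambda>i. log_sq Y i \<omega>) x))\<^sup>2) \<partial>M)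
    \<le> ennreal (C1 / (2 * pi) * ((real m)\<^sup>2 * pi\<^sup>2 + 1) powr (- s) * exp (- 2 * b * pi powr r * real m powr r)
      + 2 * (m * sqrt M2 + sqrt m / pi)\<^sup>2 / n + (D + 2 * (c * B)) / n)"
proof -
  let ?J = "{j. \<bar>j\<bar> \<le> k}" and ?a = "\<lambda>j. LINT x|lborel. g x * phi m j x"
  let ?V = "\<lambda>\<omega>. \<Sum>j\<in>?J. ((\<Sum>i=1..n. U_coeff f\<epsilon> m j (Z i \<omega>)) / n - ?a j)\<^sup>2"
  let ?A = "(LINT x|lborel. (g x)\<^sup>2) - (\<Sum>j\<in>?J. (?a j)\<^sup>2)"
  have J: "finite ?J" by simp
  have c0: "0 < c" using dep m D0 by auto
  have dep_e: "\<exists>e. (\<forall>k\<ge>1. lag_cov m ?J k \<le> e k) \<and> (\<forall>K. (\<Sum>k=1..K. e k) \<le> c * B)"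
    if b: "(\<Sum>i. d (Suc i)) = ennreal B" and cd: "\<And>k. ennreal (\<bar>lag_cov m ?J k\<bar> / c) \<le> d k" for d :: "nat \<Rightarrow> ennreal"
  proof (intro exI[of _ "\<lambda>k. c * enn2real (d k)"] conjI allI impI)
    fix k :: nat assume k: "k \<ge> 1"
    have "ennreal (\<bar>lag_cov m ?J k\<bar> / c) \<le> ennreal (enn2real (d k))"
      using cd[of k] partial_sums_le_suminf_ennreal(1)[OF b B k] by simp
    then have "\<bar>lag_cov m ?J k\<bar> / c \<le> enn2real (d k)" by simp
    then show "lag_cov m ?J k \<le> c * enn2real (d k)" using c0 by (simp add: field_simps)
  next
    show "(\<Sum>k=1..K. c * enn2real (d k)) \<le> c * B" for K
      using partial_sums_le_suminf_ennreal(2)[OF b B, of K] c0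
      by (simp only: sum_distrib_left[symmetric]) (intro mult_left_mono, auto)
  qed
  obtain e where e: "\<And>k. k \<ge> 1 \<Longrightarrow> lag_cov m ?J k \<le> e k" "\<And>K. (\<Sum>k=1..K. e k) \<le> c * B"
    using dep dep_e[of "beta1 M Y \<sigma>"] dep_e[of "tau1 M Y \<sigma>"] lag_cov_le_beta1[OF m bb D D0 nz J] lag_cov_le_tau1[OF m bb D D0 nz J]
    by blast
  note V = variance_term_le[OF m bb D D0 nz J n e]
  have risk: "(l2norm (\<lambda>x. g x - estimator f\<epsilon> m k n (\<lambda>i. log_sq Y i \<omega>) x))\<^sup>2 = ?A + ?V \<omega>" for \<omega>
    unfolding estimator_eq[OF m n bb] by (rule l2norm_diff_phi_sum[OF m J integrable_g g2])
  have "(\<integral>\<^sup>+\<omega>. ennreal (?A + ?V \<omega>) \<partial>M) = ennreal (LINT \<omega>|M. ?A + ?V \<omega>)"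
    using bessel_phi[OF m J integrable_g g2] V(1)
    by (intro nn_integral_eq_integral AE_I2 add_nonneg_nonneg sum_nonneg) auto
  also have "(LINT \<omega>|M. ?A + ?V \<omega>) = ?A + (LINT \<omega>|M. ?V \<omega>)"
    using V(1) by (subst Bochner_Integration.integral_add) (auto simp: prob_space)
  finally show ?thesis
    unfolding risk using squared_bias_le[OF g_nonneg integrable_g integral_g g2 m M2 int le cl pars n k] V(2)
    by (auto intro!: ennreal_leI)
qed

text \<open>Moving the division by G under the root leaves a product and a multiple of the given
  null sequences.\<close>

lemma sqrt_mult_divide_tendsto_0:
  fixes G :: "nat \<Rightarrow> real"
  assumes 1: "(\<lambda>m. real m powr p / G m) \<longlonglongrightarrow> 0" and 2: "(\<lambda>m. 1 / G m) \<longlonglongrightarrow> 0" and G: "\<And>m. m \<ge> 1 \<Longrightarrow> 0 < G m"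
  shows "(\<lambda>m. sqrt (real m powr p * (a + b * G m)) / G m) \<longlonglongrightarrow> 0"
proof -
  have "(\<lambda>m. sqrt (a * ((real m powr p / G m) * (1 / G m)) + b * (real m powr p / G m))) \<longlonglongrightarrow> sqrt (a * (0 * 0) + b * 0)"
    by (intro tendsto_intros 1 2)
  moreover have "\<forall>\<^sub>F m in sequentially. sqrt (a * ((real m powr p / G m) * (1 / G m)) + b * (real m powr p / G m))
      = sqrt (real m powr p * (a + b * G m)) / G m"
    using eventually_ge_at_top[of 1]
  proof eventually_elim
    case (elim m)
    have "a * ((real m powr p / G m) * (1 / G m)) + b * (real m powr p / G m) = real m powr p * (a + b * G m) / (G m)\<^sup>2"
      using G[OF elim] by (simp add: power2_eq_square field_simps)
    then show ?case using G[OF elim] by (simp add: real_sqrt_divide)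
  qed
  ultimately show ?thesis by (simp add: filterlim_cong[OF refl refl])
qed

lemma band_recip_le:
  fixes F :: "real \<Rightarrow> complex"
  assumes par: "0 \<le> \<gamma>" "0 \<le> \<mu>" "0 \<le> \<delta>" and \<kappa>: "0 < \<kappa>" and F: "F \<in> borel_measurable borel"
    and lower: "\<And>x. \<kappa> * (x\<^sup>2 + 1) powr (- \<gamma> / 2) * exp (- \<mu> * pow0 \<bar>x\<bar> \<delta>) \<le> cmod (F x)"
  shows "bounded_borel (recip_band F m)"
    and "(LINT x|band m. (norm (recip_band F m x))\<^sup>2) / (2 * pi)
      \<le> (LINT x|lborel. indicator {0..pi * m} x *\<^sub>R weight \<gamma> \<mu> \<delta> x) / (pi * \<kappa>\<^sup>2)"
proof -
  note [measurable] = F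
  have meas: "recip_band F m \<in> borel_measurable borel"
    unfolding recip_band_def[abs_def] by measurable
  have sq: "(norm (recip_band F m x))\<^sup>2 \<le> weight \<gamma> \<mu> \<delta> x / \<kappa>\<^sup>2" for x
  proof -
    let ?l = "\<kappa> * (x\<^sup>2 + 1) powr (- \<gamma> / 2) * exp (- \<mu> * pow0 \<bar>x\<bar> \<delta>)"
    have p: "0 < x\<^sup>2 + 1" by (simp add: add_nonneg_pos)
    then have l: "0 < ?l" using \<kappa> by simp
    have "norm (recip_band F m x) \<le> 1 / ?l"
      using l lower[of x] by (auto simp: recip_band_def norm_divide intro!: divide_left_mono mult_pos_pos)
    then have "(norm (recip_band F m x))\<^sup>2 \<le> (1 / ?l)\<^sup>2" by (intro power_mono) auto
    also have "(1 / ?l)\<^sup>2 = weight \<gamma> \<mu> \<delta> x / \<kappa>\<^sup>2"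
    proof -
      have "((x\<^sup>2 + 1) powr (- \<gamma> / 2))\<^sup>2 = 1 / (x\<^sup>2 + 1) powr \<gamma>"
        using p by (simp add: power2_eq_square powr_add[symmetric] powr_minus_divide)
      moreover have "(exp (- \<mu> * pow0 \<bar>x\<bar> \<delta>))\<^sup>2 = 1 / exp (2 * \<mu> * pow0 \<bar>x\<bar> \<delta>)"
      proof -
        have "(exp (- \<mu> * pow0 \<bar>x\<bar> \<delta>))\<^sup>2 = exp (- (2 * \<mu> * pow0 \<bar>x\<bar> \<delta>))"
          by (simp add: power2_eq_square flip: exp_add)
        then show ?thesis by (simp add: exp_minus divide_inverse)
      qed
      ultimately show ?thesis by (simp add: weight_def power_divide power_mult_distrib)
    qed
    finally show ?thesis .
  qed
  have \<kappa>2: "0 < \<kappa>\<^sup>2" using \<kappa> by simp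
  have sq_a: "(norm (recip_band F m x))\<^sup>2 \<le> weight \<gamma> \<mu> \<delta> (pi * m) / \<kappa>\<^sup>2" for x
  proof (cases "\<bar>x\<bar> \<le> pi * m")
    case True
    then have "weight \<gamma> \<mu> \<delta> x / \<kappa>\<^sup>2 \<le> weight \<gamma> \<mu> \<delta> (pi * m) / \<kappa>\<^sup>2"
      using par \<kappa>2 by (intro divide_right_mono weight_mono) auto
    then show ?thesis using sq[of x] by simp
  next
    case False
    then show ?thesis using \<kappa>2 by (simp add: recip_band_def weight_nonneg)
  qed
  show "bounded_borel (recip_band F m)"
    using sq_a by (intro bounded_borelI[OF meas, of "sqrt (weight \<gamma> \<mu> \<delta> (pi * m) / \<kappa>\<^sup>2)"] real_le_rsqrt)
  have "(LINT x|band m. (norm (recip_band F m x))\<^sup>2) \<le> (LINT x|band m. weight \<gamma> \<mu> \<delta> x / \<kappa>\<^sup>2)"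
  proof (rule integral_mono_AE)
    show "integrable (band m) (\<lambda>x. (norm (recip_band F m x))\<^sup>2)"
      using meas sq_a by (intro integrable_bandI[of _ "weight \<gamma> \<mu> \<delta> (pi * m) / \<kappa>\<^sup>2"]) auto
    have "integrable (band m) (weight \<gamma> \<mu> \<delta>)"
    proof -
      interpret finite_measure "band m" by (rule finite_measure_band)
      show ?thesis
      proof (rule integrable_const_bound[of _ "weight \<gamma> \<mu> \<delta> (pi * m)"])
        show "AE x in band m. norm (weight \<gamma> \<mu> \<delta> x) \<le> weight \<gamma> \<mu> \<delta> (pi * m)"
          using AE_band[of m] by eventually_elim (use par in \<open>auto simp: weight_nonneg intro!: weight_mono\<close>)
      qed measurable
    qed
    then show "integrable (band m) (\<lambda>x. weight \<gamma> \<mu> \<delta> x / \<kappa>\<^sup>2)" by simp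
  qed (simp add: sq)
  also have "\<dots> = 2 * (LINT x|lborel. indicator {0..pi * m} x *\<^sub>R weight \<gamma> \<mu> \<delta> x) / \<kappa>\<^sup>2"
    by (simp only: integral_divide_zero integral_band_weight[OF par])
  finally show "(LINT x|band m. (norm (recip_band F m x))\<^sup>2) / (2 * pi)
      \<le> (LINT x|lborel. indicator {0..pi * m} x *\<^sub>R weight \<gamma> \<mu> \<delta> x) / (pi * \<kappa>\<^sup>2)"
    by (simp add: field_simps)
qed

theorem corollary4p1:
  fixes f\<epsilon> :: "real \<Rightarrow> real"
    and \<kappa>0 \<kappa>0' \<gamma> \<mu> \<delta> M2 s r b C1 :: real
  assumes f\<epsilon>_L2: "square_integrable f\<epsilon>"
    and f\<epsilon>_nz: "\<forall>x. fourier_real f\<epsilon> x \<noteq> 0"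
    and params: "0 < \<kappa>0" "0 < \<kappa>0'" "0 \<le> \<gamma>" "0 \<le> \<mu>" "0 \<le> \<delta>" "\<delta> > 0 \<Longrightarrow> \<mu> > 0"
    and f\<epsilon>_bounds: "\<forall>x. \<kappa>0 * (x\<^sup>2 + 1) powr (- \<gamma> / 2) * exp (- \<mu> * pow0 \<bar>x\<bar> \<delta>)
                          \<le> cmod (fourier_real f\<epsilon> x) \<and>
                        cmod (fourier_real f\<epsilon> x)
                          \<le> \<kappa>0' * (x\<^sup>2 + 1) powr (- \<gamma> / 2) * exp (- \<mu> * pow0 \<bar>x\<bar> \<delta>)"
    and class_pars: "0 < M2" "0 \<le> s" "0 \<le> r" "0 \<le> b"
  shows "\<exists>(C2 :: real \<Rightarrow> real) (rem :: nat \<Rightarrow> real).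
    rem \<longlonglongrightarrow> 0 \<and>
    (\<forall>(M :: 'a measure) (Y :: nat \<Rightarrow> 'a \<Rightarrow> real) \<sigma> \<eta> g (k :: nat \<Rightarrow> int) (B :: real).
       volatility_model M Y \<sigma> \<eta> f\<epsilon> g \<and>
       square_integrable g \<and>
       integrable lborel (\<lambda>x. x\<^sup>2 * (g x)\<^sup>2) \<and> (LINT x|lborel. x\<^sup>2 * (g x)\<^sup>2) \<le> M2 \<and>
       g \<in> smoothness_class s r b C1 \<and>
       (\<forall>n\<ge>1. int n \<le> k n) \<and>
       0 \<le> B \<and>
       ((\<Sum>i. beta1 M Y \<sigma> (Suc i)) = ennreal B \<or>
        \<delta> = 0 \<and> \<gamma> > 1 \<and> integrable M (\<lambda>\<omega>. l1norm (W_proc Y \<sigma> 0 \<omega>)) \<and>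
          (\<Sum>i. tau1 M Y \<sigma> (Suc i)) = ennreal B \<or>
        \<delta> > 0 \<and> integrable M (\<lambda>\<omega>. l1norm (W_proc Y \<sigma> 0 \<omega>)) \<and>
          (\<Sum>i. tau1 M Y \<sigma> (Suc i)) = ennreal B)
     \<longrightarrow>
       (\<forall>n\<ge>1. \<forall>m\<ge>1.
          (\<integral>\<^sup>+\<omega>. ennreal ((l2norm (\<lambda>x. g x -
              estimator f\<epsilon> m (k n) n (\<lambda>i. log_sq Y i \<omega>) x))\<^sup>2) \<partial>M)
          \<le> ennreal (C1 / (2 * pi) * ((real m)\<^sup>2 * pi\<^sup>2 + 1) powr (- s) *
                       exp (- 2 * b * pi powr r * real m powr r)
                     + 2 * lambda1 \<kappa>0 \<mu> \<delta> * Gamma_rate \<gamma> \<mu> \<delta> m / real n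
                     + C2 B / real n * Gamma_rate \<gamma> \<mu> \<delta> m * rem m)))"
proof -
  define G where "G = Gamma_rate \<gamma> \<mu> \<delta>"
  define l where "l = lambda1 \<kappa>0 \<mu> \<delta>"
  have par: "0 \<le> \<gamma>" "0 \<le> \<mu>" "0 \<le> \<delta>" "\<delta> > 0 \<Longrightarrow> \<mu> > 0" by (rule params)+
  have G_pos: "0 < G m" if "m \<ge> 1" for m using Gamma_rate_pos[OF that] by (simp add: G_def)
  have l0: "0 \<le> l" using params by (auto simp: l_def lambda1_def R_const_def)
  obtain c where c: "0 \<le> c"
    "\<And>m::nat. (LINT x|lborel. indicator {0..pi * m} x *\<^sub>R weight \<gamma> \<mu> \<delta> x) \<le> c + 2 * G m / R_const \<mu> \<delta>"
    using integral_weight_le[OF par] unfolding G_def by blast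
  \<comment> \<open>The added 1 makes \<open>c'\<close>, and with it \<open>D m\<close>, positive
    even if c = 0; the covariance bounds divide by sqrt (m D).\<close>
  define c' where "c' = (c + 1) / (pi * \<kappa>0\<^sup>2)"
  have c': "0 < c'" using c params by (simp add: c'_def)
  define D where "D m = c' + 2 * l * G m" for m
  have D0: "0 < D m" if "m \<ge> 1" for m
    using c' l0 G_pos[OF that] by (auto simp: D_def intro!: add_pos_nonneg)
  define S where "S m = sqrt (real m * D m)" for m
  define Q where "Q m = (real m * sqrt M2 + sqrt (real m) / pi)\<^sup>2" for m
  \<comment> \<open>All that is left beside the leading term \<open>2 * l * G m\<close>: the
    truncated coefficients, the constant in \<open>D\<close>, and twice the covariance scale, which
    is 2 S for beta and pi m S for tau. The tau part enters only where it is negligible against the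
    rate, so that case 1 is covered for small \<open>\<gamma>\<close> too.\<close>
  define T where "T m = 2 * Q m + c' + 4 * S m + (if \<delta> > 0 \<or> \<gamma> > 1 then 2 * pi * (real m * S m) else 0)" for m
  \<comment> \<open>If the condition fails, then \<open>f\<epsilon>\<close> is not square integrable and there is nothing to bound.\<close>
  define rem where "rem m = (if \<delta> > 0 \<or> \<gamma> > 1 / 2 then T m / G m else 0)" for m
  have rem: "rem \<longlonglongrightarrow> 0"
  proof (cases "\<delta> > 0 \<or> \<gamma> > 1 / 2")
    case True
    have dom: "(\<lambda>m. real m powr p / G m) \<longlonglongrightarrow> 0" if "\<delta> > 0 \<or> p < 2 * \<gamma> + 1" for p
      unfolding G_def by (rule Gamma_rate_dominates[OF par that])
    have inv: "(\<lambda>m. 1 / G m) \<longlonglongrightarrow> 0"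
    proof (rule Lim_transform_eventually[OF dom[of 0]])
      show "\<forall>\<^sub>F m in sequentially. real m powr 0 / G m = 1 / G m"
        using eventually_ge_at_top[of 1] by eventually_elim simp
    qed (use par in auto)
    have 1: "(\<lambda>m. Q m / G m) \<longlonglongrightarrow> 0"
    proof (rule tendsto_sandwich[OF _ _ tendsto_const])
      show "(\<lambda>m. (sqrt M2 + 1)\<^sup>2 * (real m powr 2 / G m)) \<longlonglongrightarrow> 0"
        using tendsto_mult_left[OF dom[of 2], of "(sqrt M2 + 1)\<^sup>2"] True by auto
      show "\<forall>\<^sub>F m in sequentially. 0 \<le> Q m / G m"
        using eventually_ge_at_top[of 1] by eventually_elim (use G_pos in \<open>auto simp: Q_def less_imp_le\<close>)
      show "\<forall>\<^sub>F m in sequentially. Q m / G m \<le> (sqrt M2 + 1)\<^sup>2 * (real m powr 2 / G m)"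
        using eventually_ge_at_top[of 1]
      proof eventually_elim
        case (elim m)
        have "sqrt (real m) \<le> real m" using elim by (intro real_le_lsqrt) (auto simp: power2_eq_square)
        moreover have "real m \<le> real m * pi" using pi_gt3 by (simp add: mult_le_cancel_left1)
        ultimately have "sqrt (real m) / pi \<le> real m" by (simp add: divide_le_eq)
        then have "real m * sqrt M2 + sqrt (real m) / pi \<le> (sqrt M2 + 1) * real m" by (simp add: algebra_simps)
        then have "Q m \<le> ((sqrt M2 + 1) * real m)\<^sup>2"
          unfolding Q_def using class_pars by (intro power_mono) auto
        then have "Q m / G m \<le> ((sqrt M2 + 1) * real m)\<^sup>2 / G m"
          using G_pos[OF elim] by (intro divide_right_mono) auto
        then show ?case by (simp add: power_mult_distrib)
      qed
    qed
    have 2: "(\<lambda>m. S m / G m) \<longlonglongrightarrow> 0"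
    proof -
      have "(\<lambda>m. sqrt (real m powr 1 * (c' + 2 * l * G m)) / G m) \<longlonglongrightarrow> 0"
        using True par by (intro sqrt_mult_divide_tendsto_0 dom inv G_pos) auto
      then show ?thesis by (simp add: S_def D_def)
    qed
    have 3: "(\<lambda>m. (real m * S m) / G m) \<longlonglongrightarrow> 0" if "\<delta> > 0 \<or> \<gamma> > 1"
    proof -
      have "(\<lambda>m. sqrt (real m powr 3 * (c' + 2 * l * G m)) / G m) \<longlonglongrightarrow> 0"
        using that par by (intro sqrt_mult_divide_tendsto_0 dom inv G_pos) auto
      moreover have "sqrt (real m powr 3 * (c' + 2 * l * G m)) = real m * S m" for m
        by (simp add: S_def D_def real_sqrt_mult power3_eq_cube)
      ultimately show ?thesis by simp
    qed
    have "(\<lambda>m. 2 * (Q m / G m) + c' * (1 / G m) + 4 * (S m / G m)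
        + (if \<delta> > 0 \<or> \<gamma> > 1 then 2 * pi * ((real m * S m) / G m) else 0)) \<longlonglongrightarrow> 2 * 0 + c' * 0 + 4 * 0 + 0"
    proof (intro tendsto_add tendsto_mult_left 1 2 inv)
      show "(\<lambda>m. if \<delta> > 0 \<or> \<gamma> > 1 then 2 * pi * ((real m * S m) / G m) else 0) \<longlonglongrightarrow> 0"
        using tendsto_mult_left[OF 3, of "2 * pi"] by (cases "\<delta> > 0 \<or> \<gamma> > 1") auto
    qed
    moreover have "2 * (Q m / G m) + c' * (1 / G m) + 4 * (S m / G m)
        + (if \<delta> > 0 \<or> \<gamma> > 1 then 2 * pi * ((real m * S m) / G m) else 0) = rem m" for m
      using True by (simp add: rem_def T_def add_divide_distrib)
    ultimately show ?thesis by (simp only:) simp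
  next
    case False
    then show ?thesis by (auto simp: rem_def[abs_def])
  qed
  show ?thesis
  \<comment> \<open>The remainder has a part free of B and a part linear in B, each bounded by T;
    hence the factor 1 + B.\<close>
  proof (intro exI[of _ "\<lambda>B. 1 + B"] exI[of _ rem] conjI allI impI)
    show "rem \<longlonglongrightarrow> 0" by (rule rem)
    fix M :: "'a measure" and Y \<sigma> :: "nat \<Rightarrow> 'a \<Rightarrow> real" and \<eta> g and k :: "nat \<Rightarrow> int" and B :: real and n m :: nat
    assume H: "volatility_model M Y \<sigma> \<eta> f\<epsilon> g \<and> square_integrable g \<and>
       integrable lborel (\<lambda>x. x\<^sup>2 * (g x)\<^sup>2) \<and> (LINT x|lborel. x\<^sup>2 * (g x)\<^sup>2) \<le> M2 \<and>
       g \<in> smoothness_class s r b C1 \<and> (\<forall>n\<ge>1. int n \<le> k n) \<and> 0 \<le> B \<and>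
       ((\<Sum>i. beta1 M Y \<sigma> (Suc i)) = ennreal B \<or>
        \<delta> = 0 \<and> \<gamma> > 1 \<and> integrable M (\<lambda>\<omega>. l1norm (W_proc Y \<sigma> 0 \<omega>)) \<and>
          (\<Sum>i. tau1 M Y \<sigma> (Suc i)) = ennreal B \<or>
        \<delta> > 0 \<and> integrable M (\<lambda>\<omega>. l1norm (W_proc Y \<sigma> 0 \<omega>)) \<and>
          (\<Sum>i. tau1 M Y \<sigma> (Suc i)) = ennreal B)"
      and n: "1 \<le> n" and m: "1 \<le> m"
    interpret volatility_model M Y \<sigma> \<eta> f\<epsilon> g using H by blast
    have B: "0 \<le> B" and k: "int n \<le> k n" and g2: "integrable lborel (\<lambda>x. (g x)\<^sup>2)"
      and gM: "integrable lborel (\<lambda>x. x\<^sup>2 * (g x)\<^sup>2)" "(LINT x|lborel. x\<^sup>2 * (g x)\<^sup>2) \<le> M2"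
      and cl: "g \<in> smoothness_class s r b C1"
      using H n by (auto simp: square_integrable_def)
    have lower: "\<kappa>0 * (x\<^sup>2 + 1) powr (- \<gamma> / 2) * exp (- \<mu> * pow0 \<bar>x\<bar> \<delta>) \<le> cmod (fourier_real f\<epsilon> x)" for x
      using f\<epsilon>_bounds by blast
    have F: "fourier_real f\<epsilon> \<in> borel_measurable borel"
    proof -
      have "fourier_real f\<epsilon> = ft f\<epsilon>" using integrable_f\<epsilon> by (intro ext fourier_eq_ft) simp
      then show ?thesis using integrable_f\<epsilon> by (auto dest: borel_measurable_integrable)
    qed
    note recip = band_recip_le[OF par(1-3) params(1) F lower, of m]
    \<comment> \<open>That the noise function is a probability density comes from the model, so this
      is available only now, after \<open>rem\<close> has been fixed.\<close>
    have good: "\<delta> > 0 \<or> \<gamma> > 1 / 2"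
    proof (cases "\<delta> = 0")
      case True
      have "1 / 2 < \<gamma>"
      proof (rule decay_exponent_gt_half[OF f\<epsilon>_nonneg integrable_f\<epsilon> integral_f\<epsilon> _ _ par(1)])
        show "integrable lborel (\<lambda>x. (f\<epsilon> x)\<^sup>2)" using f\<epsilon>_L2 by (simp add: square_integrable_def)
        \<comment> \<open>For \<open>\<delta> = 0\<close> the exponential factor of the lower bound
          is the constant \<open>exp (- \<mu>)\<close>, as \<open>pow0\<close> is 1 for exponent
          0.\<close>
        show "0 < \<kappa>0 * exp (- \<mu>)" using params by simp
        show "\<kappa>0 * exp (- \<mu>) * (x\<^sup>2 + 1) powr (- \<gamma> / 2) \<le> cmod (fourier_real f\<epsilon> x)" for x
          using lower[of x] True by (simp add: pow0_def mult_ac)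
      qed
      then show ?thesis by simp
    qed (use par in auto)
    have Delta: "(LINT x|band m. (norm (recip_band (fourier_real f\<epsilon>) m x))\<^sup>2) / (2 * pi) \<le> D m"
    proof -
      have "(LINT x|lborel. indicator {0..pi * m} x *\<^sub>R weight \<gamma> \<mu> \<delta> x) / (pi * \<kappa>0\<^sup>2) \<le> (c + 1 + 2 * G m / R_const \<mu> \<delta>) / (pi * \<kappa>0\<^sup>2)"
        using c(2)[of m] params by (intro divide_right_mono) auto
      also have "\<dots> = D m"
        by (simp add: D_def c'_def l_def lambda1_def add_divide_distrib mult_ac)
      finally show ?thesis using recip(2) by simp
    qed
    \<comment> \<open>Twice the covariance scale of whichever case applies is one of the summands of
      T; for tau the case assumptions supply the condition under which that summand is
      present.\<close>
    obtain q where q: "(\<Sum>i. beta1 M Y \<sigma> (Suc i)) = ennreal B \<and> q = 2 * sqrt (m * D m) \<or>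
      (\<Sum>i. tau1 M Y \<sigma> (Suc i)) = ennreal B \<and> q = pi * m * sqrt (m * D m)"
      "2 * Q m + c' + 2 * q \<le> T m"
    proof -
      have S0: "0 \<le> S m" using D0[OF m] by (simp add: S_def)
      show thesis
      proof (cases "(\<Sum>i. beta1 M Y \<sigma> (Suc i)) = ennreal B")
        case True
        show thesis
          by (rule that[of "2 * S m"]) (use True S0 in \<open>auto simp: S_def[symmetric] T_def\<close>)
      next
        case False
        then have "\<delta> > 0 \<or> \<gamma> > 1" "(\<Sum>i. tau1 M Y \<sigma> (Suc i)) = ennreal B" using H by auto
        then show thesis
          by (intro that[of "pi * m * S m"]) (use S0 in \<open>auto simp: S_def[symmetric] T_def\<close>)
      qed
    qed
    have "0 \<le> q" using q(1) D0[OF m] by auto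
    have "2 * (m * sqrt M2 + sqrt m / pi)\<^sup>2 / n + (D m + 2 * (q * B)) / n
      = (2 * l * G m + (2 * Q m + c' + 2 * (q * B))) / n"
      by (simp add: D_def Q_def add_divide_distrib)
    also have "\<dots> \<le> (2 * l * G m + (1 + B) * T m) / n"
    proof (intro divide_right_mono add_left_mono)
      have "0 \<le> Q m" by (simp add: Q_def)
      then have QT: "2 * Q m + c' + 2 * q \<le> T m" "2 * q \<le> T m" using q(2) c' by linarith+
      then have "B * (2 * q) \<le> B * T m" using B by (intro mult_left_mono)
      then show "2 * Q m + c' + 2 * (q * B) \<le> (1 + B) * T m" using QT \<open>0 \<le> q\<close> by (simp add: algebra_simps)
    qed simp
    also have "\<dots> = 2 * l * G m / n + (1 + B) / n * G m * rem m"
      using G_pos[OF m] good by (simp add: rem_def add_divide_distrib distrib_right)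
    finally have final: "2 * (m * sqrt M2 + sqrt m / pi)\<^sup>2 / n + (D m + 2 * (q * B)) / n
      \<le> 2 * l * G m / n + (1 + B) / n * G m * rem m" .
    have nz: "fourier_real f\<epsilon> x \<noteq> 0" for x using f\<epsilon>_nz by blast
    show "(\<integral>\<^sup>+\<omega>. ennreal ((l2norm (\<lambda>x. g x -
              estimator f\<epsilon> m (k n) n (\<lambda>i. log_sq Y i \<omega>) x))\<^sup>2) \<partial>M)
          \<le> ennreal (C1 / (2 * pi) * ((real m)\<^sup>2 * pi\<^sup>2 + 1) powr (- s) *
                       exp (- 2 * b * pi powr r * real m powr r)
                     + 2 * lambda1 \<kappa>0 \<mu> \<delta> * Gamma_rate \<gamma> \<mu> \<delta> m / real n
                     + (1 + B) / real n * Gamma_rate \<gamma> \<mu> \<delta> m * rem m)"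
      by (rule order_trans[OF risk_le[OF m recip(1) Delta D0[OF m] nz g2 class_pars(1) gM cl class_pars(2-4) n k B q(1)]])
        (use final in \<open>auto intro!: ennreal_leI simp: G_def l_def\<close>)
  qed
qed

end
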